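(* Let $X$ be a recurrent $\alpha$-stable process with $\alpha\in(1,2)$, $\beta\in[-1,1]$ and characteristic exponent $\Psi(\lambda)=|\lambda|^\alpha\left(1-i\beta\,\mathrm{sgn}(\lambda)\tan\frac{\pi\alpha}{2}\right)$, let $\rho:=\mathbb{P}_0(X_t\ge0)$ (independent of $t>0$) and $\hat\rho:=1-\rho$. Let $a<b$. Then $$\mu_{[a,b]}(dy)=\frac{(b-a)^{\alpha-1}}{\mathrm{B}(1-\alpha\hat\rho,1-\alpha\rho)}(b-y)^{-\alpha\rho}(y-a)^{-\alpha\hat\rho}\,1_{(a,b)}(y)\,dy,$$ $$k([a,b])=-\frac{(b-a)^{\alpha-1}\,\pi\cos\left(\pi\alpha\left(\rho-\frac12\right)\right)}{\Gamma(\alpha)\sin(\pi\alpha)\,\mathrm{B}(1-\alpha\rho,1-\alpha\hat\rho)},$$ where $\mathrm{B}(\cdot,\cdot)$ is the Beta function and $\Gamma$ the Gamma function.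
   Context: $X=((X_t)_{t\ge 0},(\mathbb{P}_x)_{x\in\mathbb{R}})$ has $\mathbb{P}_x(X_0=x)=1$ and $\mathbb{E}_0[e^{i\lambda X_t}]=e^{-t\Psi(\lambda)}$. One has $\rho=\frac12+\frac{1}{\pi\alpha}\tan^{-1}\left(\beta\tan\frac{\pi\alpha}{2}\right)$, and $\rho$ ranges over $[1-\frac1\alpha,\frac1\alpha]$. For each $q>0$ the process has a bounded continuous resolvent density $r_q(x)=\frac1\pi\int_0^\infty \Re\left(\frac{e^{-i\lambda x}}{q+\Psi(\lambda)}\right)d\lambda$, so that $\int f(y)r_q(y-x)\,dy=\mathbb{E}_x\left[\int_0^\infty e^{-qt}f(X_t)\,dt\right]$ for bounded measurable $f$. For a Borel set $A$, $T_A:=\inf\{t\ge 0: X_t\in A\}$. For $q>0$ and nonempty compact $B$, the $q$-capacity measure $m_B^q$ is the unique measure such that $\mathbb{E}_x[e^{-qT_B}]=\int r_q(y-x)\,m_B^q(dy)$ for all $x$; it is supported on $B$. The equilibrium measure $\mu_B$ is the probability measure with support in $B$ that is the weak limit of $r_q(0)m_B^q$ as $q\to0$, and the Robin constant is $k(B):=\lim_{q\to0}r_q(0)\big(r_q(0)m_B^q(B)-1\big)$ (both limits exist).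
   Formalization: For β=1 (αρ̂=1) and β=−1 (αρ=1) the Beta function is infinite and the displayed density is not a probability density; the density formula is stated for |β|<1, and μ_{[a,b]} is the point mass at a for β=1 and at b for β=−1, with k([a,b])=0 in both cases. *)

theory Defs
  imports "HOL-Probability.Probability"
begin

text \<open>
  A real Levy process together with all its starting points: \<open>P x\<close> is the law under which
  \<open>X\<close> starts in \<open>x\<close>. The laws live on one measurable space, and \<open>P x\<close> makes \<open>X\<close> a
  copy of \<open>x + X\<close> under \<open>P 0\<close>. Time is the half-line of nonnegative reals; the values of
  \<open>X t\<close> for negative \<open>t\<close> play no role.
\<close>

locale levy_process =
  fixes P :: "real \<Rightarrow> 'w measure" and X :: "real \<Rightarrow> 'w \<Rightarrow> real"
  assumes prob: "prob_space (P x)"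
    and sets_eq: "sets (P x) = sets (P 0)"
    and measurable: "t \<ge> 0 \<Longrightarrow> X t \<in> borel_measurable (P x)"
    and start: "AE w in P x. X 0 w = x"
    and right_continuous:
      "AE w in P x. \<forall>t\<ge>0. ((\<lambda>s. X s w) \<longlongrightarrow> X t w) (at_right t)"
    and left_limits:
      "AE w in P x. \<forall>t>0. \<exists>l. ((\<lambda>s. X s w) \<longlongrightarrow> l) (at_left t)"
    and independent_increments:
      "mono (ts :: nat \<Rightarrow> real) \<Longrightarrow> ts 0 \<ge> 0 \<Longrightarrow>
        prob_space.indep_vars (P 0) (\<lambda>_. borel) (\<lambda>i w. X (ts (Suc i)) w - X (ts i) w) {..<n}"
    and stationary_increments:
      "0 \<le> s \<Longrightarrow> s \<le> t \<Longrightarrow>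
        distr (P 0) borel (\<lambda>w. X t w - X s w) = distr (P 0) borel (X (t - s))"
    and translation:
      "distr (P x) (PiM {0..} (\<lambda>_. borel)) (\<lambda>w. \<lambda>t\<in>{0..}. X t w)
        = distr (P 0) (PiM {0..} (\<lambda>_. borel)) (\<lambda>w. \<lambda>t\<in>{0..}. x + X t w)"

definition recurrent_process :: "(real \<Rightarrow> 'w measure) \<Rightarrow> (real \<Rightarrow> 'w \<Rightarrow> real) \<Rightarrow> bool" where
  "recurrent_process P X \<longleftrightarrow> (AE w in P 0. Liminf at_top (\<lambda>t. ereal \<bar>X t w\<bar>) = 0)"

definition stable_exponent :: "real \<Rightarrow> real \<Rightarrow> real \<Rightarrow> complex" where
  "stable_exponent \<alpha> \<beta> \<xi> =
     of_real (\<bar>\<xi>\<bar> powr \<alpha>) * (1 - \<i> * of_real (\<beta> * sgn \<xi> * tan (pi * \<alpha> / 2)))"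

locale stable_process = levy_process P X
  for P :: "real \<Rightarrow> 'w measure" and X :: "real \<Rightarrow> 'w \<Rightarrow> real" +
  fixes \<alpha> \<beta> :: real
  assumes characteristic_exponent:
    "t \<ge> 0 \<Longrightarrow> char (distr (P 0) borel (X t)) \<xi> = exp (- of_real t * stable_exponent \<alpha> \<beta> \<xi>)"

definition resolvent_density :: "(real \<Rightarrow> complex) \<Rightarrow> real \<Rightarrow> real \<Rightarrow> real" where
  "resolvent_density \<Psi> q x =
     1 / pi * (LBINT \<xi>:{0..}. Re (iexp (- (\<xi> * x)) / (of_real q + \<Psi> \<xi>)))"

definition hitting_time :: "(real \<Rightarrow> 'w \<Rightarrow> real) \<Rightarrow> real set \<Rightarrow> 'w \<Rightarrow> ereal" where
  "hitting_time X A w = (INF t \<in> {t. 0 \<le> t \<and> X t w \<in> A}. ereal t)"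

text \<open>
  The expectation of \<open>exp (- q T)\<close>, with value \<open>0\<close> of the integrand where \<open>T\<close> is infinite.
  By the debut theorem \<open>T\<close> is measurable for the completed \<open>\<sigma>\<close>-algebra, in general not
  for the original one; hence the completion.
\<close>

definition hitting_laplace ::
    "(real \<Rightarrow> 'w measure) \<Rightarrow> (real \<Rightarrow> 'w \<Rightarrow> real) \<Rightarrow> real \<Rightarrow> real set \<Rightarrow> real \<Rightarrow> real" where
  "hitting_laplace P X q A x =
     (LINT w|completion (P x).
        (if hitting_time X A w = \<infinity> then 0 else exp (- q * real_of_ereal (hitting_time X A w))))"

definition is_capacity_measure ::
    "(real \<Rightarrow> 'w measure) \<Rightarrow> (real \<Rightarrow> 'w \<Rightarrow> real) \<Rightarrow> (real \<Rightarrow> complex)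
      \<Rightarrow> real \<Rightarrow> real set \<Rightarrow> real measure \<Rightarrow> bool" where
  "is_capacity_measure P X \<Psi> q B m \<longleftrightarrow>
     finite_measure m \<and> sets m = sets borel \<and> emeasure m (- B) = 0 \<and>
     (\<forall>x. hitting_laplace P X q B x = (LINT y|m. resolvent_density \<Psi> q (y - x)))"

definition weak_limit :: "('i \<Rightarrow> real measure) \<Rightarrow> real measure \<Rightarrow> 'i filter \<Rightarrow> bool" where
  "weak_limit M N F \<longleftrightarrow>
     (\<forall>f :: real \<Rightarrow> real. continuous_on UNIV f \<longrightarrow> bounded (range f) \<longrightarrow>
        ((\<lambda>i. LINT x|M i. f x) \<longlongrightarrow> (LINT x|N. f x)) F)"

text \<open>In the next two definitions \<open>m q\<close> is the \<open>q\<close>-capacity measure of \<open>B\<close> for each \<open>q > 0\<close>.\<close>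

definition is_equilibrium_measure ::
    "(real \<Rightarrow> complex) \<Rightarrow> real set \<Rightarrow> (real \<Rightarrow> real measure) \<Rightarrow> real measure \<Rightarrow> bool" where
  "is_equilibrium_measure \<Psi> B m \<mu> \<longleftrightarrow>
     prob_space \<mu> \<and> sets \<mu> = sets borel \<and> emeasure \<mu> (- B) = 0 \<and>
     weak_limit (\<lambda>q. scale_measure (ennreal (resolvent_density \<Psi> q 0)) (m q)) \<mu> (at_right 0)"

definition is_robin_constant ::
    "(real \<Rightarrow> complex) \<Rightarrow> real set \<Rightarrow> (real \<Rightarrow> real measure) \<Rightarrow> real \<Rightarrow> bool" where
  "is_robin_constant \<Psi> B m k \<longleftrightarrow>
     ((\<lambda>q. resolvent_density \<Psi> q 0 * (resolvent_density \<Psi> q 0 * measure (m q) B - 1)) \<longlongrightarrow> k)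
       (at_right 0)"

end

theory Submission
  imports Defs
begin

text \<open>
  A process that starts in \<open>[a, b]\<close> has already hit \<open>[a, b]\<close> at time \<open>0\<close>, so the defining
  equation of the capacity measure \<open>m\<^sub>q\<close> says that its potential \<open>\<integral> r\<^sub>q (y - x) m\<^sub>q(dy)\<close> equals
  \<open>1\<close> for every \<open>x\<close> in \<open>[a, b]\<close>. From there on the argument is
  potential theory for one explicit kernel.

  Subtract the diverging constant: \<open>h\<^sub>q (x) = r\<^sub>q (0) - r\<^sub>q (x)\<close> is the Fourier integral of
  \<open>Re ((1 - e\<^sup>-\<^sup>i\<^sup>\<xi>\<^sup>x) / (q + \<Psi> \<xi>)) / \<pi>\<close> over \<open>\<xi> > 0\<close>, which makes sense for \<open>q = 0\<close> too, and
  \<open>h\<^sub>q\<close> tends to \<open>h = h\<^sub>0\<close> uniformly on compact sets. If \<open>N\<^sub>q\<close> is \<open>m\<^sub>q\<close> normalized to mass \<open>1\<close>, then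
  the \<open>h\<^sub>q\<close>-potential of \<open>N\<^sub>q\<close> is constant on \<open>[a, b]\<close>, hence its \<open>h\<close>-potential is nearly constant.
  Suppose that a probability measure \<open>M\<close> on \<open>[a, b]\<close> has \<open>h\<close>-potential exactly \<open>k\<close> on \<open>[a, b]\<close>.
  Then the \<open>h\<close>-energy of the neutral charge \<open>N\<^sub>q - M\<close> tends to \<open>0\<close>. In Fourier space this energy is
  \<open>- \<integral> |N\<^sub>q^ - M^|\<^sup>2 Re (1 / \<Psi>)\<close> up to a factor, with a strictly positive weight, and
  characteristic functions of measures on \<open>[a, b]\<close> are equi-Lipschitz; so they converge pointwise, and
  \<open>N\<^sub>q\<close> converges weakly to \<open>M\<close> by Levy's continuity theorem. Since \<open>r\<^sub>q (0)\<close> tends to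
  \<open>\<infinity>\<close>, the masses \<open>r\<^sub>q (0) m\<^sub>q [a, b]\<close> tend to \<open>1\<close> and the Robin constant is \<open>k\<close>
  (\<open>equilibrium_measure_and_robin_constant\<close>).

  It remains to compute. For the stable exponent, \<open>h (x)\<close> is a positive multiple of
  \<open>|x|\<^sup>\<alpha>\<^sup>-\<^sup>1 (1 + \<beta> sgn x)\<close> (\<open>stable_potential_kernel\<close>). For \<open>\<beta> = 1\<close> the kernel vanishes on the
  negative half-line, so the point mass in \<open>a\<close> has potential \<open>0\<close> on \<open>[a, b]\<close>; \<open>\<beta> = - 1\<close> is the mirror
  image. For \<open>|\<beta>| < 1\<close> the density \<open>(b - y)\<^sup>-\<^sup>u (y - a)\<^sup>-\<^sup>v\<close> with \<open>u + v = \<alpha>\<close> has a constant potential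
  (\<open>riesz_potential_constant\<close>): the derivative of the potential is a difference of two Beta
  integrals, which are both multiples of \<open>(x - a)\<^sup>u\<^sup>-\<^sup>1 (b - x)\<^sup>v\<^sup>-\<^sup>1\<close> by a Moebius substitution, and the
  multiples cancel when \<open>(1 + \<beta>) / sin (\<pi> u) = (1 - \<beta>) / sin (\<pi> v)\<close>. With
  \<open>\<rho> = 1/2 + arctan (\<beta> tan (\<pi> \<alpha> / 2)) / (\<pi> \<alpha>)\<close>, which is the Gil-Pelaez inversion formula applied to the law
  of \<open>X t\<close> (\<open>stable_positivity\<close>), this holds for \<open>u = \<alpha> \<rho>\<close> and \<open>v = \<alpha> (1 - \<rho>)\<close>.
\<close>

section \<open>Integrability and Fourier preliminaries\<close>

lemma set_integrable_powr_neg_atLeast_1: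
  fixes e :: real
  assumes "e < -1"
  shows "set_integrable lborel {1..} (\<lambda>x. x powr e)"
proof -
  have "(\<lambda>x. x powr e) integrable_on {1..}"
    using has_integral_powr_to_inf[OF assms, of 1] by (auto simp: integrable_on_def)
  then have "(\<lambda>x. x powr e) absolutely_integrable_on {1..}"
    by (intro nonnegative_absolutely_integrable_1) auto
  then have "set_integrable lebesgue {1..} (\<lambda>x. x powr e)"
    by simp
  then show ?thesis
    unfolding set_integrable_def
    by (subst (asm) integrable_completion) auto
qed

lemma set_integrable_powr_Icc_0_1:
  fixes e :: real
  assumes "e > -1"
  shows "set_integrable lborel {0..1} (\<lambda>x. x powr e)"
proof -
  have "(\<lambda>x. x powr e) absolutely_integrable_on {0..1}"
    by (intro nonnegative_absolutely_integrable_1 integrable_on_powr_from_0 assms) auto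
  then have "set_integrable lebesgue {0..1} (\<lambda>x. x powr e)"
    by simp
  then show ?thesis
    unfolding set_integrable_def
    by (subst (asm) integrable_completion) auto
qed

lemma cmod_one_minus_iexp_le: "cmod (1 - iexp x) \<le> min 2 \<bar>x\<bar>"
proof -
  have "cmod (iexp x - 1) \<le> \<bar>x\<bar>" using iexp_approx1[of x 0] by simp
  moreover have "cmod (1 - iexp x) \<le> cmod 1 + cmod (iexp x)" by (rule norm_triangle_ineq4)
  ultimately show ?thesis by (simp add: norm_minus_commute)
qed

text \<open>
  The resolvent identity, which exhibits the error of replacing \<open>q + \<Psi>\<close> by \<open>\<Psi>\<close> as the limit integrand
  times a factor of modulus at most \<open>1\<close> that tends to \<open>0\<close> with \<open>q\<close>.
\<close>

lemma divide_diff_divide_perturb: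
  fixes p q u :: complex
  assumes "p \<noteq> 0" "q + p \<noteq> 0"
  shows "u / (q + p) - u / p = - ((u / p) * (q / (q + p)))"
  using assms by (simp add: field_simps)

text \<open>
  A common majorant, at frequency \<open>\<xi>\<close>, of all Fourier integrands below for points within distance
  \<open>R\<close> of each other: the numerators vanish linearly at \<open>\<xi> = 0\<close> and are bounded by \<open>2\<close>, while
  the denominators are at least \<open>\<xi>\<^sup>\<alpha>\<close>. The bounds \<open>1 < \<alpha>\<close> and \<open>\<alpha> < 2\<close> make it integrable at
  \<open>\<infinity>\<close> and at \<open>0\<close>.
\<close>

definition kernel_weight :: "real \<Rightarrow> real \<Rightarrow> real \<Rightarrow> real" where
  "kernel_weight \<alpha> R \<xi> = indicator {0..} \<xi> * (min 2 (R * \<xi>) * \<xi> powr (- \<alpha>))"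

lemma kernel_weight_measurable [measurable]: "kernel_weight \<alpha> R \<in> borel_measurable borel"
  unfolding kernel_weight_def by measurable

lemma kernel_weight_nonneg: "R \<ge> 0 \<Longrightarrow> kernel_weight \<alpha> R \<xi> \<ge> 0"
  unfolding kernel_weight_def by (auto simp: indicator_def)

lemma integrable_kernel_weight:
  assumes "1 < \<alpha>" "\<alpha> < 2" "R \<ge> 0"
  shows "integrable lborel (kernel_weight \<alpha> R)"
proof (rule Bochner_Integration.integrable_bound)
  show "integrable lborel (\<lambda>x. R * (indicator {0..1} x *\<^sub>R x powr (1 - \<alpha>))
      + 2 * (indicator {1..} x *\<^sub>R x powr (- \<alpha>)))"
    using set_integrable_powr_neg_atLeast_1[of "-\<alpha>"] set_integrable_powr_Icc_0_1[of "1-\<alpha>"] assms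
    unfolding set_integrable_def by (intro Bochner_Integration.integrable_add integrable_mult_right) auto
  show "AE x in lborel. norm (kernel_weight \<alpha> R x) \<le> norm (R * (indicator {0..1} x *\<^sub>R x powr (1 - \<alpha>))
      + 2 * (indicator {1..} x *\<^sub>R x powr (- \<alpha>)))"
  proof (rule AE_I2)
    fix x :: real
    have e: "x powr (1 - \<alpha>) = x * x powr (-\<alpha>)" if "x > 0"
      using that powr_add[of x 1 "-\<alpha>"] by simp
    have A: "0 \<le> R * (indicator {0..1} x *\<^sub>R x powr (1 - \<alpha>))
      + 2 * (indicator {1..} x *\<^sub>R x powr (- \<alpha>))"
      using assms by (auto intro!: add_nonneg_nonneg mult_nonneg_nonneg simp: indicator_def)
    consider "x \<le> 0" | "0 < x" "x < 1" | "x \<ge> 1" by linarith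
    then have "kernel_weight \<alpha> R x \<le> R * (indicator {0..1} x *\<^sub>R x powr (1 - \<alpha>))
      + 2 * (indicator {1..} x *\<^sub>R x powr (- \<alpha>))"
    proof cases
      case 1
      then show ?thesis using A by (auto simp: kernel_weight_def indicator_def)
    next
      case 2
      have "min 2 (R * x) * x powr (- \<alpha>) \<le> (R * x) * x powr (-\<alpha>)"
        by (intro mult_right_mono) auto
      with 2 show ?thesis by (auto simp: kernel_weight_def indicator_def e)
    next
      case 3
      have "min 2 (R * x) * x powr (- \<alpha>) \<le> 2 * x powr (-\<alpha>)"
        by (intro mult_right_mono) auto
      with 3 assms show ?thesis by (auto simp: kernel_weight_def indicator_def intro: add_increasing)
    qed
    then show "norm (kernel_weight \<alpha> R x) \<le> norm (R * (indicator {0..1} x *\<^sub>R x powr (1 - \<alpha>))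
      + 2 * (indicator {1..} x *\<^sub>R x powr (- \<alpha>)))"
      using kernel_weight_nonneg[OF assms(3), of \<alpha> x] A by simp
  qed
qed simp

lemma set_lebesgue_integral_Re_diff:
  assumes "set_integrable M A f" "set_integrable M A (g :: real \<Rightarrow> complex)"
  shows "(LINT x:A|M. Re (f x)) - (LINT x:A|M. Re (g x)) = (LINT x:A|M. Re (f x - g x))"
  using assms unfolding set_integrable_def set_lebesgue_integral_def
  by (subst Bochner_Integration.integral_diff[symmetric])
     (auto dest: integrable_Re simp: algebra_simps)

lemma Fubini_prob_lborel:
  fixes f :: "real \<Rightarrow> real \<Rightarrow> 'b :: {banach, second_countable_topology}"
  assumes "real_distribution N"
    and [measurable]: "case_prod f \<in> borel_measurable (borel \<Otimes>\<^sub>M borel)"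
    and w: "integrable lborel w"
    and bound: "AE y in N. \<forall>\<xi>. norm (f y \<xi>) \<le> w \<xi>"
  shows "integrable lborel (\<lambda>\<xi>. LINT y|N. f y \<xi>)"
    and "(LINT y|N. LINT \<xi>|lborel. f y \<xi>) = (LINT \<xi>|lborel. LINT y|N. f y \<xi>)"
proof -
  interpret N: real_distribution N by fact
  interpret pair_sigma_finite N lborel by unfold_locales
  have [measurable]: "case_prod f \<in> borel_measurable (N \<Otimes>\<^sub>M lborel)" by measurable
  have m2: "AE y in N. integrable lborel (f y)"
    using bound
  proof eventually_elim
    case (elim y)
    show ?case
      by (rule Bochner_Integration.integrable_bound[OF w])
         (use elim in \<open>auto intro: order_trans[OF _ abs_ge_self]\<close>)
  qed
  have "integrable (N \<Otimes>\<^sub>M lborel) (case_prod f)"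
  proof (rule Fubini_integrable)
    show "integrable N (\<lambda>x. LINT \<xi>|lborel. norm (case_prod f (x, \<xi>)))"
    proof (rule N.integrable_const_bound[where B="LINT \<xi>|lborel. w \<xi>"])
      show "AE x in N. norm (LINT \<xi>|lborel. norm (case_prod f (x, \<xi>))) \<le> (LINT \<xi>|lborel. w \<xi>)"
        using bound m2
        by eventually_elim (auto intro!: integral_mono w simp: Bochner_Integration.integral_nonneg)
    qed measurable
  qed (use m2 in auto)
  then show "integrable lborel (\<lambda>\<xi>. LINT y|N. f y \<xi>)"
    and "(LINT y|N. LINT \<xi>|lborel. f y \<xi>) = (LINT \<xi>|lborel. LINT y|N. f y \<xi>)"
    by (auto intro: integrable_snd Fubini_integral[symmetric])
qed

lemma char_uminus: "char M (- t) = cnj (char M t)"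
proof -
  have "char M (- t) = (LINT x|M. cnj (iexp (t * x)))"
    unfolding char_def by (rule Bochner_Integration.integral_cong) (simp_all add: exp_cnj)
  also have "\<dots> = cnj (char M t)"
    unfolding char_def by (rule Bochner_Integration.integral_cnj)
  finally show ?thesis .
qed

lemma cmod_iexp_diff_le: "cmod (iexp x - iexp y) \<le> \<bar>x - y\<bar>"
proof -
  have "iexp x - iexp y = iexp y * (iexp (x - y) - 1)"
    by (simp add: algebra_simps exp_diff)
  then have "cmod (iexp x - iexp y) = cmod (1 - iexp (x - y))"
    by (simp add: norm_mult norm_minus_commute)
  then show ?thesis using cmod_one_minus_iexp_le[of "x - y"] by simp
qed

lemma cmod_char_diff_le:
  assumes "real_distribution N" and "AE y in N. \<bar>y\<bar> \<le> R"
  shows "cmod (char N s - char N t) \<le> R * \<bar>s - t\<bar>"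
proof -
  interpret N: real_distribution N by fact
  have "char N s - char N t = (LINT y|N. iexp (s * y) - iexp (t * y))"
    unfolding char_def by (intro Bochner_Integration.integral_diff[symmetric] N.integrable_iexp) auto
  also have "cmod \<dots> \<le> (LINT y|N. cmod (iexp (s * y) - iexp (t * y)))"
    by (rule integral_norm_bound)
  also have "\<dots> \<le> R * \<bar>s - t\<bar>"
  proof (rule N.integral_le_const)
    show "integrable N (\<lambda>y. cmod (iexp (s * y) - iexp (t * y)))"
      by (intro integrable_norm Bochner_Integration.integrable_diff N.integrable_iexp) auto
    show "AE y in N. cmod (iexp (s * y) - iexp (t * y)) \<le> R * \<bar>s - t\<bar>"
      using assms(2)
    proof eventually_elim
      case (elim y)
      have "\<bar>s * y - t * y\<bar> = \<bar>y\<bar> * \<bar>s - t\<bar>"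
        by (simp add: abs_mult[symmetric] algebra_simps)
      also have "\<dots> \<le> R * \<bar>s - t\<bar>" using elim by (intro mult_right_mono) auto
      finally show ?case using cmod_iexp_diff_le[of "s * y" "t * y"] by linarith
    qed
  qed
  finally show ?thesis .
qed

lemma integral_scale_measure:
  fixes f :: "'a \<Rightarrow> real"
  assumes [measurable]: "f \<in> borel_measurable M" and "r \<ge> 0"
  shows "(LINT x|scale_measure (ennreal r) M. f x) = r * (LINT x|M. f x)"
proof -
  have "scale_measure (ennreal r) M = density M (\<lambda>_. ennreal r)"
    by (rule measure_eqI) (auto simp: emeasure_density nn_integral_cmult_indicator)
  then show ?thesis using assms by (simp add: integral_density)
qed

section \<open>The potential kernel as a limit of resolvent densities\<close>

text \<open>
  For \<open>q > 0\<close> this is \<open>r\<^sub>q (0) - r\<^sub>q (x)\<close>. Written as a single integral it survives \<open>q = 0\<close>, where it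
  is the potential kernel of a recurrent process.
\<close>

definition potential_kernel :: "(real \<Rightarrow> complex) \<Rightarrow> real \<Rightarrow> real \<Rightarrow> real" where
  "potential_kernel \<Psi> q x =
     1 / pi * (LBINT \<xi>:{0..}. Re ((1 - iexp (- (\<xi> * x))) / (of_real q + \<Psi> \<xi>)))"

text \<open>
  Two-sided comparison with \<open>\<xi>\<^sup>\<alpha>\<close> is all that the limit theorem needs to know about the exponent.
  Only nonnegative frequencies occur, because the resolvent density is written as an integral over them.
\<close>

locale stable_like_exponent =
  fixes \<Psi> :: "real \<Rightarrow> complex" and \<alpha> C :: real
  assumes index: "1 < \<alpha>" "\<alpha> < 2"
    and measurable_exponent [measurable]: "\<Psi> \<in> borel_measurable borel"
    and Re_exponent_ge: "\<And>\<xi>. \<xi> \<ge> 0 \<Longrightarrow> \<xi> powr \<alpha> \<le> Re (\<Psi> \<xi>)"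
    and exponent_le: "\<And>\<xi>. \<xi> \<ge> 0 \<Longrightarrow> cmod (\<Psi> \<xi>) \<le> C * \<xi> powr \<alpha>"
begin

lemma cmod_resolvent_symbol_ge: "\<xi> \<ge> 0 \<Longrightarrow> q \<ge> 0 \<Longrightarrow> q + \<xi> powr \<alpha> \<le> cmod (of_real q + \<Psi> \<xi>)"
  using Re_exponent_ge[of \<xi>] complex_Re_le_cmod[of "of_real q + \<Psi> \<xi>"] by simp

lemma C_ge_1: "1 \<le> C"
  using cmod_resolvent_symbol_ge[of 1 0] exponent_le[of 1] by simp

lemma cmod_kernel_integrand_le:
  assumes "\<xi> \<ge> 0" "q \<ge> 0" "cmod z \<le> min 2 (R * \<xi>)" "R \<ge> 0"
  shows "cmod (z / (of_real q + \<Psi> \<xi>)) \<le> kernel_weight \<alpha> R \<xi>"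
proof (cases "\<xi> = 0")
  case True
  then show ?thesis using assms by (auto simp: kernel_weight_def)
next
  case False
  then have x: "\<xi> > 0" using assms by simp
  have p: "\<xi> powr \<alpha> > 0" using x by simp
  have "\<xi> powr \<alpha> \<le> cmod (of_real q + \<Psi> \<xi>)"
    using cmod_resolvent_symbol_ge[OF assms(1,2)] assms(2) by linarith
  then have "cmod z / cmod (of_real q + \<Psi> \<xi>) \<le> min 2 (R * \<xi>) / \<xi> powr \<alpha>"
    using assms p by (intro frac_le) auto
  also have "\<dots> = kernel_weight \<alpha> R \<xi>"
    using x by (simp add: kernel_weight_def powr_minus field_simps)
  finally show ?thesis by (simp add: norm_divide)
qed

lemma set_integrable_kernel_integrand:
  assumes "R \<ge> 0" "q \<ge> 0" and [measurable]: "z \<in> borel_measurable borel"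
    and "\<And>\<xi>. \<xi> \<ge> 0 \<Longrightarrow> cmod (z \<xi>) \<le> min 2 (R * \<xi>)"
  shows "set_integrable lborel {0..} (\<lambda>\<xi>. z \<xi> / (of_real q + \<Psi> \<xi>))"
  unfolding set_integrable_def
proof (rule Bochner_Integration.integrable_bound[OF integrable_kernel_weight[OF index assms(1)]])
  show "AE \<xi> in lborel. norm (indicat_real {0..} \<xi> *\<^sub>R (z \<xi> / (of_real q + \<Psi> \<xi>)))
      \<le> norm (kernel_weight \<alpha> R \<xi>)"
    using cmod_kernel_integrand_le[OF _ assms(2) assms(4) assms(1)] kernel_weight_nonneg[OF assms(1)]
    by (intro AE_I2) (auto simp: indicator_def)
qed measurable

lemma set_integrable_potential_kernel:
  assumes "q \<ge> 0"
  shows "set_integrable lborel {0..} (\<lambda>\<xi>. (1 - iexp (- (\<xi> * x))) / (of_real q + \<Psi> \<xi>))"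
proof (intro set_integrable_kernel_integrand[where R="\<bar>x\<bar>"] assms)
  fix \<xi> :: real assume "\<xi> \<ge> 0"
  then have "\<bar>- (\<xi> * x)\<bar> = \<bar>x\<bar> * \<xi>" by (simp add: abs_mult mult.commute)
  then show "cmod (1 - iexp (- (\<xi> * x))) \<le> min 2 (\<bar>x\<bar> * \<xi>)"
    using cmod_one_minus_iexp_le[of "- (\<xi> * x)"] by (simp only:)
qed simp_all

lemma set_integrable_resolvent:
  assumes "q > 0" and [measurable]: "z \<in> borel_measurable borel" and "\<And>\<xi>. cmod (z \<xi>) \<le> 1"
  shows "set_integrable lborel {0..} (\<lambda>\<xi>. z \<xi> / (of_real q + \<Psi> \<xi>))"
  unfolding set_integrable_def
proof (rule Bochner_Integration.integrable_bound)
  show "integrable lborel (\<lambda>x. 1/q * (indicat_real {0..1} x)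
      + (indicator {1..} x *\<^sub>R x powr (- \<alpha>)))"
    using set_integrable_powr_neg_atLeast_1[of "-\<alpha>"] index
    unfolding set_integrable_def by (intro Bochner_Integration.integrable_add integrable_mult_right) auto
  show "AE x in lborel. norm (indicat_real {0..} x *\<^sub>R (z x / (of_real q + \<Psi> x)))
     \<le> norm (1/q * (indicat_real {0..1} x) + (indicator {1..} x *\<^sub>R x powr (- \<alpha>)))"
  proof (rule AE_I2)
    fix x :: real
    have A: "0 \<le> 1/q * (indicat_real {0..1} x) + (indicator {1..} x *\<^sub>R x powr (- \<alpha>))"
      using assms by (auto intro!: add_nonneg_nonneg mult_nonneg_nonneg simp: indicator_def)
    have "cmod (indicat_real {0..} x *\<^sub>R (z x / (of_real q + \<Psi> x)))
      \<le> 1/q * (indicat_real {0..1} x) + (indicator {1..} x *\<^sub>R x powr (- \<alpha>))"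
    proof (cases "x \<ge> 0")
      case False
      then show ?thesis using A by (auto simp: indicator_def)
    next
      case True
      note ge = cmod_resolvent_symbol_ge[OF True, of q]
      have "cmod (z x) / cmod (of_real q + \<Psi> x) \<le> 1 / (q + x powr \<alpha>)"
        using assms True ge by (intro frac_le) (auto intro: add_pos_nonneg)
      moreover have "1 / (q + x powr \<alpha>) \<le> 1 / q" using assms
        by (intro frac_le) auto
      moreover have "1 / (q + x powr \<alpha>) \<le> x powr (-\<alpha>)" if "x \<ge> 1" using assms that
        by (auto simp: powr_minus inverse_eq_divide intro!: frac_le)
      ultimately show ?thesis using True assms
        by (cases "x \<le> 1") (auto simp: norm_divide indicator_def intro: add_increasing order_trans)
    qed
    then show "norm (indicat_real {0..} x *\<^sub>R (z x / (of_real q + \<Psi> x)))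
     \<le> norm (1/q * (indicat_real {0..1} x) + (indicator {1..} x *\<^sub>R x powr (- \<alpha>)))"
      using A by simp
  qed
qed measurable

lemma potential_kernel_eq_resolvent_diff:
  assumes "q > 0"
  shows "resolvent_density \<Psi> q 0 - resolvent_density \<Psi> q x = potential_kernel \<Psi> q x"
proof -
  have "set_integrable lborel {0..} (\<lambda>\<xi>. iexp (- (\<xi> * 0)) / (of_real q + \<Psi> \<xi>))"
       "set_integrable lborel {0..} (\<lambda>\<xi>. iexp (- (\<xi> * x)) / (of_real q + \<Psi> \<xi>))"
    by (intro set_integrable_resolvent assms; simp)+
  from set_lebesgue_integral_Re_diff[OF this]
  have "(LBINT \<xi>:{0..}. Re (iexp (- (\<xi> * 0)) / (of_real q + \<Psi> \<xi>)))
      - (LBINT \<xi>:{0..}. Re (iexp (- (\<xi> * x)) / (of_real q + \<Psi> \<xi>)))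
      = (LBINT \<xi>:{0..}. Re ((1 - iexp (- (\<xi> * x))) / (of_real q + \<Psi> \<xi>)))"
    by (simp add: diff_divide_distrib)
  then show ?thesis unfolding resolvent_density_def potential_kernel_def right_diff_distrib[symmetric]
    by (rule arg_cong)
qed

definition kernel_error :: "real \<Rightarrow> real \<Rightarrow> real" where
  "kernel_error R q = 1 / pi * (LINT \<xi>|lborel. kernel_weight \<alpha> R \<xi> * (q / (q + \<bar>\<xi>\<bar> powr \<alpha>)))"

lemma kernel_error_integrand_le:
  assumes "R \<ge> 0" "q \<ge> 0"
  shows "norm (kernel_weight \<alpha> R \<xi> * (q / (q + \<bar>\<xi>\<bar> powr \<alpha>))) \<le> kernel_weight \<alpha> R \<xi>"
proof -
  have "q / (q + r) \<le> 1" if "r \<ge> 0" for r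
    using assms that by (cases "q + r = 0") (auto simp: divide_le_eq_1)
  then have "kernel_weight \<alpha> R \<xi> * (q / (q + \<bar>\<xi>\<bar> powr \<alpha>)) \<le> kernel_weight \<alpha> R \<xi> * 1"
    using kernel_weight_nonneg[OF assms(1)] by (intro mult_left_mono) auto
  then show ?thesis
    using assms kernel_weight_nonneg[OF assms(1), of \<alpha> \<xi>] by (simp add: abs_mult)
qed

lemma integrable_kernel_error:
  assumes "R \<ge> 0" "q \<ge> 0"
  shows "integrable lborel (\<lambda>\<xi>. kernel_weight \<alpha> R \<xi> * (q / (q + \<bar>\<xi>\<bar> powr \<alpha>)))"
  by (rule Bochner_Integration.integrable_bound[OF integrable_kernel_weight[OF index assms(1)]])
     (use order_trans[OF kernel_error_integrand_le[OF assms] abs_ge_self] in auto)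

lemma kernel_error_tendsto_0:
  assumes "R \<ge> 0" "\<And>n. q n > 0" "q \<longlonglongrightarrow> 0"
  shows "(\<lambda>n. kernel_error R (q n)) \<longlonglongrightarrow> 0"
proof -
  have "(\<lambda>n. LINT \<xi>|lborel. kernel_weight \<alpha> R \<xi> * (q n / (q n + \<bar>\<xi>\<bar> powr \<alpha>)))
      \<longlonglongrightarrow> integral\<^sup>L lborel (\<lambda>\<xi>::real. 0)"
  proof (rule integral_dominated_convergence[where w="kernel_weight \<alpha> R"])
    show "integrable lborel (kernel_weight \<alpha> R)"
      by (intro integrable_kernel_weight index assms)
    show "AE \<xi> in lborel. norm (kernel_weight \<alpha> R \<xi> * (q n / (q n + \<bar>\<xi>\<bar> powr \<alpha>))) \<le> kernel_weight \<alpha> R \<xi>" for n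
      by (intro AE_I2 kernel_error_integrand_le assms(1) less_imp_le assms(2))
    show "AE \<xi> in lborel. (\<lambda>n. kernel_weight \<alpha> R \<xi> * (q n / (q n + \<bar>\<xi>\<bar> powr \<alpha>))) \<longlonglongrightarrow> 0"
    proof (rule AE_I2)
      fix \<xi> :: real
      show "(\<lambda>n. kernel_weight \<alpha> R \<xi> * (q n / (q n + \<bar>\<xi>\<bar> powr \<alpha>))) \<longlonglongrightarrow> 0"
      proof (cases "\<xi> = 0")
        case False
        then have "(\<lambda>n. kernel_weight \<alpha> R \<xi> * (q n / (q n + \<bar>\<xi>\<bar> powr \<alpha>)))
          \<longlonglongrightarrow> kernel_weight \<alpha> R \<xi> * (0 / (0 + \<bar>\<xi>\<bar> powr \<alpha>))"
          by (intro tendsto_intros assms) auto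
        then show ?thesis by simp
      qed (simp add: kernel_weight_def)
    qed
  qed auto
  then show ?thesis unfolding kernel_error_def by (auto intro: tendsto_mult_right_zero)
qed

lemma potential_kernel_approx:
  assumes "q > 0" "\<bar>x\<bar> \<le> R"
  shows "\<bar>potential_kernel \<Psi> q x - potential_kernel \<Psi> 0 x\<bar> \<le> kernel_error R q"
proof -
  have R: "R \<ge> 0" using assms by linarith
  let ?e = "\<lambda>\<xi>. 1 - iexp (- (\<xi> * x))"
  have eq: "potential_kernel \<Psi> q x - potential_kernel \<Psi> 0 x =
      1 / pi * (LBINT \<xi>:{0..}. Re (?e \<xi> / (of_real q + \<Psi> \<xi>) - ?e \<xi> / (of_real 0 + \<Psi> \<xi>)))"
    unfolding potential_kernel_def right_diff_distrib[symmetric]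
    using assms by (intro arg_cong[where f="\<lambda>y. 1/pi * y"] set_lebesgue_integral_Re_diff
      set_integrable_potential_kernel) auto
  have "\<bar>1 / pi * (LBINT \<xi>:{0..}. Re (?e \<xi> / (of_real q + \<Psi> \<xi>) - ?e \<xi> / (of_real 0 + \<Psi> \<xi>)))\<bar>
      \<le> 1 / pi * (LINT \<xi>|lborel. kernel_weight \<alpha> R \<xi> * (q / (q + \<bar>\<xi>\<bar> powr \<alpha>)))"
    unfolding abs_mult set_lebesgue_integral_def
  proof (rule mult_mono[OF _ integral_abs_bound_integral])
    show "integrable lborel (\<lambda>\<xi>. kernel_weight \<alpha> R \<xi> * (q / (q + \<bar>\<xi>\<bar> powr \<alpha>)))"
      using assms R by (intro integrable_kernel_error) auto
    have "set_integrable lborel {0..} (\<lambda>\<xi>. ?e \<xi> / (of_real q + \<Psi> \<xi>) - ?e \<xi> / (of_real 0 + \<Psi> \<xi>))"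
      using assms by (intro set_integral_diff set_integrable_potential_kernel) auto
    then show "integrable lborel (\<lambda>\<xi>. indicat_real {0..} \<xi> *\<^sub>R
        Re (?e \<xi> / (of_real q + \<Psi> \<xi>) - ?e \<xi> / (of_real 0 + \<Psi> \<xi>)))"
      unfolding set_integrable_def by (auto dest: integrable_Re)
  next
    fix \<xi> :: real
    show "\<bar>indicat_real {0..} \<xi> *\<^sub>R Re (?e \<xi> / (of_real q + \<Psi> \<xi>) - ?e \<xi> / (of_real 0 + \<Psi> \<xi>))\<bar>
        \<le> kernel_weight \<alpha> R \<xi> * (q / (q + \<bar>\<xi>\<bar> powr \<alpha>))"
    proof (cases "\<xi> > 0")
      case False
      then show ?thesis using assms R kernel_weight_nonneg[OF R, of \<alpha> \<xi>]
        by (cases "\<xi> = 0") (auto simp: indicator_def)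
    next
      case True
      then have ge: "\<xi> powr \<alpha> \<le> cmod (\<Psi> \<xi>)" "q + \<xi> powr \<alpha> \<le> cmod (of_real q + \<Psi> \<xi>)"
        using cmod_resolvent_symbol_ge[of \<xi> 0] cmod_resolvent_symbol_ge[of \<xi> q] assms by auto
      have p: "\<xi> powr \<alpha> > 0" using True by simp
      have "cmod (\<Psi> \<xi>) > 0" "cmod (of_real q + \<Psi> \<xi>) > 0" using ge p assms by linarith+
      then have nz: "\<Psi> \<xi> \<noteq> 0" "of_real q + \<Psi> \<xi> \<noteq> 0" by auto
      then have eq: "?e \<xi> / (of_real q + \<Psi> \<xi>) - ?e \<xi> / (of_real 0 + \<Psi> \<xi>)
          = - ((?e \<xi> / (of_real 0 + \<Psi> \<xi>)) * (of_real q / (of_real q + \<Psi> \<xi>)))"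
        using divide_diff_divide_perturb[of "\<Psi> \<xi>" "of_real q" "?e \<xi>"] by (simp only: of_real_0 add_0) blast
      have "cmod (?e \<xi>) \<le> min 2 (R * \<xi>)"
      proof -
        have "\<bar>- (\<xi> * x)\<bar> \<le> R * \<xi>" using assms(2) True by (simp add: abs_mult mult.commute)
        then show ?thesis using cmod_one_minus_iexp_le[of "- (\<xi> * x)"] by linarith
      qed
      then have "cmod (?e \<xi> / (of_real 0 + \<Psi> \<xi>)) \<le> kernel_weight \<alpha> R \<xi>"
        using True R by (intro cmod_kernel_integrand_le) auto
      moreover have "cmod (of_real q / (of_real q + \<Psi> \<xi>)) \<le> q / (q + \<xi> powr \<alpha>)"
        using assms p ge unfolding norm_divide by (intro frac_le add_pos_pos) auto
      ultimately have "cmod (?e \<xi> / (of_real q + \<Psi> \<xi>) - ?e \<xi> / (of_real 0 + \<Psi> \<xi>))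
          \<le> kernel_weight \<alpha> R \<xi> * (q / (q + \<bar>\<xi>\<bar> powr \<alpha>))"
        unfolding eq norm_minus_cancel norm_mult using True assms kernel_weight_nonneg[OF R]
        by (intro mult_mono) auto
      with True show ?thesis
        using abs_Re_le_cmod[of "?e \<xi> / (of_real q + \<Psi> \<xi>) - ?e \<xi> / (of_real 0 + \<Psi> \<xi>)"]
        by (simp add: indicator_def del: minus_complex.sel)
    qed
  qed auto
  then show ?thesis unfolding eq kernel_error_def .
qed

text \<open>
  Frequencies up to \<open>s = q\<^sup>1\<^sup>/\<^sup>\<alpha>\<close> alone contribute of the order of \<open>s / q\<close>, because \<open>|q + \<Psi>|\<close> is
  comparable to \<open>q\<close> there. As \<open>\<alpha> > 1\<close>, this makes the resolvent density at \<open>0\<close> diverge.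
\<close>

lemma resolvent_density_0_ge:
  assumes "s > 0"
  shows "s powr (1 - \<alpha>) / (pi * (1 + C)\<^sup>2) \<le> resolvent_density \<Psi> (s powr \<alpha>) 0"
proof -
  let ?q = "s powr \<alpha>"
  have q: "?q > 0" using assms by simp
  have C: "C \<ge> 1" by (rule C_ge_1)
  have int: "set_integrable lborel {0..} (\<lambda>\<xi>. 1 / (of_real ?q + \<Psi> \<xi>))"
    by (intro set_integrable_resolvent q) auto
  have "s powr (1 - \<alpha>) / (1 + C)\<^sup>2 = (LINT \<xi>|lborel. indicator {0..s} \<xi> * (1 / (?q * (1 + C)\<^sup>2)))"
    using assms by (simp add: powr_diff)
  also have "\<dots> \<le> (LINT \<xi>|lborel. indicator {0..} \<xi> *\<^sub>R Re (1 / (of_real ?q + \<Psi> \<xi>)))"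
  proof (rule integral_mono)
    show "integrable lborel (\<lambda>\<xi>. indicat_real {0..} \<xi> *\<^sub>R Re (1 / (of_real ?q + \<Psi> \<xi>)))"
      using int unfolding set_integrable_def by (auto dest: integrable_Re)
    fix \<xi> :: real
    show "indicator {0..s} \<xi> * (1 / (?q * (1 + C)\<^sup>2))
        \<le> indicat_real {0..} \<xi> *\<^sub>R Re (1 / (of_real ?q + \<Psi> \<xi>))"
    proof (cases "\<xi> \<ge> 0")
      case True
      let ?z = "of_real ?q + \<Psi> \<xi>"
      have Re: "?q \<le> Re ?z" using order_trans[OF powr_ge_zero Re_exponent_ge[OF True]] by simp
      have zpos: "cmod ?z > 0" using Re q complex_Re_le_cmod[of ?z] by linarith
      have eq: "Re (1 / ?z) = Re ?z / (cmod ?z)\<^sup>2"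
        by (simp add: Re_divide cmod_power2)
      show ?thesis
      proof (cases "\<xi> \<le> s")
        case le: True
        have "\<xi> powr \<alpha> \<le> ?q" using le True index by (intro powr_mono2) auto
        then have "C * \<xi> powr \<alpha> \<le> C * ?q" using C by simp
        then have "cmod ?z \<le> (1 + C) * ?q"
          using exponent_le[OF True] norm_triangle_ineq[of "of_real ?q" "\<Psi> \<xi>"] q by (simp add: algebra_simps)
        then have "(cmod ?z)\<^sup>2 \<le> ((1 + C) * ?q)\<^sup>2" by (intro power_mono) auto
        then have "?q / ((1 + C) * ?q)\<^sup>2 \<le> Re ?z / (cmod ?z)\<^sup>2"
          using Re q zpos by (intro frac_le) auto
        moreover have "?q / ((1 + C) * ?q)\<^sup>2 = 1 / (?q * (1 + C)\<^sup>2)"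
          using q by (simp add: power2_eq_square)
        ultimately show ?thesis using True le eq by simp
      qed (use True Re q eq in \<open>auto simp: indicator_def\<close>)
    qed (auto simp: indicator_def)
  qed (use assms in auto)
  finally have "s powr (1 - \<alpha>) / (1 + C)\<^sup>2 \<le> pi * resolvent_density \<Psi> ?q 0"
    unfolding resolvent_density_def set_lebesgue_integral_def by simp
  then show ?thesis using C by (simp add: field_simps)
qed

lemma resolvent_density_0_at_top:
  assumes "\<And>n. q n > 0" "q \<longlonglongrightarrow> 0"
  shows "filterlim (\<lambda>n. resolvent_density \<Psi> (q n) 0) at_top sequentially"
proof (rule filterlim_at_top_mono)
  define e where "e = 1 / \<alpha> * (1 - \<alpha>)"
  have e: "e < 0" using index by (simp add: field_simps e_def)
  define K where "K = 1 / (pi * (1 + C)\<^sup>2)"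
  have K: "K > 0" using C_ge_1 by (simp add: K_def)
  have "filterlim q (at_right 0) sequentially"
    using assms by (intro tendsto_imp_filterlim_at_right always_eventually) auto
  moreover have "filterlim (\<lambda>x::real. K * x powr e) at_top (at_right 0)"
    using e K by real_asymp
  ultimately show "filterlim (\<lambda>n. K * q n powr e) at_top sequentially"
    by (rule filterlim_compose[rotated])
  show "\<forall>\<^sub>F n in sequentially. K * q n powr e \<le> resolvent_density \<Psi> (q n) 0"
  proof (rule always_eventually, rule allI)
    fix n
    show "K * q n powr e \<le> resolvent_density \<Psi> (q n) 0"
      using resolvent_density_0_ge[of "q n powr (1/\<alpha>)"] assms(1)[of n] index
      by (simp add: powr_powr K_def e_def)
  qed
qed

lemma measurable_potential_kernel [measurable]: "potential_kernel \<Psi> q \<in> borel_measurable borel"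
  unfolding potential_kernel_def set_lebesgue_integral_def by measurable

lemma abs_potential_kernel_le:
  assumes "q \<ge> 0" "\<bar>x\<bar> \<le> R"
  shows "\<bar>potential_kernel \<Psi> q x\<bar> \<le> (LINT \<xi>|lborel. kernel_weight \<alpha> R \<xi>) / pi"
proof -
  have R: "R \<ge> 0" using assms by linarith
  have "\<bar>LBINT \<xi>:{0..}. Re ((1 - iexp (- (\<xi> * x))) / (of_real q + \<Psi> \<xi>))\<bar>
      \<le> (LINT \<xi>|lborel. kernel_weight \<alpha> R \<xi>)"
    unfolding set_lebesgue_integral_def
  proof (rule integral_abs_bound_integral)
    show "integrable lborel (\<lambda>\<xi>. indicat_real {0..} \<xi> *\<^sub>R Re ((1 - iexp (- (\<xi> * x))) / (of_real q + \<Psi> \<xi>)))"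
      using set_integrable_potential_kernel[OF assms(1), of x]
      unfolding set_integrable_def by (auto dest: integrable_Re)
    fix \<xi> :: real
    show "\<bar>indicat_real {0..} \<xi> *\<^sub>R Re ((1 - iexp (- (\<xi> * x))) / (of_real q + \<Psi> \<xi>))\<bar> \<le> kernel_weight \<alpha> R \<xi>"
    proof (cases "\<xi> \<ge> 0")
      case True
      have "\<bar>- (\<xi> * x)\<bar> \<le> R * \<xi>" using assms(2) True by (simp add: abs_mult mult.commute[of R] mult_left_mono)
      then have "cmod (1 - iexp (- (\<xi> * x))) \<le> min 2 (R * \<xi>)"
        using cmod_one_minus_iexp_le[of "- (\<xi> * x)"] by linarith
      from cmod_kernel_integrand_le[OF True assms(1) this R] show ?thesis
        using abs_Re_le_cmod[of "(1 - iexp (- (\<xi> * x))) / (of_real q + \<Psi> \<xi>)"] True by simp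
    qed (use kernel_weight_nonneg[OF R] in auto)
  qed (intro integrable_kernel_weight index R)
  then show ?thesis unfolding potential_kernel_def by (simp add: abs_mult divide_right_mono)
qed

end

section \<open>Energy of charges on a compact interval\<close>

locale compact_charge = stable_like_exponent +
  fixes a b :: real
  assumes a_le_b: "a \<le> b"
begin

definition charge :: "real measure \<Rightarrow> bool" where
  "charge N \<longleftrightarrow> real_distribution N \<and> (AE y in N. y \<in> {a..b})"

lemma chargeD: "charge N \<Longrightarrow> real_distribution N" "charge N \<Longrightarrow> AE y in N. y \<in> {a..b}"
  by (auto simp: charge_def)

definition mutual_energy :: "real measure \<Rightarrow> real measure \<Rightarrow> real" where
  "mutual_energy N M = (LINT x|M. LINT y|N. potential_kernel \<Psi> 0 (y - x))"

lemma cmod_translate_le: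
  assumes "x \<in> {a..b}" "y \<in> {a..b}" "\<xi> \<ge> 0"
  shows "cmod (1 - iexp (- (\<xi> * (y - x)))) \<le> min 2 ((b - a) * \<xi>)"
proof -
  have "\<bar>- (\<xi> * (y - x))\<bar> \<le> (b - a) * \<xi>" using assms
    by (auto simp: abs_mult mult.commute[of _ \<xi>] intro!: mult_left_mono)
  then show ?thesis
    using cmod_one_minus_iexp_le[of "- (\<xi> * (y - x))"] by linarith
qed

lemma expectation_translate:
  assumes "charge N"
  shows "(LINT y|N. 1 - iexp (- (\<xi> * (y - x)))) = 1 - iexp (\<xi> * x) * char N (- \<xi>)"
    and "integrable N (\<lambda>y. 1 - iexp (- (\<xi> * (y - x))))"
proof -
  interpret N: real_distribution N using assms by (rule chargeD)
  have i: "integrable N (\<lambda>y. iexp (- \<xi> * y))"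
    by (rule N.integrable_iexp) auto
  have e: "1 - iexp (- (\<xi> * (y - x))) = 1 - iexp (\<xi> * x) * iexp (- \<xi> * y)" for y
    by (simp add: exp_add[symmetric] algebra_simps)
  show "integrable N (\<lambda>y. 1 - iexp (- (\<xi> * (y - x))))"
    unfolding e using i by (intro Bochner_Integration.integrable_diff integrable_mult_right) auto
  show "(LINT y|N. 1 - iexp (- (\<xi> * (y - x)))) = 1 - iexp (\<xi> * x) * char N (- \<xi>)"
    unfolding e using i N.prob_space unfolding char_def
    by (subst Bochner_Integration.integral_diff) auto
qed

lemma cmod_translate_char_le:
  assumes "charge N" "x \<in> {a..b}" "\<xi> \<ge> 0"
  shows "cmod (1 - iexp (\<xi> * x) * char N (- \<xi>)) \<le> min 2 ((b - a) * \<xi>)"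
proof -
  interpret N: real_distribution N using assms(1) by (rule chargeD)
  have "cmod (1 - iexp (\<xi> * x) * char N (- \<xi>)) \<le> (LINT y|N. cmod (1 - iexp (- (\<xi> * (y - x)))))"
    unfolding expectation_translate(1)[OF assms(1), symmetric] by (rule integral_norm_bound)
  also have "\<dots> \<le> min 2 ((b - a) * \<xi>)"
  proof (rule N.integral_le_const)
    show "AE y in N. cmod (1 - iexp (- (\<xi> * (y - x)))) \<le> min 2 ((b - a) * \<xi>)"
      using chargeD(2)[OF assms(1)] by eventually_elim (intro cmod_translate_le assms)
  qed (intro integrable_norm expectation_translate(2) assms(1))
  finally show ?thesis .
qed

lemma abs_indicator_Re_divide_le:
  assumes "\<And>\<xi>. \<xi> \<ge> 0 \<Longrightarrow> cmod (z \<xi>) \<le> min 2 ((b - a) * \<xi>)"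
  shows "norm (indicat_real {0..} \<xi> *\<^sub>R Re (z \<xi> / \<Psi> \<xi>)) \<le> kernel_weight \<alpha> (b - a) \<xi>"
proof (cases "\<xi> \<ge> 0")
  case True
  have "cmod (z \<xi> / (of_real 0 + \<Psi> \<xi>)) \<le> kernel_weight \<alpha> (b - a) \<xi>"
    using True assms[OF True] a_le_b by (intro cmod_kernel_integrand_le) auto
  then show ?thesis using abs_Re_le_cmod[of "z \<xi> / \<Psi> \<xi>"] True by simp
qed (use kernel_weight_nonneg[of "b - a"] a_le_b in auto)

lemma integrable_weight: "integrable lborel (kernel_weight \<alpha> (b - a))"
  using a_le_b by (intro integrable_kernel_weight index) auto

text \<open>
  Integrating the exponential in the kernel against the charge turns the potential into a Fourier
  integral that involves the characteristic function; all points have distance at most \<open>b - a\<close>, so one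
  majorant justifies the interchange.
\<close>

lemma potential_eq_char:
  assumes "charge N" "x \<in> {a..b}"
  shows "(LINT y|N. potential_kernel \<Psi> 0 (y - x)) =
    1 / pi * (LBINT \<xi>:{0..}. Re ((1 - iexp (\<xi> * x) * char N (- \<xi>)) / \<Psi> \<xi>))"
proof -
  let ?f = "\<lambda>y \<xi>. indicat_real {0..} \<xi> *\<^sub>R Re ((1 - iexp (- (\<xi> * (y - x)))) / \<Psi> \<xi>)"
  interpret N: real_distribution N using assms(1) by (rule chargeD)
  have "(LINT y|N. potential_kernel \<Psi> 0 (y - x)) = 1 / pi *
     (LINT y|N. LINT \<xi>|lborel. ?f y \<xi>)"
    unfolding potential_kernel_def set_lebesgue_integral_def by simp
  also have "(LINT y|N. LINT \<xi>|lborel. ?f y \<xi>)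
     = (LINT \<xi>|lborel. LINT y|N. ?f y \<xi>)"
  proof (rule Fubini_prob_lborel(2)[OF _ _ integrable_weight])
    show "AE y in N. \<forall>\<xi>. norm (?f y \<xi>)
        \<le> kernel_weight \<alpha> (b - a) \<xi>"
      using chargeD(2)[OF assms(1)]
    proof eventually_elim
      case (elim y)
      show ?case
        by (intro allI abs_indicator_Re_divide_le cmod_translate_le assms elim)
    qed
  qed (use N.real_distribution_axioms in \<open>simp_all\<close>)
  also have "\<dots> = (LBINT \<xi>:{0..}. Re ((1 - iexp (\<xi> * x) * char N (- \<xi>)) / \<Psi> \<xi>))"
    unfolding set_lebesgue_integral_def
  proof (rule Bochner_Integration.integral_cong[OF refl])
    fix \<xi> :: real
    have "(LINT y|N. Re ((1 - iexp (- (\<xi> * (y - x)))) / \<Psi> \<xi>))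
        = Re (LINT y|N. (1 - iexp (- (\<xi> * (y - x)))) / \<Psi> \<xi>)"
      by (intro integral_Re integrable_divide_zero expectation_translate assms)
    also have "(LINT y|N. (1 - iexp (- (\<xi> * (y - x)))) / \<Psi> \<xi>)
        = (1 - iexp (\<xi> * x) * char N (- \<xi>)) / \<Psi> \<xi>"
      by (subst expectation_translate(1)[OF assms(1), symmetric]) (rule integral_divide_zero)
    finally show "(LINT y|N. ?f y \<xi>)
        = indicat_real {0..} \<xi> *\<^sub>R Re ((1 - iexp (\<xi> * x) * char N (- \<xi>)) / \<Psi> \<xi>)"
      by simp
  qed
  finally show ?thesis .
qed

lemma expectation_translate_char:
  assumes "charge N" "charge M"
  shows "(LINT x|M. 1 - iexp (\<xi> * x) * char N (- \<xi>)) = 1 - char M \<xi> * char N (- \<xi>)"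
    and "integrable M (\<lambda>x. 1 - iexp (\<xi> * x) * char N (- \<xi>))"
proof -
  interpret M: real_distribution M using assms(2) by (rule chargeD)
  have i: "integrable M (\<lambda>y. iexp (\<xi> * y))"
    by (rule M.integrable_iexp) auto
  show "integrable M (\<lambda>x. 1 - iexp (\<xi> * x) * char N (- \<xi>))"
    using i by (intro Bochner_Integration.integrable_diff integrable_mult_left) auto
  show "(LINT x|M. 1 - iexp (\<xi> * x) * char N (- \<xi>)) = 1 - char M \<xi> * char N (- \<xi>)"
    using i M.prob_space unfolding char_def
    by (subst Bochner_Integration.integral_diff) auto
qed

lemma cmod_one_minus_char_mult_le:
  assumes "charge N" "charge M" "\<xi> \<ge> 0"
  shows "cmod (1 - char M \<xi> * char N (- \<xi>)) \<le> min 2 ((b - a) * \<xi>)"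
proof -
  interpret M: real_distribution M using assms(2) by (rule chargeD)
  have "cmod (1 - char M \<xi> * char N (- \<xi>)) \<le> (LINT x|M. cmod (1 - iexp (\<xi> * x) * char N (- \<xi>)))"
    unfolding expectation_translate_char(1)[OF assms(1,2), symmetric] by (rule integral_norm_bound)
  also have "\<dots> \<le> min 2 ((b - a) * \<xi>)"
  proof (rule M.integral_le_const)
    show "AE x in M. cmod (1 - iexp (\<xi> * x) * char N (- \<xi>)) \<le> min 2 ((b - a) * \<xi>)"
      using chargeD(2)[OF assms(2)] by eventually_elim (intro cmod_translate_char_le assms)
  qed (intro integrable_norm expectation_translate_char(2) assms)
  finally show ?thesis .
qed

lemma measurable_char [measurable]: "charge N \<Longrightarrow> char N \<in> borel_measurable borel"
  by (intro real_distribution.char_measurable chargeD)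

lemma set_integrable_char_mult:
  assumes "charge N" "charge M"
  shows "set_integrable lborel {0..} (\<lambda>\<xi>. Re ((1 - char M \<xi> * char N (- \<xi>)) / \<Psi> \<xi>))"
  unfolding set_integrable_def
proof (rule Bochner_Integration.integrable_bound[OF integrable_weight])
  note [measurable] = measurable_char[OF assms(1)] measurable_char[OF assms(2)]
  show "(\<lambda>\<xi>. indicat_real {0..} \<xi> *\<^sub>R Re ((1 - char M \<xi> * char N (- \<xi>)) / \<Psi> \<xi>))
      \<in> borel_measurable lborel" by measurable
  show "AE \<xi> in lborel. norm (indicat_real {0..} \<xi> *\<^sub>R Re ((1 - char M \<xi> * char N (- \<xi>)) / \<Psi> \<xi>))
      \<le> norm (kernel_weight \<alpha> (b - a) \<xi>)"
    by (intro AE_I2 order_trans[OF abs_indicator_Re_divide_le[OF cmod_one_minus_char_mult_le[OF assms]]])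
       auto
qed

lemma mutual_energy_eq_char:
  assumes "charge N" "charge M"
  shows "mutual_energy N M =
    1 / pi * (LBINT \<xi>:{0..}. Re ((1 - char M \<xi> * char N (- \<xi>)) / \<Psi> \<xi>))"
proof -
  let ?f = "\<lambda>x \<xi>. indicat_real {0..} \<xi> *\<^sub>R Re ((1 - iexp (\<xi> * x) * char N (- \<xi>)) / \<Psi> \<xi>)"
  interpret N: real_distribution N using assms(1) by (rule chargeD)
  interpret M: real_distribution M using assms(2) by (rule chargeD)
  have [measurable]: "char N \<in> borel_measurable borel" by (rule measurable_char) fact
  have "mutual_energy N M = (LINT x|M. 1 / pi *
     (LINT \<xi>|lborel. ?f x \<xi>))"
    unfolding mutual_energy_def
  proof (rule integral_cong_AE)
    show "AE x in M. (LINT y|N. potential_kernel \<Psi> 0 (y - x)) = 1 / pi *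
     (LINT \<xi>|lborel. ?f x \<xi>)"
      using chargeD(2)[OF assms(2)]
      by eventually_elim (use potential_eq_char[OF assms(1)] in \<open>auto simp: set_lebesgue_integral_def\<close>)
  qed measurable
  also have "\<dots> = 1 / pi *
     (LINT x|M. LINT \<xi>|lborel. ?f x \<xi>)"
    by simp
  also have "(LINT x|M. LINT \<xi>|lborel. ?f x \<xi>)
     = (LINT \<xi>|lborel. LINT x|M. ?f x \<xi>)"
  proof (rule Fubini_prob_lborel(2)[OF _ _ integrable_weight])
    show "AE x in M. \<forall>\<xi>. norm (?f x \<xi>)
        \<le> kernel_weight \<alpha> (b - a) \<xi>"
      using chargeD(2)[OF assms(2)]
    proof eventually_elim
      case (elim x)
      show ?case
        by (intro allI abs_indicator_Re_divide_le cmod_translate_char_le assms elim)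
    qed
  qed (use M.real_distribution_axioms in \<open>simp_all\<close>)
  also have "\<dots> = (LBINT \<xi>:{0..}. Re ((1 - char M \<xi> * char N (- \<xi>)) / \<Psi> \<xi>))"
    unfolding set_lebesgue_integral_def
  proof (rule Bochner_Integration.integral_cong[OF refl])
    fix \<xi> :: real
    have "(LINT x|M. Re ((1 - iexp (\<xi> * x) * char N (- \<xi>)) / \<Psi> \<xi>))
        = Re (LINT x|M. (1 - iexp (\<xi> * x) * char N (- \<xi>)) / \<Psi> \<xi>)"
      by (intro integral_Re integrable_divide_zero expectation_translate_char assms)
    also have "(LINT x|M. (1 - iexp (\<xi> * x) * char N (- \<xi>)) / \<Psi> \<xi>)
        = (1 - char M \<xi> * char N (- \<xi>)) / \<Psi> \<xi>"
      by (subst expectation_translate_char(1)[OF assms, symmetric]) (rule integral_divide_zero)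
    finally show "(LINT x|M. ?f x \<xi>)
        = indicat_real {0..} \<xi> *\<^sub>R Re ((1 - char M \<xi> * char N (- \<xi>)) / \<Psi> \<xi>)"
      by simp
  qed
  finally show ?thesis .
qed

text \<open>
  Expanding the energy of \<open>N - M\<close> by bilinearity, the constants cancel because the charge is neutral, and
  the four products of characteristic functions form \<open>|N^ - M^|\<^sup>2\<close>. Being real, it leaves only the real
  part of \<open>1 / \<Psi>\<close>, which is positive: the energy is negative definite on neutral charges,
  also for asymmetric exponents.
\<close>

lemma energy_of_difference:
  assumes "charge N" "charge M"
  shows "set_integrable lborel {0..} (\<lambda>\<xi>. (cmod (char N \<xi> - char M \<xi>))\<^sup>2 * Re (1 / \<Psi> \<xi>))"
    and "mutual_energy N N - mutual_energy N M - mutual_energy M N + mutual_energy M M =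
      - (1 / pi) * (LBINT \<xi>:{0..}. (cmod (char N \<xi> - char M \<xi>))\<^sup>2 * Re (1 / \<Psi> \<xi>))"
proof -
  let ?f = "\<lambda>N M \<xi>. Re ((1 - char M \<xi> * char N (- \<xi>)) / \<Psi> \<xi>)"
  note i = set_integrable_char_mult
  \<comment> \<open>The numerators combine to \<open>(n - m) cnj (n - m)\<close>, since \<open>char N (- \<xi>)\<close> is the conjugate.\<close>
  have eq: "?f N M \<xi> + ?f M N \<xi> - ?f N N \<xi> - ?f M M \<xi> = (cmod (char N \<xi> - char M \<xi>))\<^sup>2 * Re (1 / \<Psi> \<xi>)" for \<xi>
  proof -
    define n m where "n = char N \<xi>" and "m = char M \<xi>"
    have "?f N M \<xi> + ?f M N \<xi> - ?f N N \<xi> - ?f M M \<xi>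
        = Re (((n - m) * cnj (n - m)) / \<Psi> \<xi>)"
      unfolding char_uminus n_def[symmetric] m_def[symmetric]
        minus_complex.sel[symmetric] plus_complex.sel[symmetric]
      by (simp only: diff_divide_distrib[symmetric] add_divide_distrib[symmetric])
         (simp add: algebra_simps)
    also have "(n - m) * cnj (n - m) = of_real ((cmod (n - m))\<^sup>2)"
      by (simp only: complex_norm_square)
    also have "Re (of_real ((cmod (n - m))\<^sup>2) / \<Psi> \<xi>) = (cmod (n - m))\<^sup>2 * Re (1 / \<Psi> \<xi>)"
      using scaleR_complex.sel(1)[of "(cmod (n - m))\<^sup>2" "1 / \<Psi> \<xi>"] by (simp add: scaleR_conv_of_real)
    finally show ?thesis unfolding n_def m_def .
  qed
  have int: "set_integrable lborel {0..} (\<lambda>\<xi>. ?f N M \<xi> + ?f M N \<xi> - ?f N N \<xi> - ?f M M \<xi>)"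
    by (intro set_integral_diff set_integral_add i assms)
  then show "set_integrable lborel {0..} (\<lambda>\<xi>. (cmod (char N \<xi> - char M \<xi>))\<^sup>2 * Re (1 / \<Psi> \<xi>))"
    unfolding eq .
  have "(LBINT \<xi>:{0..}. ?f N M \<xi> + ?f M N \<xi> - ?f N N \<xi> - ?f M M \<xi>)
     = (LBINT \<xi>:{0..}. ?f N M \<xi>) + (LBINT \<xi>:{0..}. ?f M N \<xi>)
       - (LBINT \<xi>:{0..}. ?f N N \<xi>) - (LBINT \<xi>:{0..}. ?f M M \<xi>)"
    by (subst set_integral_diff set_integral_add; (intro set_integral_diff set_integral_add i assms)?)+ simp
  then have J: "(LBINT \<xi>:{0..}. (cmod (char N \<xi> - char M \<xi>))\<^sup>2 * Re (1 / \<Psi> \<xi>))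
     = (LBINT \<xi>:{0..}. ?f N M \<xi>) + (LBINT \<xi>:{0..}. ?f M N \<xi>)
       - (LBINT \<xi>:{0..}. ?f N N \<xi>) - (LBINT \<xi>:{0..}. ?f M M \<xi>)"
    unfolding eq .
  show "mutual_energy N N - mutual_energy N M - mutual_energy M N + mutual_energy M M =
      - (1 / pi) * (LBINT \<xi>:{0..}. (cmod (char N \<xi> - char M \<xi>))\<^sup>2 * Re (1 / \<Psi> \<xi>))"
    unfolding J mutual_energy_eq_char[OF assms] mutual_energy_eq_char[OF assms(2,1)]
      mutual_energy_eq_char[OF assms(1,1)] mutual_energy_eq_char[OF assms(2,2)]
    by (simp only: right_diff_distrib distrib_left mult_minus_left)
qed

lemma Re_inverse_exponent_ge:
  assumes "0 < \<xi>" "\<xi> \<le> s"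
  shows "s powr (- \<alpha>) / C\<^sup>2 \<le> Re (1 / \<Psi> \<xi>)"
proof -
  have p: "\<xi> powr \<alpha> > 0" using assms by simp
  have ge: "\<xi> powr \<alpha> \<le> Re (\<Psi> \<xi>)" and le: "cmod (\<Psi> \<xi>) \<le> C * \<xi> powr \<alpha>"
    using assms Re_exponent_ge exponent_le by auto
  have pos: "cmod (\<Psi> \<xi>) > 0" using ge p complex_Re_le_cmod[of "\<Psi> \<xi>"] by linarith
  have "s powr (- \<alpha>) / C\<^sup>2 \<le> \<xi> powr (- \<alpha>) / C\<^sup>2"
    using assms index by (intro divide_right_mono powr_mono2') auto
  also have "\<dots> = \<xi> powr \<alpha> / (C * \<xi> powr \<alpha>)\<^sup>2"
    using p by (simp add: powr_minus power2_eq_square field_simps)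
  also have "\<dots> \<le> Re (\<Psi> \<xi>) / (cmod (\<Psi> \<xi>))\<^sup>2"
    using order_trans[OF less_imp_le[OF p] ge] ge le pos by (intro frac_le power_mono) auto
  also have "\<dots> = Re (1 / \<Psi> \<xi>)"
    by (simp add: Re_divide cmod_power2)
  finally show ?thesis .
qed

text \<open>
  A Lipschitz constant for differences of two characteristic functions of measures on \<open>[a, b]\<close>. The summand
  \<open>1\<close> keeps it at least \<open>2\<close>, which bounds the interval length in \<open>energy_of_difference_ge\<close> by \<open>1\<close>.
\<close>

definition char_lipschitz :: real where
  "char_lipschitz = 2 * (1 + max \<bar>a\<bar> \<bar>b\<bar>)"

lemma char_lipschitz_ge: "char_lipschitz \<ge> 2"
  unfolding char_lipschitz_def by simp

lemma cmod_char_difference_lipschitz: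
  assumes "charge N" "charge M"
  shows "cmod (char N t - char M t) \<le> cmod (char N s - char M s) + char_lipschitz * \<bar>s - t\<bar>"
proof -
  have l: "cmod (char N t - char N s) \<le> (1 + max \<bar>a\<bar> \<bar>b\<bar>) * \<bar>t - s\<bar>" if "charge N" for N
  proof (rule cmod_char_diff_le[OF chargeD(1)[OF that]])
    show "AE y in N. \<bar>y\<bar> \<le> 1 + max \<bar>a\<bar> \<bar>b\<bar>"
      using chargeD(2)[OF that] by eventually_elim auto
  qed
  have "char N t - char M t = (char N s - char M s) + (char N t - char N s) - (char M t - char M s)"
    by simp
  then have "cmod (char N t - char M t) \<le> cmod (char N s - char M s) + cmod (char N t - char N s)
      + cmod (char M t - char M s)"
    using norm_triangle_ineq4[of "(char N s - char M s) + (char N t - char N s)" "char M t - char M s"]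
      norm_triangle_ineq[of "char N s - char M s" "char N t - char N s"] by simp
  then show ?thesis using l[OF assms(1)] l[OF assms(2)]
    unfolding char_lipschitz_def abs_minus_commute[of s t] by (simp add: algebra_simps)
qed

text \<open>
  If the characteristic functions differ by \<open>d\<close> at \<open>t\<close>, then by the Lipschitz bound they differ by at
  least \<open>d / 2\<close> on an interval of length \<open>d / (2 L)\<close> to the right of \<open>t\<close>, where \<open>Re (1 / \<Psi>)\<close> is bounded
  below. So small energy forces the characteristic functions to be close at each point.
\<close>

lemma energy_of_difference_ge:
  assumes N: "charge N" and M: "charge M" and t: "t \<ge> 0"
  shows "(cmod (char N t - char M t)) ^ 3 * ((t + 1) powr (- \<alpha>) / (8 * char_lipschitz * C\<^sup>2))
    \<le> (LBINT \<xi>:{0..}. (cmod (char N \<xi> - char M \<xi>))\<^sup>2 * Re (1 / \<Psi> \<xi>))"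
proof -
  let ?L = char_lipschitz
  let ?f = "\<lambda>\<xi>. (cmod (char N \<xi> - char M \<xi>))\<^sup>2 * Re (1 / \<Psi> \<xi>)"
  define d where "d = cmod (char N t - char M t)"
  define w where "w = (t + 1) powr (- \<alpha>) / C\<^sup>2"
  define s where "s = d / (2 * ?L)"
  note L = char_lipschitz_ge
  have d: "d \<ge> 0" "d \<le> 2"
    using norm_triangle_ineq4[of "char N t" "char M t"]
      real_distribution.cmod_char_le_1[OF chargeD(1)[OF N], of t]
      real_distribution.cmod_char_le_1[OF chargeD(1)[OF M], of t] unfolding d_def by auto
  have w: "w \<ge> 0" unfolding w_def by simp
  have s: "s \<ge> 0" "s \<le> 1" using d L by (auto simp: s_def field_simps)
  have "d ^ 3 * ((t + 1) powr (- \<alpha>) / (8 * ?L * C\<^sup>2)) = s * ((d / 2)\<^sup>2 * w)"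
    using L by (simp add: s_def w_def power2_eq_square power3_eq_cube)
  also have "\<dots> = (LINT \<xi>|lborel. indicator {t<..<t+s} \<xi> * ((d / 2)\<^sup>2 * w))"
    using s by simp
  also have "\<dots> \<le> (LINT \<xi>|lborel. indicator {0..} \<xi> *\<^sub>R ?f \<xi>)"
  proof (rule integral_mono)
    show "integrable lborel (\<lambda>\<xi>. indicator {0..} \<xi> *\<^sub>R ?f \<xi>)"
      using energy_of_difference(1)[OF N M] unfolding set_integrable_def .
    show "integrable lborel (\<lambda>\<xi>. indicat_real {t<..<t + s} \<xi> * ((d / 2)\<^sup>2 * w))"
      using s by (intro integrable_mult_left) auto
    fix \<xi> :: real
    have Re0: "\<xi> \<ge> 0 \<Longrightarrow> 0 \<le> Re (1 / \<Psi> \<xi>)"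
      using Re_exponent_ge[of \<xi>] powr_ge_zero[of \<xi> \<alpha>] by (auto simp: Re_divide simp del: powr_ge_zero)
    show "indicator {t<..<t+s} \<xi> * ((d / 2)\<^sup>2 * w) \<le> indicator {0..} \<xi> *\<^sub>R ?f \<xi>"
    proof (cases "\<xi> \<in> {t<..<t+s}")
      case True
      have "?L * \<bar>\<xi> - t\<bar> \<le> ?L * s" using True L by (intro mult_left_mono) auto
      also have "\<dots> = d / 2" using L by (simp add: s_def)
      finally have "d / 2 \<le> cmod (char N \<xi> - char M \<xi>)"
        using cmod_char_difference_lipschitz[OF N M, of t \<xi>] unfolding d_def by linarith
      moreover have "w \<le> Re (1 / \<Psi> \<xi>)"
        unfolding w_def using True t s by (intro Re_inverse_exponent_ge) auto
      ultimately have "(d / 2)\<^sup>2 * w \<le> ?f \<xi>"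
        using d w by (intro mult_mono power_mono) auto
      then show ?thesis using True t by simp
    next
      case False
      then show ?thesis using Re0 by (cases "\<xi> \<ge> 0") auto
    qed
  qed
  finally show ?thesis unfolding d_def set_lebesgue_integral_def .
qed

end

section \<open>Convergence of the normalized capacity measures\<close>

text \<open>
  The limit \<open>q \<rightarrow> 0\<close> is taken along an arbitrary sequence, as dominated convergence and Levy's theorem are
  about sequences. The measure \<open>M\<close> is any solution of the limit equation; that it is the limit,
  and hence unique, is the conclusion.
\<close>

locale equilibrium_problem = compact_charge +
  fixes M :: "real measure" and k :: real
    and q :: "nat \<Rightarrow> real" and m :: "nat \<Rightarrow> real measure"
  assumes charge_M: "charge M"
    and potential_M: "\<And>x. x \<in> {a..b} \<Longrightarrow> (LINT y|M. potential_kernel \<Psi> 0 (y - x)) = k"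
    and q_pos: "\<And>n. q n > 0" and q_tendsto: "q \<longlonglongrightarrow> 0"
    and finite_m: "\<And>n. finite_measure (m n)" and sets_m: "\<And>n. sets (m n) = sets borel"
    and supp_m: "\<And>n. emeasure (m n) (- {a..b}) = 0"
    and capacity: "\<And>n x. x \<in> {a..b} \<Longrightarrow> (LINT y|m n. resolvent_density \<Psi> (q n) (y - x)) = 1"
begin

abbreviation mass :: "nat \<Rightarrow> real" where "mass n \<equiv> measure (m n) (space (m n))"

abbreviation r0 :: "nat \<Rightarrow> real" where "r0 n \<equiv> resolvent_density \<Psi> (q n) 0"

definition normalized :: "nat \<Rightarrow> real measure" where
  "normalized n = scale_measure (ennreal (1 / mass n)) (m n)"

lemma space_m: "space (m n) = UNIV"
  using sets_eq_imp_space_eq[OF sets_m[of n]] by simp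

text \<open>
  The zero measure could not have the potential \<open>1\<close>.
\<close>

lemma mass_pos: "mass n > 0"
proof (rule ccontr)
  assume "\<not> ?thesis"
  then have "mass n = 0" by (simp add: measure_nonneg order.antisym not_less)
  then have "emeasure (m n) (space (m n)) = 0"
    using finite_measure.emeasure_eq_measure[OF finite_m[of n]] by simp
  then have "AE y in m n. False"
    by (intro AE_I[where N="space (m n)"]) auto
  then have "(LINT y|m n. resolvent_density \<Psi> (q n) (y - a)) = 0"
    by (intro integral_eq_zero_AE) (auto elim: eventually_mono)
  then show False using capacity[of a n] a_le_b by simp
qed

lemma charge_normalized: "charge (normalized n)"
  unfolding charge_def
proof
  have "prob_space (normalized n)"
  proof
    have "emeasure (normalized n) (space (normalized n)) = ennreal (1 / mass n) * ennreal (mass n)"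
      unfolding normalized_def
      by (simp add: space_scale_measure finite_measure.emeasure_eq_measure[OF finite_m[of n]])
    also have "\<dots> = ennreal (1 / mass n * mass n)"
      using mass_pos[of n] by (intro ennreal_mult[symmetric]) auto
    finally show "emeasure (normalized n) (space (normalized n)) = 1"
      using mass_pos[of n] by simp
  qed
  then show "real_distribution (normalized n)"
    unfolding real_distribution_def real_distribution_axioms_def normalized_def
    by (simp add: space_scale_measure space_m sets_m)
  show "AE y in normalized n. y \<in> {a..b}"
    by (rule AE_I[where N="- {a..b}"]) (auto simp: normalized_def space_scale_measure supp_m sets_m)
qed

text \<open>
  Dividing \<open>\<integral> r\<^sub>q (y - x) m\<^sub>q(dy) = 1\<close> by the mass and subtracting from \<open>r\<^sub>q (0)\<close> shows that this number is
  the constant value on \<open>[a, b]\<close> of the \<open>h\<^sub>q\<close>-potential of the normalized measure.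
\<close>

definition level :: "nat \<Rightarrow> real" where "level n = r0 n - 1 / mass n"

text \<open>
  Integrability of the resolvent density against the normalized measure comes from that of the kernel
  \<open>h\<^sub>q\<close>, which is bounded on \<open>[a - b, b - a]\<close>.
\<close>

lemma potential_normalized_near_level:
  assumes "x \<in> {a..b}"
  shows "\<bar>(LINT y|normalized n. potential_kernel \<Psi> 0 (y - x)) - level n\<bar> \<le> kernel_error (b - a) (q n)"
proof -
  interpret N: real_distribution "normalized n" by (rule chargeD(1)[OF charge_normalized])
  let ?r = "\<lambda>y. resolvent_density \<Psi> (q n) (y - x)"
  have r_eq: "?r = (\<lambda>y. r0 n - potential_kernel \<Psi> (q n) (y - x))"
    using potential_kernel_eq_resolvent_diff[OF q_pos[of n], symmetric] by simp
  have bdd: "AE y in normalized n. norm (potential_kernel \<Psi> c (y - x))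
      \<le> (LINT \<xi>|lborel. kernel_weight \<alpha> (b - a) \<xi>) / pi" if "c \<ge> 0" for c
    using chargeD(2)[OF charge_normalized]
    by eventually_elim (use assms that in \<open>auto intro!: abs_potential_kernel_le\<close>)
  have int: "integrable (normalized n) (\<lambda>y. potential_kernel \<Psi> c (y - x))" if "c \<ge> 0" for c
    by (rule N.integrable_const_bound[OF bdd[OF that]]) measurable
  have "(LINT y|normalized n. ?r y) = 1 / mass n"
  proof -
    have "?r \<in> borel_measurable (m n)"
      unfolding r_eq by (subst measurable_cong_sets[OF sets_m refl]) measurable
    then show ?thesis
      unfolding normalized_def using mass_pos[of n] capacity[OF assms, of n]
      by (subst integral_scale_measure) auto
  qed
  moreover have "(LINT y|normalized n. ?r y) = r0 n - (LINT y|normalized n. potential_kernel \<Psi> (q n) (y - x))"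
    unfolding r_eq using int[of "q n"] q_pos[of n] N.prob_space
    by (subst Bochner_Integration.integral_diff) auto
  ultimately have lev: "level n = (LINT y|normalized n. potential_kernel \<Psi> (q n) (y - x))"
    by (simp add: level_def)
  have "\<bar>LINT y|normalized n. potential_kernel \<Psi> 0 (y - x) - potential_kernel \<Psi> (q n) (y - x)\<bar>
      \<le> (LINT y|normalized n. \<bar>potential_kernel \<Psi> 0 (y - x) - potential_kernel \<Psi> (q n) (y - x)\<bar>)"
    by (rule integral_abs_bound)
  also have "\<dots> \<le> kernel_error (b - a) (q n)"
  proof (rule N.integral_le_const)
    show "AE y in normalized n. \<bar>potential_kernel \<Psi> 0 (y - x) - potential_kernel \<Psi> (q n) (y - x)\<bar>
        \<le> kernel_error (b - a) (q n)"
      using chargeD(2)[OF charge_normalized]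
      by eventually_elim
         (subst abs_minus_commute, use assms in \<open>auto intro!: potential_kernel_approx q_pos\<close>)
    show "integrable (normalized n) (\<lambda>y. \<bar>potential_kernel \<Psi> 0 (y - x) - potential_kernel \<Psi> (q n) (y - x)\<bar>)"
      using q_pos[of n] by (intro integrable_abs Bochner_Integration.integrable_diff int) auto
  qed
  finally show ?thesis unfolding lev
    using int[of 0] int[of "q n"] q_pos[of n] by (simp add: less_imp_le)
qed

lemma mutual_energy_normalized_near_level:
  assumes "charge N"
  shows "\<bar>mutual_energy (normalized n) N - level n\<bar> \<le> kernel_error (b - a) (q n)"
proof -
  interpret N: real_distribution N using assms by (rule chargeD)
  interpret K: real_distribution "normalized n" by (rule chargeD(1)[OF charge_normalized])
  let ?u = "\<lambda>x. LINT y|normalized n. potential_kernel \<Psi> 0 (y - x)"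
  have near: "AE x in N. \<bar>?u x - level n\<bar> \<le> kernel_error (b - a) (q n)"
    using chargeD(2)[OF assms] by eventually_elim (rule potential_normalized_near_level)
  have [measurable]: "?u \<in> borel_measurable N" by measurable
  have int: "integrable N (\<lambda>x. ?u x - level n)"
    by (rule N.integrable_const_bound[where B="kernel_error (b - a) (q n)"]) (use near in auto)
  have "mutual_energy (normalized n) N - level n = (LINT x|N. ?u x - level n)"
  proof -
    have "integrable N (\<lambda>x. (?u x - level n) + level n)"
      by (rule Bochner_Integration.integrable_add[OF int]) auto
    then have "integrable N ?u" by simp
    then show ?thesis unfolding mutual_energy_def using N.prob_space by simp
  qed
  then have "\<bar>mutual_energy (normalized n) N - level n\<bar> \<le> (LINT x|N. \<bar>?u x - level n\<bar>)"
    by (simp only:) (rule integral_abs_bound)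
  also have "\<dots> \<le> kernel_error (b - a) (q n)"
    by (rule N.integral_le_const) (use near int in auto)
  finally show ?thesis .
qed

lemma mutual_energy_M:
  assumes "charge N"
  shows "mutual_energy M N = k"
proof -
  interpret N: real_distribution N using assms by (rule chargeD)
  interpret M: real_distribution M using charge_M by (rule chargeD)
  have "mutual_energy M N = (LINT x|N. k)"
    unfolding mutual_energy_def
  proof (rule integral_cong_AE)
    show "AE x in N. (LINT y|M. potential_kernel \<Psi> 0 (y - x)) = k"
      using chargeD(2)[OF assms] by eventually_elim (rule potential_M)
  qed measurable
  then show ?thesis using N.prob_space by simp
qed

lemma error_tendsto: "(\<lambda>n. kernel_error (b - a) (q n)) \<longlonglongrightarrow> 0"
  using a_le_b by (intro kernel_error_tendsto_0 q_pos q_tendsto) auto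

lemma char_normalized_tendsto: "(\<lambda>n. char (normalized n) t) \<longlonglongrightarrow> char M t"
proof -
  have nonneg: "(\<lambda>n. char (normalized n) t) \<longlonglongrightarrow> char M t" if t: "t \<ge> 0" for t
  proof -
    define c where "c = (t + 1) powr (- \<alpha>) / (8 * char_lipschitz * C\<^sup>2)"
    define d where "d n = cmod (char (normalized n) t - char M t)" for n
    have c: "c > 0" using t C_ge_1 char_lipschitz_ge by (auto simp: c_def)
    have "d n ^ 3 \<le> 2 * pi / c * kernel_error (b - a) (q n)" for n
    proof -
      let ?J = "LBINT \<xi>:{0..}. (cmod (char (normalized n) \<xi> - char M \<xi>))\<^sup>2 * Re (1 / \<Psi> \<xi>)"
      have "d n ^ 3 * c \<le> ?J"
        unfolding c_def d_def by (rule energy_of_difference_ge[OF charge_normalized charge_M t])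
      also have "?J \<le> 2 * pi * kernel_error (b - a) (q n)"
      proof -
        have "- (1 / pi) * ?J = mutual_energy (normalized n) (normalized n) - mutual_energy (normalized n) M"
          using energy_of_difference(2)[OF charge_normalized charge_M, of n]
          by (simp add: mutual_energy_M charge_normalized charge_M)
        then have "1 / pi * ?J \<le> 2 * kernel_error (b - a) (q n)"
          using mutual_energy_normalized_near_level[OF charge_normalized, of n n]
            mutual_energy_normalized_near_level[OF charge_M, of n] by linarith
        then show ?thesis by (simp add: field_simps)
      qed
      finally show ?thesis using c by (simp add: field_simps)
    qed
    moreover have d: "d n \<ge> 0" for n by (simp add: d_def)
    ultimately have "\<forall>\<^sub>F n in sequentially. norm (d n ^ 3) \<le> 2 * pi / c * kernel_error (b - a) (q n)"
      by simp
    moreover have "(\<lambda>n. 2 * pi / c * kernel_error (b - a) (q n)) \<longlonglongrightarrow> 0"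
      by (intro tendsto_mult_right_zero error_tendsto)
    ultimately have "(\<lambda>n. d n ^ 3) \<longlonglongrightarrow> 0"
      by (rule Lim_null_comparison)
    then have "(\<lambda>n. root 3 (d n ^ 3)) \<longlonglongrightarrow> root 3 0" by (rule tendsto_real_root)
    then have "d \<longlonglongrightarrow> 0" by (simp add: real_root_power_cancel d)
    then have "(\<lambda>n. char (normalized n) t - char M t) \<longlonglongrightarrow> 0"
      unfolding d_def[abs_def] by (rule tendsto_norm_zero_cancel)
    then show ?thesis by (rule LIM_zero_cancel)
  qed
  show ?thesis
  proof (cases "t \<ge> 0")
    case False
    then have "(\<lambda>n. cnj (char (normalized n) (- t))) \<longlonglongrightarrow> cnj (char M (- t))"
      by (intro tendsto_cnj nonneg) auto
    then show ?thesis by (simp add: char_uminus)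
  qed (rule nonneg)
qed

lemma weak_conv_normalized: "weak_conv_m normalized M"
  by (rule levy_continuity) (auto intro: chargeD charge_normalized charge_M char_normalized_tendsto)

text \<open>
  The mutual energy of the normalized measure with \<open>M\<close> is close to the level, and in its Fourier
  representation dominated convergence gives the limit \<open>k\<close>.
\<close>

lemma level_tendsto: "level \<longlonglongrightarrow> k"
proof -
  let ?f = "\<lambda>N \<xi>. indicat_real {0..} \<xi> *\<^sub>R Re ((1 - char M \<xi> * char N (- \<xi>)) / \<Psi> \<xi>)"
  note [measurable] = measurable_char[OF charge_M] measurable_char[OF charge_normalized]
  have "(\<lambda>n. LINT \<xi>|lborel. ?f (normalized n) \<xi>)
    \<longlonglongrightarrow> (LINT \<xi>|lborel. ?f M \<xi>)"
  proof (rule integral_dominated_convergence[where w="kernel_weight \<alpha> (b - a)"])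
    show "AE \<xi> in lborel. norm (?f (normalized n) \<xi>)
        \<le> kernel_weight \<alpha> (b - a) \<xi>" for n
      by (intro AE_I2 abs_indicator_Re_divide_le cmod_one_minus_char_mult_le charge_M charge_normalized)
    show "AE \<xi> in lborel. (\<lambda>n. ?f (normalized n) \<xi>)
        \<longlonglongrightarrow> ?f M \<xi>"
      unfolding divide_inverse by (intro AE_I2 tendsto_intros char_normalized_tendsto)
  qed (measurable, rule integrable_weight)
  then have "(\<lambda>n. 1 / pi * (LBINT \<xi>:{0..}. Re ((1 - char M \<xi> * char (normalized n) (- \<xi>)) / \<Psi> \<xi>)))
      \<longlonglongrightarrow> 1 / pi * (LBINT \<xi>:{0..}. Re ((1 - char M \<xi> * char M (- \<xi>)) / \<Psi> \<xi>))"
    unfolding set_lebesgue_integral_def by (rule tendsto_mult_left)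
  then have "(\<lambda>n. mutual_energy (normalized n) M) \<longlonglongrightarrow> mutual_energy M M"
    by (simp only: mutual_energy_eq_char charge_M charge_normalized)
  then have *: "(\<lambda>n. mutual_energy (normalized n) M) \<longlonglongrightarrow> k"
    by (simp only: mutual_energy_M[OF charge_M])
  have "(\<lambda>n. mutual_energy (normalized n) M - level n) \<longlonglongrightarrow> 0"
    by (rule Lim_null_comparison[OF _ error_tendsto])
       (use mutual_energy_normalized_near_level[OF charge_M] in auto)
  from tendsto_diff[OF * this] show ?thesis by simp
qed

lemma r0_at_top: "filterlim r0 at_top sequentially"
  by (rule resolvent_density_0_at_top[OF q_pos q_tendsto])

lemma r0_pos: "r0 n > 0"
proof -
  have "0 < (q n powr (1 / \<alpha>)) powr (1 - \<alpha>) / (pi * (1 + C)\<^sup>2)"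
    using q_pos[of n] C_ge_1 by auto
  also have "\<dots> \<le> resolvent_density \<Psi> ((q n powr (1 / \<alpha>)) powr \<alpha>) 0"
    using q_pos[of n] by (intro resolvent_density_0_ge) auto
  finally show ?thesis using q_pos[of n] index by (simp add: powr_powr)
qed

text \<open>
  By definition of the level, \<open>r\<^sub>q (0) m\<^sub>q [a, b] = 1 / (1 - level / r\<^sub>q (0))\<close>; the level is bounded and
  \<open>r\<^sub>q (0)\<close> diverges.
\<close>

lemma scaled_mass_tendsto_1: "(\<lambda>n. r0 n * mass n) \<longlonglongrightarrow> 1"
proof -
  have "(\<lambda>n. level n / r0 n) \<longlonglongrightarrow> 0"
    using level_tendsto by (rule tendsto_divide_0) (rule filterlim_at_top_imp_at_infinity[OF r0_at_top])
  then have "(\<lambda>n. 1 / (1 - level n / r0 n)) \<longlonglongrightarrow> 1 / (1 - 0)"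
    by (intro tendsto_intros) auto
  moreover have "1 / (1 - level n / r0 n) = r0 n * mass n" for n
    using r0_pos[of n] mass_pos[of n] by (simp add: level_def field_simps)
  ultimately show ?thesis by simp
qed

theorem robin_constant_tendsto: "(\<lambda>n. r0 n * (r0 n * mass n - 1)) \<longlonglongrightarrow> k"
proof -
  have eq: "r0 n * (r0 n * mass n - 1) = r0 n * mass n * level n" for n
    using mass_pos[of n] by (simp add: level_def field_simps)
  show ?thesis
    unfolding eq using tendsto_mult[OF scaled_mass_tendsto_1 level_tendsto] by simp
qed

theorem equilibrium_tendsto:
  fixes f :: "real \<Rightarrow> real"
  assumes f: "continuous_on UNIV f" "bounded (range f)"
  shows "(\<lambda>n. LINT x|scale_measure (ennreal (r0 n)) (m n). f x) \<longlonglongrightarrow> (LINT x|M. f x)"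
proof -
  have [measurable]: "f \<in> borel_measurable borel"
    using f by (intro borel_measurable_continuous_onI)
  obtain B where B: "\<And>x. norm (f x) \<le> B"
    using f(2) by (auto simp: bounded_iff)
  have "(\<lambda>n. LINT x|normalized n. f x) \<longlonglongrightarrow> (LINT x|M. f x)"
    by (rule weak_conv_imp_integral_bdd_continuous_conv[OF _ _ weak_conv_normalized _ B])
       (use f chargeD(1) charge_normalized charge_M in \<open>auto simp: continuous_on_eq_continuous_at\<close>)
  then have "(\<lambda>n. (r0 n * mass n) * (LINT x|normalized n. f x)) \<longlonglongrightarrow> 1 * (LINT x|M. f x)"
    by (intro tendsto_mult scaled_mass_tendsto_1)
  moreover have "(r0 n * mass n) * (LINT x|normalized n. f x)
      = (LINT x|scale_measure (ennreal (r0 n)) (m n). f x)" for n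
    unfolding normalized_def using mass_pos[of n] r0_pos[of n]
    by (subst (1 2) integral_scale_measure) (auto simp: measurable_cong_sets[OF sets_m refl])
  ultimately show ?thesis by simp
qed

end

section \<open>The potential kernel of a stable process\<close>

lemma absolutely_integrable_imp_lborel:
  fixes f :: "real \<Rightarrow> real"
  assumes "f absolutely_integrable_on S" and [measurable]: "S \<in> sets borel" "f \<in> borel_measurable borel"
  shows "set_integrable lborel S f" "(LBINT x:S. f x) = integral S f"
proof -
  show *: "set_integrable lborel S f"
    using assms(1) unfolding set_integrable_def
    by (subst (asm) integrable_completion) auto
  show "(LBINT x:S. f x) = integral S f"
    by (rule set_borel_integral_eq_integral(2)[OF *])
qed

text \<open>
  Represents \<open>\<xi>\<^sup>-\<^sup>a\<close> as a mixture of exponentials. Below this trades the oscillating integral of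
  \<open>\<xi>\<^sup>-\<^sup>\<alpha> (1 - e\<^sup>-\<^sup>i\<^sup>\<xi>)\<close> for an elementary one without analytic continuation.
\<close>

lemma has_bochner_integral_Gamma_laplace:
  assumes "a > 0" "\<xi> > 0"
  shows "has_bochner_integral lborel
    (\<lambda>s. indicat_real {0<..} s * (s powr (a - 1) * exp (- (\<xi> * s)))) (Gamma a * \<xi> powr (- a))"
proof -
  define g where "g t = indicator {0..} t * t powr (a - 1) / exp t" for t :: real
  have "has_bochner_integral lborel g (Gamma a)"
  proof (rule has_bochner_integral_nn_integral)
    show "g \<in> borel_measurable lborel" unfolding g_def by measurable
    show "AE t in lborel. 0 \<le> g t" by (rule AE_I2) (simp add: g_def)
    show "(\<integral>\<^sup>+ t. ennreal (g t) \<partial>lborel) = ennreal (Gamma a)"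
      unfolding g_def by (rule Gamma_conv_nn_integral_real[OF assms(1), symmetric])
  qed (use assms Gamma_real_pos in \<open>auto intro: less_imp_le\<close>)
  then have "has_bochner_integral lborel (\<lambda>s. \<xi> powr (1 - a) * g (0 + \<xi> * s))
      (\<xi> powr (1 - a) * (Gamma a /\<^sub>R \<bar>\<xi>\<bar>))"
    using assms by (intro has_bochner_integral_mult_right)
      (subst (asm) lborel_has_bochner_integral_real_affine_iff[where c=\<xi> and t=0], auto)
  moreover have "\<xi> powr (1 - a) * (Gamma a /\<^sub>R \<bar>\<xi>\<bar>) = Gamma a * \<xi> powr (- a)"
    using assms powr_add[of \<xi> 1 "-a"] by (simp add: field_simps)
  moreover have "\<xi> powr (1 - a) * g (0 + \<xi> * s)
      = indicat_real {0<..} s * (s powr (a - 1) * exp (- (\<xi> * s)))" for s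
  proof (cases "s > 0")
    case True
    have "\<xi> powr (1 - a) * \<xi> powr (a - 1) = 1"
      using assms by (simp add: powr_add[symmetric])
    then show ?thesis using True assms
      by (simp add: g_def powr_mult exp_minus field_simps)
  next
    case False
    then show ?thesis using assms
      by (cases "s = 0") (auto simp: g_def indicator_def mult_le_0_iff zero_le_mult_iff)
  qed
  ultimately show ?thesis by (simp only:)
qed

lemma LBINT_exp_complex:
  fixes z :: complex
  assumes "Re z > 0"
  shows "set_integrable lborel {0<..} (\<lambda>x. exp (- (z * of_real x)))"
    and "(LBINT x:{0<..}. exp (- (z * of_real x))) = 1 / z"
proof -
  show int: "set_integrable lborel {0<..} (\<lambda>x. exp (- (z * of_real x)))"
  proof (rule set_integrable_bound[OF integrable_I0i_exp_mscale[OF assms]])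
    show "AE x in lborel. x \<in> {0<..} \<longrightarrow> norm (exp (- (z * complex_of_real x))) \<le> norm (exp (- (x * Re z)))"
      by (intro AE_I2) (simp add: mult.commute)
  qed (unfold set_borel_measurable_def, measurable)
  have z: "z \<noteq> 0" using assms by auto
  let ?F = "\<lambda>x::real. - exp (- (z * of_real x)) / z"
  have "(LBINT x=0..\<infinity>. exp (- (z * of_real x))) = 0 - (- 1 / z)"
  proof (rule interval_integral_FTC_integrable[where F="?F"])
    show "(?F has_vector_derivative exp (- (z * of_real x))) (at x)" for x
    proof -
      have "((\<lambda>w. - exp (- (z * w)) / z) has_field_derivative exp (- (z * of_real x))) (at (of_real x))"
        using z by (auto intro!: derivative_eq_intros)
      then show ?thesis
        by (rule has_vector_derivative_real_field)
    qed
    show "set_integrable lborel (einterval 0 \<infinity>) (\<lambda>x. exp (- (z * of_real x)))"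
      using int by (simp add: einterval_eq zero_ereal_def)
    have "(?F \<longlongrightarrow> ?F 0) (at_right 0)"
      by (intro tendsto_intros) (use z in auto)
    then show "((?F \<circ> real_of_ereal) \<longlongrightarrow> - 1 / z) (at_right 0)"
      by (simp add: zero_ereal_def ereal_tendsto_simps)
    have "((\<lambda>x. exp (- (Re z * x))) \<longlongrightarrow> 0) at_top"
      using assms by real_asymp
    then have "((\<lambda>x. norm (exp (- (z * complex_of_real x)))) \<longlongrightarrow> 0) at_top"
      by simp
    then have "((\<lambda>x. exp (- (z * complex_of_real x))) \<longlongrightarrow> 0) at_top"
      by (rule tendsto_norm_zero_cancel)
    then have "(?F \<longlongrightarrow> - 0 / z) at_top"
      by (intro tendsto_intros z)
    then show "((?F \<circ> real_of_ereal) \<longlongrightarrow> 0) (at_left \<infinity>)"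
      by (simp add: ereal_tendsto_simps)
  qed auto
  then show "(LBINT x:{0<..}. exp (- (z * of_real x))) = 1 / z"
    by (simp add: interval_lebesgue_integral_0_infty)
qed

lemma sin_Gamma_reflection_real:
  fixes x :: real
  assumes "0 < x" "x < 1"
  shows "Gamma x * Gamma (1 - x) = pi / sin (pi * x)"
proof -
  have "complex_of_real (Gamma x * Gamma (1 - x)) = Gamma (of_real x) * Gamma (1 - of_real x)"
    using Gamma_complex_of_real[of x] Gamma_complex_of_real[of "1 - x"] by simp
  also have "\<dots> = complex_of_real (pi / sin (pi * x))"
    using sin_of_real[of "pi * x", where 'a=complex] by (simp add: Gamma_reflection_complex)
  finally have "complex_of_real (Gamma x * Gamma (1 - x)) = complex_of_real (pi / sin (pi * x))" .
  then show ?thesis by (simp only: of_real_eq_iff)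
qed

text \<open>
  The substitution \<open>t = s\<^sup>2 / (1 + s\<^sup>2)\<close> maps the half-line onto the unit interval and the integrand to a
  Beta density with parameters \<open>p / 2\<close> and \<open>1 - p / 2\<close>; the reflection formula evaluates it.
\<close>

lemma LBINT_powr_div_one_plus_square:
  assumes "0 < p" "p < 2"
  shows "set_integrable lborel {0<..} (\<lambda>s. s powr (p - 1) / (1 + s\<^sup>2))"
    and "(LBINT s:{0<..}. s powr (p - 1) / (1 + s\<^sup>2)) = pi / (2 * sin (pi * p / 2))"
proof -
  define f where "f t = t powr (p / 2 - 1) * (1 - t) powr (- (p / 2))" for t :: real
  define g where "g s = s\<^sup>2 / (1 + s\<^sup>2)" for s :: real
  define g' where "g' s = 2 * s / (1 + s\<^sup>2)\<^sup>2" for s :: real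
  have pos: "1 + s\<^sup>2 > 0" for s :: real by (simp add: add_pos_nonneg)
  have nz: "1 + s\<^sup>2 \<noteq> 0" for s :: real using pos[of s] by linarith
  have "(f has_integral Beta (p / 2) (1 - p / 2)) {0..1}"
    using has_integral_Beta_real[of "p/2" "1 - p/2"] assms unfolding f_def by simp
  then have f: "(f has_integral Beta (p / 2) (1 - p / 2)) {0<..<1}"
    by (simp add: has_integral_Icc_iff_Ioo)
  then have abs_f: "f absolutely_integrable_on {0<..<1}"
    by (intro nonnegative_absolutely_integrable_1) (auto simp: f_def integrable_on_def)
  have der: "(g has_field_derivative g' s) (at s within {0<..})" for s
    unfolding g_def g'_def using nz[of s]
    by (auto intro!: derivative_eq_intros simp: field_simps power2_eq_square power4_eq_xxxx)
  have img: "g ` {0<..} = {0<..<1}"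
  proof (intro equalityI subsetI)
    fix t assume "t \<in> g ` {0<..}"
    then show "t \<in> {0<..<1}" using pos by (auto simp: g_def field_simps)
  next
    fix t :: real assume t: "t \<in> {0<..<1}"
    then have "t = g (sqrt (t / (1 - t)))" by (simp add: g_def field_simps)
    moreover have "sqrt (t / (1 - t)) \<in> {0<..}" using t by simp
    ultimately show "t \<in> g ` {0<..}" by blast
  qed
  have inj: "inj_on g {0<..}"
  proof (rule inj_onI)
    fix x y :: real assume xy: "x \<in> {0<..}" "y \<in> {0<..}" and "g x = g y"
    then have "x\<^sup>2 * (1 + y\<^sup>2) = y\<^sup>2 * (1 + x\<^sup>2)"
      using nz by (simp add: g_def frac_eq_eq)
    then have "x\<^sup>2 = y\<^sup>2" by (simp add: algebra_simps)
    then show "x = y" using xy by (simp add: power2_eq_iff_nonneg)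
  qed
  have eq: "\<bar>g' s\<bar> * f (g s) = 2 * (s powr (p - 1) / (1 + s\<^sup>2))" if "s \<in> {0<..}" for s
  proof -
    have s: "s > 0" using that by simp
    have g1: "1 - g s = 1 / (1 + s\<^sup>2)" using nz[of s] by (simp add: g_def field_simps)
    have s2: "(s\<^sup>2) powr (p / 2 - 1) = s powr (p - 2)"
      using s by (simp add: powr_powr flip: powr_numeral)
    have "f (g s) = s powr (p - 2) / (1 + s\<^sup>2) powr (p / 2 - 1) * (1 / (1 + s\<^sup>2) powr (- (p / 2)))"
      unfolding f_def g1 using s pos[of s] by (simp add: g_def powr_divide s2)
    also have "\<dots> = s powr (p - 2) * (1 + s\<^sup>2)"
      using pos[of s] by (simp add: powr_diff powr_minus)
    finally have "f (g s) = s powr (p - 2) * (1 + s\<^sup>2)" .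
    moreover have "s * s powr (p - 2) = s powr (p - 1)"
      using s powr_add[of s 1 "p - 2"] by simp
    ultimately show ?thesis using s nz[of s] pos[of s]
      by (simp add: g'_def power2_eq_square[of "1 + s\<^sup>2"] abs_mult)
  qed
  have "(\<lambda>s. \<bar>g' s\<bar> * f (g s)) absolutely_integrable_on {0<..} \<and>
      integral {0<..} (\<lambda>s. \<bar>g' s\<bar> * f (g s)) = Beta (p / 2) (1 - p / 2)"
    using has_absolute_integral_change_of_variables_1'[OF _ der inj, of f "Beta (p / 2) (1 - p / 2)"]
      abs_f f unfolding img by (auto simp: integral_unique)
  moreover have "(\<lambda>s. \<bar>g' s\<bar> * f (g s)) absolutely_integrable_on {0<..}
      \<longleftrightarrow> (\<lambda>s. 2 * (s powr (p - 1) / (1 + s\<^sup>2))) absolutely_integrable_on {0<..}"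
    by (rule set_integrable_cong) (simp_all only: eq)
  moreover have "integral {0<..} (\<lambda>s. \<bar>g' s\<bar> * f (g s))
      = integral {0<..} (\<lambda>s. 2 * (s powr (p - 1) / (1 + s\<^sup>2)))"
    by (rule Henstock_Kurzweil_Integration.integral_cong) (simp only: eq)
  ultimately have h: "(\<lambda>s. 2 * (s powr (p - 1) / (1 + s\<^sup>2))) absolutely_integrable_on {0<..}"
      "integral {0<..} (\<lambda>s. 2 * (s powr (p - 1) / (1 + s\<^sup>2))) = Beta (p / 2) (1 - p / 2)"
    by simp_all
  from h(1) have "set_integrable lborel {0<..} (\<lambda>s. 2 * (s powr (p - 1) / (1 + s\<^sup>2)))"
    by (rule absolutely_integrable_imp_lborel(1)) auto
  then show "set_integrable lborel {0<..} (\<lambda>s. s powr (p - 1) / (1 + s\<^sup>2))"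
    using set_integrable_mult_right[of "1/2" lborel "{0<..}" "\<lambda>s. 2 * (s powr (p - 1) / (1 + s\<^sup>2))"] by simp
  have "2 * (LBINT s:{0<..}. s powr (p - 1) / (1 + s\<^sup>2)) = Beta (p / 2) (1 - p / 2)"
    using absolutely_integrable_imp_lborel(2)[OF h(1)] unfolding h(2) set_integral_mult_right by simp
  also have "\<dots> = pi / sin (pi * (p / 2))"
    using sin_Gamma_reflection_real[of "p/2"] assms by (simp add: Beta_def)
  finally show "(LBINT s:{0<..}. s powr (p - 1) / (1 + s\<^sup>2)) = pi / (2 * sin (pi * p / 2))"
    by (simp add: field_simps)
qed

definition fourier_kernel :: "real \<Rightarrow> real \<Rightarrow> complex" where
  "fourier_kernel \<alpha> x = (LBINT \<xi>:{0<..}. (1 - iexp (- (\<xi> * x))) * of_real (\<xi> powr (- \<alpha>)))"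

lemma set_integrable_fourier_kernel:
  assumes "1 < \<alpha>" "\<alpha> < 2"
  shows "set_integrable lborel {0<..} (\<lambda>\<xi>. (1 - iexp (- (\<xi> * x))) * of_real (\<xi> powr (- \<alpha>)))"
  unfolding set_integrable_def
proof (rule Bochner_Integration.integrable_bound[OF integrable_kernel_weight[OF assms, of "\<bar>x\<bar>"]])
  show "AE \<xi> in lborel. norm (indicat_real {0<..} \<xi> *\<^sub>R ((1 - iexp (- (\<xi> * x))) * of_real (\<xi> powr (- \<alpha>))))
      \<le> norm (kernel_weight \<alpha> \<bar>x\<bar> \<xi>)"
  proof (rule AE_I2)
    fix \<xi> :: real
    have "\<xi> > 0 \<Longrightarrow> \<bar>- (\<xi> * x)\<bar> = \<bar>x\<bar> * \<xi>" by (simp add: abs_mult mult.commute)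
    then show "norm (indicat_real {0<..} \<xi> *\<^sub>R ((1 - iexp (- (\<xi> * x))) * of_real (\<xi> powr (- \<alpha>))))
      \<le> norm (kernel_weight \<alpha> \<bar>x\<bar> \<xi>)"
      using cmod_one_minus_iexp_le[of "- (\<xi> * x)"]
      by (auto simp: indicator_def kernel_weight_def norm_mult abs_mult mult.commute[of "\<bar>x\<bar>"] intro!: mult_right_mono)
  qed
qed auto

text \<open>
  With \<open>\<Gamma> (\<alpha>) \<xi>\<^sup>-\<^sup>\<alpha> = \<integral> s\<^sup>\<alpha>\<^sup>-\<^sup>1 e\<^sup>-\<^sup>\<xi>\<^sup>s ds\<close> and Fubini, the inner integral over \<open>\<xi>\<close> is
  \<open>1 / s - 1 / (s + i)\<close>. Its real and imaginary parts lead to the preceding integral with exponents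
  \<open>p = \<alpha> - 1\<close> and \<open>p = \<alpha>\<close>. Absolute integrability of the double integral is that of
  \<open>\<xi>\<^sup>-\<^sup>\<alpha> (1 - e\<^sup>-\<^sup>i\<^sup>\<xi>)\<close>.
\<close>

lemma fourier_kernel_1:
  assumes "1 < \<alpha>" "\<alpha> < 2"
  shows "fourier_kernel \<alpha> 1 = of_real (pi / (2 * Gamma \<alpha>)) *
    Complex (1 / sin (pi * (\<alpha> - 1) / 2)) (1 / sin (pi * \<alpha> / 2))"
proof -
  define F :: "real \<Rightarrow> real \<Rightarrow> complex" where
    "F \<xi> s = (if \<xi> > 0 \<and> s > 0 then (1 - iexp (- \<xi>)) * of_real (s powr (\<alpha> - 1) * exp (- (\<xi> * s))) else 0)" for \<xi> s
  have G: "Gamma \<alpha> > 0" using assms by (intro Gamma_real_pos) auto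
  have [measurable]: "case_prod F \<in> borel_measurable (lborel \<Otimes>\<^sub>M lborel)"
    unfolding F_def by measurable
  have F_s: "F \<xi> s = (indicat_real {0<..} \<xi> *\<^sub>R (1 - iexp (- \<xi>))) *
      of_real (indicat_real {0<..} s * (s powr (\<alpha> - 1) * exp (- (\<xi> * s))))" for \<xi> s
    by (auto simp: F_def indicator_def)
  have s_all: "integrable lborel (F \<xi>) \<and> (LINT s|lborel. F \<xi> s) = of_real (Gamma \<alpha>) *
    (indicat_real {0<..} \<xi> *\<^sub>R ((1 - iexp (- (\<xi> * 1))) * of_real (\<xi> powr (- \<alpha>)))) \<and>
    (LINT s|lborel. norm (F \<xi> s)) = Gamma \<alpha> *
    norm (indicat_real {0<..} \<xi> *\<^sub>R ((1 - iexp (- (\<xi> * 1))) * of_real (\<xi> powr (- \<alpha>))))" for \<xi>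
  proof (cases "\<xi> > 0")
    case True
    have hb: "has_bochner_integral lborel
        (\<lambda>s. indicat_real {0<..} s * (s powr (\<alpha> - 1) * exp (- (\<xi> * s)))) (Gamma \<alpha> * \<xi> powr (- \<alpha>))"
      using assms True by (intro has_bochner_integral_Gamma_laplace) auto
    have n: "norm (F \<xi> s) = norm (1 - iexp (- \<xi>)) *
        (indicat_real {0<..} s * (s powr (\<alpha> - 1) * exp (- (\<xi> * s))))" for s
      unfolding F_s using True by (auto simp: norm_mult indicator_def)
    have v: "F \<xi> s = (1 - iexp (- \<xi>)) *
        of_real (indicat_real {0<..} s * (s powr (\<alpha> - 1) * exp (- (\<xi> * s))))" for s
      unfolding F_s using True by simp
    have "integrable lborel (F \<xi>)"
      unfolding v[abs_def] using hb[THEN has_bochner_integral_iff[THEN iffD1]]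
      by (intro integrable_mult_right integrable_of_real) auto
    moreover have "(LINT s|lborel. F \<xi> s) = (1 - iexp (- \<xi>)) * of_real (Gamma \<alpha> * \<xi> powr (- \<alpha>))"
      unfolding v[abs_def] using hb[THEN has_bochner_integral_iff[THEN iffD1]]
      by (simp only: integral_mult_right_zero integral_complex_of_real)
    moreover have "(LINT s|lborel. norm (F \<xi> s)) = norm (1 - iexp (- \<xi>)) * (Gamma \<alpha> * \<xi> powr (- \<alpha>))"
      unfolding n using hb[THEN has_bochner_integral_iff[THEN iffD1]]
      by (simp only: integral_mult_right_zero)
    ultimately show ?thesis using True G by (simp add: norm_mult)
  qed (simp add: F_def[abs_def])
  note s_int = s_all[THEN conjunct1] and s_val = s_all[THEN conjunct2, THEN conjunct1]
    and s_norm = s_all[THEN conjunct2, THEN conjunct2]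
  have "integrable (lborel \<Otimes>\<^sub>M lborel) (case_prod F)"
  proof (rule lborel_pair.Fubini_integrable)
    show "integrable lborel (\<lambda>\<xi>. LINT s|lborel. norm (case_prod F (\<xi>, s)))"
      using set_integrable_fourier_kernel[OF assms, of 1]
      unfolding prod.case s_norm set_integrable_def by (intro integrable_mult_right integrable_norm)
  qed (use s_int in auto)
  note fub = lborel_pair.Fubini_integral[OF this]
  have xi_val: "(LINT \<xi>|lborel. F \<xi> s) =
      indicat_real {0<..} s *\<^sub>R Complex (s powr (\<alpha> - 1 - 1) / (1 + s\<^sup>2)) (s powr (\<alpha> - 1) / (1 + s\<^sup>2))" for s
  proof (cases "s > 0")
    case True
    let ?z = "Complex s 1"
    have z: "?z \<noteq> 0" "(of_real s :: complex) \<noteq> 0" using True by (auto simp: complex_eq_iff)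
    have "F \<xi> s = of_real (s powr (\<alpha> - 1)) * (indicat_real {0<..} \<xi> *\<^sub>R exp (- (of_real s * of_real \<xi>))
        - indicat_real {0<..} \<xi> *\<^sub>R exp (- (?z * of_real \<xi>)))" for \<xi>
    proof (cases "\<xi> > 0")
      case xi: True
      have "exp (- (?z * of_real \<xi>)) = iexp (- \<xi>) * exp (- (of_real s * of_real \<xi>))"
        unfolding exp_add[symmetric] by (rule arg_cong[where f=exp]) (simp add: complex_eq_iff)
      moreover have "of_real (exp (- (\<xi> * s))) = exp (- (of_real s * complex_of_real \<xi>))"
        by (simp add: exp_of_real mult.commute flip: of_real_mult of_real_minus)
      ultimately show ?thesis using xi True by (simp add: F_def algebra_simps)
    qed (simp add: F_def)
    then have "(LINT \<xi>|lborel. F \<xi> s) = of_real (s powr (\<alpha> - 1)) * (1 / of_real s - 1 / ?z)"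
      using LBINT_exp_complex[of "of_real s"] LBINT_exp_complex[of ?z] True
      unfolding set_integrable_def set_lebesgue_integral_def by simp
    also have "1 / of_real s - 1 / ?z = of_real (1 / (s * (1 + s\<^sup>2))) * Complex 1 s"
    proof -
      have "?z * Complex s (-1) = of_real (1 + s\<^sup>2)"
        by (simp add: complex_eq_iff power2_eq_square)
      then have "1 / ?z = Complex s (- 1) / of_real (1 + s\<^sup>2)"
      proof -
        have nz: "(of_real (1 + s\<^sup>2) :: complex) \<noteq> 0"
          using True by (simp only: of_real_eq_0_iff) (smt (verit) zero_le_power2)
        then show ?thesis
          using \<open>?z * Complex s (-1) = of_real (1 + s\<^sup>2)\<close>
          by (intro iffD2[OF frac_eq_eq[OF z(1) nz]]) (simp only: mult_1_left mult.commute)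
      qed
      then have "1 / of_real s - 1 / ?z = of_real (1 / s) - Complex s (- 1) / of_real (1 + s\<^sup>2)"
        by simp
      moreover have "1 / s - s / (1 + s\<^sup>2) = 1 / (s * (1 + s\<^sup>2))"
        using True add_pos_nonneg[of 1 "s\<^sup>2"] by (simp add: field_simps power2_eq_square)
      ultimately show ?thesis using True
        by (simp add: complex_eq_iff)
    qed
    also have "of_real (s powr (\<alpha> - 1)) * (of_real (1 / (s * (1 + s\<^sup>2))) * Complex 1 s)
       = Complex (s powr (\<alpha> - 1 - 1) / (1 + s\<^sup>2)) (s powr (\<alpha> - 1) / (1 + s\<^sup>2))"
    proof -
      have "s powr (\<alpha> - 1 - 1) = s powr (\<alpha> - 1) / s"
        using True powr_diff[of s "\<alpha> - 1" 1] by simp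
      then show ?thesis using True by (simp add: complex_eq_iff)
    qed
    finally show ?thesis using True by simp
  qed (simp add: F_def[abs_def])
  have K1: "set_integrable lborel {0<..} (\<lambda>s. s powr (\<alpha> - 1 - 1) / (1 + s\<^sup>2))"
      "(LBINT s:{0<..}. s powr (\<alpha> - 1 - 1) / (1 + s\<^sup>2)) = pi / (2 * sin (pi * (\<alpha> - 1) / 2))"
    using assms LBINT_powr_div_one_plus_square[of "\<alpha> - 1"] by simp_all
  have K2: "set_integrable lborel {0<..} (\<lambda>s. s powr (\<alpha> - 1) / (1 + s\<^sup>2))"
      "(LBINT s:{0<..}. s powr (\<alpha> - 1) / (1 + s\<^sup>2)) = pi / (2 * sin (pi * \<alpha> / 2))"
    using assms by (auto intro!: LBINT_powr_div_one_plus_square)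
  have "of_real (Gamma \<alpha>) * fourier_kernel \<alpha> 1 = (LINT \<xi>|lborel. LINT s|lborel. F \<xi> s)"
    unfolding s_val fourier_kernel_def set_lebesgue_integral_def by (simp only: integral_mult_right_zero)
  also have "\<dots> = (LINT s|lborel. LINT \<xi>|lborel. F \<xi> s)" by (rule fub[symmetric])
  also have "\<dots> = (LINT s|lborel. of_real (indicat_real {0<..} s *\<^sub>R (s powr (\<alpha> - 1 - 1) / (1 + s\<^sup>2)))
      + \<i> * of_real (indicat_real {0<..} s *\<^sub>R (s powr (\<alpha> - 1) / (1 + s\<^sup>2))))"
    unfolding xi_val by (intro Bochner_Integration.integral_cong) (auto simp: complex_eq_iff)
  also have "\<dots> = of_real (LBINT s:{0<..}. s powr (\<alpha> - 1 - 1) / (1 + s\<^sup>2))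
      + \<i> * of_real (LBINT s:{0<..}. s powr (\<alpha> - 1) / (1 + s\<^sup>2))"
    using K1(1) K2(1) unfolding set_integrable_def set_lebesgue_integral_def
    by (subst Bochner_Integration.integral_add)
       (auto simp del: real_scaleR_def intro!: integrable_mult_right integrable_of_real)
  also have "\<dots> = of_real (pi / 2) * Complex (1 / sin (pi * (\<alpha> - 1) / 2)) (1 / sin (pi * \<alpha> / 2))"
    unfolding K1(2) K2(2) by (simp add: complex_eq_iff)
  finally show ?thesis using G by (simp add: field_simps)
qed

lemma fourier_kernel_pos:
  assumes "x > 0"
  shows "fourier_kernel \<alpha> x = of_real (x powr (\<alpha> - 1)) * fourier_kernel \<alpha> 1"
proof -
  have "fourier_kernel \<alpha> 1 = \<bar>x\<bar> *\<^sub>R (LINT \<xi>|lborel. indicat_real {0<..} (0 + x * \<xi>) *\<^sub>R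
      ((1 - iexp (- ((0 + x * \<xi>) * 1))) * of_real ((0 + x * \<xi>) powr (- \<alpha>))))"
    unfolding fourier_kernel_def set_lebesgue_integral_def
    using assms by (intro lborel_integral_real_affine) auto
  also have "\<dots> = x *\<^sub>R (LINT \<xi>|lborel. of_real (x powr (- \<alpha>)) * (indicat_real {0<..} \<xi> *\<^sub>R
      ((1 - iexp (- (\<xi> * x))) * of_real (\<xi> powr (- \<alpha>)))))"
    using assms by (intro arg_cong2[where f=scaleR] Bochner_Integration.integral_cong)
      (auto simp: indicator_def zero_less_mult_iff powr_mult mult.commute)
  also have "\<dots> = of_real (x powr (1 - \<alpha>)) * fourier_kernel \<alpha> x"
    unfolding fourier_kernel_def set_lebesgue_integral_def
    using assms powr_add[of x 1 "-\<alpha>"] by (simp add: scaleR_conv_of_real)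
  finally have "of_real (x powr (\<alpha> - 1)) * fourier_kernel \<alpha> 1
      = of_real (x powr (\<alpha> - 1) * x powr (1 - \<alpha>)) * fourier_kernel \<alpha> x" by simp
  then show ?thesis using assms by (simp add: powr_add[symmetric])
qed

lemma fourier_kernel_uminus: "fourier_kernel \<alpha> (- x) = cnj (fourier_kernel \<alpha> x)"
  unfolding fourier_kernel_def set_lebesgue_integral_def Bochner_Integration.integral_cnj[symmetric]
  by (intro Bochner_Integration.integral_cong) (auto simp: exp_cnj)

lemma fourier_kernel_0: "fourier_kernel \<alpha> 0 = 0"
  unfolding fourier_kernel_def by simp

lemma measurable_stable_exponent [measurable]: "stable_exponent \<alpha> \<beta> \<in> borel_measurable borel"
  unfolding stable_exponent_def by measurable

lemma stable_exponent_pos: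
  "\<xi> > 0 \<Longrightarrow> stable_exponent \<alpha> \<beta> \<xi> = of_real (\<xi> powr \<alpha>) * Complex 1 (- (\<beta> * tan (pi * \<alpha> / 2)))"
  unfolding stable_exponent_def by (simp add: complex_eq_iff)

lemma stable_like_exponent_stable:
  assumes "1 < \<alpha>" "\<alpha> < 2"
  shows "stable_like_exponent (stable_exponent \<alpha> \<beta>) \<alpha> (1 + \<bar>\<beta> * tan (pi * \<alpha> / 2)\<bar>)"
proof
  fix \<xi> :: real assume "\<xi> \<ge> 0"
  show "\<xi> powr \<alpha> \<le> Re (stable_exponent \<alpha> \<beta> \<xi>)" 
    using \<open>\<xi> \<ge> 0\<close> by (simp add: stable_exponent_def)
  show "cmod (stable_exponent \<alpha> \<beta> \<xi>) \<le> (1 + \<bar>\<beta> * tan (pi * \<alpha> / 2)\<bar>) * \<xi> powr \<alpha>"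
  proof (cases "\<xi> = 0")
    case False
    then have x: "\<xi> > 0" using \<open>\<xi> \<ge> 0\<close> by simp
    have "cmod (Complex 1 (- (\<beta> * tan (pi * \<alpha> / 2)))) \<le> 1 + \<bar>\<beta> * tan (pi * \<alpha> / 2)\<bar>"
      using cmod_le[of "Complex 1 (- (\<beta> * tan (pi * \<alpha> / 2)))"] by simp
    then show ?thesis unfolding stable_exponent_pos[OF x] norm_mult
      by (simp add: mult.commute mult_left_mono)
  qed (simp add: stable_exponent_def)
qed (use assms in auto)

text \<open>
  Writing \<open>1 / \<Psi>\<close> as \<open>\<xi>\<^sup>-\<^sup>\<alpha> (1 + i c) / (1 + c\<^sup>2)\<close> with \<open>c = \<beta> tan (\<pi> \<alpha> / 2)\<close>, the real part combines the
  two constants of the Fourier integral as \<open>1 / sin (\<pi> (\<alpha> - 1) / 2) \<mp> c / sin (\<pi> \<alpha> / 2)\<close>. Since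
  \<open>sin (\<pi> (\<alpha> - 1) / 2) = - cos (\<pi> \<alpha> / 2)\<close>, the tangent in \<open>c\<close> makes this a multiple of \<open>1 \<plusminus> \<beta>\<close>.
\<close>

lemma stable_potential_kernel:
  fixes x :: real
  assumes \<alpha>: "1 < \<alpha>" "\<alpha> < 2"
  shows "potential_kernel (stable_exponent \<alpha> \<beta>) 0 x =
    - 1 / (2 * Gamma \<alpha> * cos (pi * \<alpha> / 2) * (1 + (\<beta> * tan (pi * \<alpha> / 2))\<^sup>2))
      * \<bar>x\<bar> powr (\<alpha> - 1) * (1 + \<beta> * sgn x)"
proof -
  define c where "c = \<beta> * tan (pi * \<alpha> / 2)"
  have c2: "1 + c\<^sup>2 > 0" by (simp add: add_pos_nonneg)
  have inv: "1 / (of_real (\<xi> powr \<alpha>) * Complex 1 (- c)) = of_real (\<xi> powr (- \<alpha>)) * (Complex 1 c / of_real (1 + c\<^sup>2))"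
    if "\<xi> > 0" for \<xi>
  proof -
    have "Complex 1 (- c) * (Complex 1 c / of_real (1 + c\<^sup>2)) = 1"
      using c2 by (simp add: complex_eq_iff power2_eq_square field_simps)
    then have "1 / Complex 1 (- c) = Complex 1 c / of_real (1 + c\<^sup>2)"
      by (metis mult_eq_0_iff nonzero_mult_div_cancel_left zero_neq_one)
    moreover have "1 / (of_real (\<xi> powr \<alpha>) * Complex 1 (- c)) = of_real (\<xi> powr (- \<alpha>)) * (1 / Complex 1 (- c))"
      using that by (simp add: powr_minus divide_inverse)
    ultimately show ?thesis by (simp only:)
  qed
  have "(LBINT \<xi>:{0..}. Re ((1 - iexp (- (\<xi> * x))) / (of_real 0 + stable_exponent \<alpha> \<beta> \<xi>)))
     = (LINT \<xi>|lborel. Re ((Complex 1 c / of_real (1 + c\<^sup>2)) *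
         (indicat_real {0<..} \<xi> *\<^sub>R ((1 - iexp (- (\<xi> * x))) * of_real (\<xi> powr (- \<alpha>))))))"
    unfolding set_lebesgue_integral_def
  proof (rule Bochner_Integration.integral_cong[OF refl])
    fix \<xi> :: real
    consider "\<xi> < 0" | "\<xi> = 0" | "\<xi> > 0" by linarith
    then show "indicat_real {0..} \<xi> *\<^sub>R Re ((1 - iexp (- (\<xi> * x))) / (of_real 0 + stable_exponent \<alpha> \<beta> \<xi>))
      = Re ((Complex 1 c / of_real (1 + c\<^sup>2)) *
         (indicat_real {0<..} \<xi> *\<^sub>R ((1 - iexp (- (\<xi> * x))) * of_real (\<xi> powr (- \<alpha>)))))"
    proof cases
      case 3
      have "(1 - iexp (- (\<xi> * x))) / (of_real 0 + stable_exponent \<alpha> \<beta> \<xi>)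
        = (1 - iexp (- (\<xi> * x))) * (1 / (of_real (\<xi> powr \<alpha>) * Complex 1 (- c)))"
        by (simp add: stable_exponent_pos[OF 3] c_def)
      also have "\<dots> = (Complex 1 c / of_real (1 + c\<^sup>2)) * ((1 - iexp (- (\<xi> * x))) * of_real (\<xi> powr (- \<alpha>)))"
        unfolding inv[OF 3] by (simp only: mult_ac)
      finally show ?thesis using 3 by simp
    qed auto
  qed
  also have "\<dots> = Re (LINT \<xi>|lborel. (Complex 1 c / of_real (1 + c\<^sup>2)) *
         (indicat_real {0<..} \<xi> *\<^sub>R ((1 - iexp (- (\<xi> * x))) * of_real (\<xi> powr (- \<alpha>)))))"
    using set_integrable_fourier_kernel[OF \<alpha>, of x] unfolding set_integrable_def
    by (intro integral_Re integrable_mult_right)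
  also have "\<dots> = Re ((Complex 1 c / of_real (1 + c\<^sup>2)) * fourier_kernel \<alpha> x)"
    unfolding fourier_kernel_def set_lebesgue_integral_def by (simp only: integral_mult_right_zero)
  finally have *: "potential_kernel (stable_exponent \<alpha> \<beta>) 0 x
      = 1 / pi * Re ((Complex 1 c / of_real (1 + c\<^sup>2)) * fourier_kernel \<alpha> x)"
    unfolding potential_kernel_def by simp
  have half: "0 < pi * \<alpha> / 2" "pi * \<alpha> / 2 < pi" "pi / 2 < pi * \<alpha> / 2" using \<alpha> by auto
  have s: "sin (pi * \<alpha> / 2) > 0" using half by (intro sin_gt_zero) auto
  have co: "cos (pi * \<alpha> / 2) < 0"
    using half cos_monotone_0_pi[of "pi/2" "pi * \<alpha> / 2"] by simp
  have s1: "sin (pi * (\<alpha> - 1) / 2) = - cos (pi * \<alpha> / 2)"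
    using sin_diff[of "pi * \<alpha> / 2" "pi / 2"] by (simp add: field_simps)
  have G: "Gamma \<alpha> > 0" using \<alpha> by (intro Gamma_real_pos) auto
  have val: "1 / pi * Re ((Complex 1 c / of_real (1 + c\<^sup>2)) * (of_real y * (of_real (pi / (2 * Gamma \<alpha>)) *
      Complex (1 / sin (pi * (\<alpha> - 1) / 2)) (e / sin (pi * \<alpha> / 2)))))
     = - 1 / (2 * Gamma \<alpha> * cos (pi * \<alpha> / 2) * (1 + c\<^sup>2)) * y * (1 + \<beta> * e)" for y e
  proof -
    have "c * (e / sin (pi * \<alpha> / 2)) = \<beta> * e / cos (pi * \<alpha> / 2)"
      using s unfolding c_def tan_def by simp
    then have "1 / sin (pi * (\<alpha> - 1) / 2) - c * (e / sin (pi * \<alpha> / 2)) = - (1 + \<beta> * e) / cos (pi * \<alpha> / 2)"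
      unfolding s1 by (simp add: diff_divide_distrib)
    moreover have "Re ((Complex 1 c / of_real (1 + c\<^sup>2)) * (of_real y * (of_real (pi / (2 * Gamma \<alpha>)) *
      Complex (1 / sin (pi * (\<alpha> - 1) / 2)) (e / sin (pi * \<alpha> / 2)))))
      = y * (pi / (2 * Gamma \<alpha>)) / (1 + c\<^sup>2) *
        (1 / sin (pi * (\<alpha> - 1) / 2) - c * (e / sin (pi * \<alpha> / 2)))"
      by (simp add: field_simps)
    moreover have "1 / pi * (y * (pi / (2 * G)) / D * (- (1 + t) / k)) = - 1 / (2 * G * k * D) * y * (1 + t)"
      for G D k t :: real
      by (auto simp: divide_simps algebra_simps)
    ultimately show ?thesis by (simp only:)
  qed
  consider "x = 0" | "x > 0" | "x < 0" by linarith
  then show ?thesis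
  proof cases
    case 1
    then show ?thesis unfolding * by (simp add: fourier_kernel_0)
  next
    case 2
    then show ?thesis unfolding * fourier_kernel_pos[OF 2] fourier_kernel_1[OF \<alpha>]
      using val[of "x powr (\<alpha> - 1)" 1] by (simp add: c_def)
  next
    case 3
    have "fourier_kernel \<alpha> x = cnj (fourier_kernel \<alpha> (- x))"
      using fourier_kernel_uminus[of \<alpha> "- x"] by simp
    also have "\<dots> = of_real ((- x) powr (\<alpha> - 1)) * (of_real (pi / (2 * Gamma \<alpha>)) *
      Complex (1 / sin (pi * (\<alpha> - 1) / 2)) (- 1 / sin (pi * \<alpha> / 2)))"
      using 3 by (subst fourier_kernel_pos) (auto simp: fourier_kernel_1[OF \<alpha>] complex_eq_iff)
    finally show ?thesis unfolding *
      using val[of "(- x) powr (\<alpha> - 1)" "-1"] 3 by (simp add: c_def)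
  qed
qed

section \<open>Two-sided power potentials on an interval\<close>

lemma nn_integral_Beta:
  fixes a b u v :: real
  assumes "a < b" "u > 0" "v > 0"
  shows "(\<integral>\<^sup>+s. ennreal ((s - a) powr (u - 1) * (b - s) powr (v - 1)) * indicator {a..b} s \<partial>lborel)
    = ennreal (Beta u v * (b - a) powr (u + v - 1))"
proof -
  have "(\<integral>\<^sup>+s. ennreal ((s - a) powr (u - 1) * (b - s) powr (v - 1)) * indicator {a..b} s \<partial>lborel)
    = ennreal (b - a) * (\<integral>\<^sup>+t. ennreal ((a + (b - a) * t - a) powr (u - 1) * (b - (a + (b - a) * t)) powr (v - 1))
        * indicator {a..b} (a + (b - a) * t) \<partial>lborel)"
    using assms by (subst nn_integral_real_affine[where c="b - a" and t=a]) auto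
  also have "\<dots> = ennreal (b - a) * (\<integral>\<^sup>+t. ennreal ((b - a) powr (u + v - 2)) *
      (ennreal (t powr (u - 1) * (1 - t) powr (v - 1)) * indicator {0..1} t) \<partial>lborel)"
  proof (rule arg_cong[where f="\<lambda>I. ennreal (b - a) * I"], rule nn_integral_cong)
    fix t :: real
    have ind: "indicator {a..b} (a + (b - a) * t) = (indicator {0..1} t :: ennreal)"
    proof -
      have "a \<le> a + (b - a) * t \<longleftrightarrow> 0 \<le> t"
        using assms by (simp add: zero_le_mult_iff)
      moreover have "a + (b - a) * t \<le> b \<longleftrightarrow> t \<le> 1"
        using assms mult_le_cancel_left_pos[of "b - a" t 1] by (simp add: algebra_simps)
      ultimately show ?thesis by (auto simp: indicator_def)
    qed
    show "ennreal ((a + (b - a) * t - a) powr (u - 1) * (b - (a + (b - a) * t)) powr (v - 1))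
        * indicator {a..b} (a + (b - a) * t)
      = ennreal ((b - a) powr (u + v - 2)) * (ennreal (t powr (u - 1) * (1 - t) powr (v - 1)) * indicator {0..1} t)"
    proof (cases "t \<in> {0..1}")
      case True
      have "b - (a + (b - a) * t) = (b - a) * (1 - t)" by (simp add: algebra_simps)
      moreover have "(b - a) powr (u - 1) * (b - a) powr (v - 1) = (b - a) powr (u + v - 2)"
        by (simp add: powr_add[symmetric])
      ultimately have "(a + (b - a) * t - a) powr (u - 1) * (b - (a + (b - a) * t)) powr (v - 1)
        = (b - a) powr (u + v - 2) * (t powr (u - 1) * (1 - t) powr (v - 1))"
        using assms True by (simp add: powr_mult)
      then show ?thesis unfolding ind using True by (simp add: ennreal_mult')
    qed (simp add: ind)
  qed
  also have "\<dots> = ennreal (b - a) * (ennreal ((b - a) powr (u + v - 2)) * ennreal (Beta u v))"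
    using assms
    by (subst nn_integral_cmult) (auto simp: nn_integral_has_integral_lebesgue'[OF _ has_integral_Beta_real])
  also have "\<dots> = ennreal (Beta u v * (b - a) powr (u + v - 1))"
  proof -
    have "(b - a) * (b - a) powr (u + v - 2) = (b - a) powr (u + v - 1)"
      using assms powr_add[of "b - a" 1 "u + v - 2"] by simp
    moreover have "Beta u v > 0" using assms by (simp add: Beta_def Gamma_real_pos)
    ultimately show ?thesis using assms by (simp add: ennreal_mult'[symmetric] mult_ac)
  qed
  finally show ?thesis .
qed

text \<open>
  The exponents sum to \<open>- 2\<close>, so the integrand behaves like a differential on the projective line with
  singularities in \<open>a\<close>, \<open>s\<close> and \<open>b\<close> only. The Moebius map that sends \<open>s\<close>, \<open>b\<close>, \<open>a\<close> to \<open>0\<close>, \<open>1\<close>, \<open>\<infinity>\<close>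
  turns it into the standard Beta integral.
\<close>

lemma nn_integral_Beta_projective:
  fixes a b s p q :: real
  assumes s: "a < s" "s < b" and pq: "p > 0" "q > 0"
  shows "(\<integral>\<^sup>+y. ennreal ((y - s) powr (p - 1) * (b - y) powr (q - 1) * (y - a) powr (- p - q)) * indicator {s..b} y \<partial>lborel)
    = ennreal (Beta p q * ((b - a) powr (- p) * (s - a) powr (- q) * (b - s) powr (p + q - 1)))"
proof -
  define f where "f t = t powr (p - 1) * (1 - t) powr (q - 1)" for t :: real
  define g where "g y = (y - s) * (b - a) / ((y - a) * (b - s))" for y
  define g' where "g' y = (b - a) * (s - a) / ((b - s) * (y - a)\<^sup>2)" for y
  define K where "K = (b - a) powr p * (s - a) powr q * (b - s) powr (1 - p - q)"
  have K: "K > 0" using s by (simp add: K_def)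
  have g_ends: "g s = 0" "g b = 1" using s by (auto simp: g_def)
  have "ennreal (Beta p q) = (\<integral>\<^sup>+t. ennreal (f t) * indicator {g s..g b} t \<partial>lborel)"
    unfolding g_ends f_def using pq
    by (intro nn_integral_has_integral_lebesgue'[symmetric] has_integral_Beta_real) auto
  also have "\<dots> = (\<integral>\<^sup>+y. ennreal (f (g y) * g' y) * indicator {s..b} y \<partial>lborel)"
    unfolding nn_integral_set_ennreal
  proof (rule nn_integral_substitution)
    show "set_borel_measurable borel {g s..g b} f"
      unfolding set_borel_measurable_def f_def by measurable
    show "(g has_real_derivative g' y) (at y)" if "y \<in> {s..b}" for y
    proof -
      have nz: "y - a \<noteq> 0" "b - s \<noteq> 0" using that s by auto
      have "(g has_real_derivative ((b - a) * ((y - a) * (b - s)) - (y - s) * (b - a) * (b - s))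
          / ((y - a) * (b - s) * ((y - a) * (b - s)))) (at y)"
        unfolding g_def using nz by (auto intro!: derivative_eq_intros)
      moreover have "((b - a) * ((y - a) * (b - s)) - (y - s) * (b - a) * (b - s)) = (b - s) * ((b - a) * (s - a))"
        by (simp add: algebra_simps)
      ultimately show ?thesis using nz by (simp add: g'_def power2_eq_square mult_ac)
    qed
    show "continuous_on {s..b} g'"
      unfolding g'_def using s by (intro continuous_intros) auto
    show "g' y \<ge> 0" if "y \<in> {s..b}" for y
      using s that unfolding g'_def by simp
  qed (use s in auto)
  also have "\<dots> = (\<integral>\<^sup>+y. ennreal K *
     (ennreal ((y - s) powr (p - 1) * (b - y) powr (q - 1) * (y - a) powr (- p - q)) * indicator {s..b} y) \<partial>lborel)"
  proof (rule nn_integral_cong)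
    fix y
    \<comment> \<open>This includes the end points, where both sides vanish because \<open>0 powr z = 0\<close>.\<close>
    show "ennreal (f (g y) * g' y) * indicator {s..b} y = ennreal K *
     (ennreal ((y - s) powr (p - 1) * (b - y) powr (q - 1) * (y - a) powr (- p - q)) * indicator {s..b} y)"
    proof (cases "y \<in> {s..b}")
      case True
      define Y where "Y = y - a"
      define S where "S = s - a"
      define T where "T = b - s"
      define D where "D = b - a"
      have pos: "Y > 0" "S > 0" "T > 0" "D > 0" using True s by (auto simp: Y_def S_def T_def D_def)
      have one_minus: "1 - g y = (b - y) * S / (Y * T)"
      proof -
        have "Y * T - (y - s) * D = (b - y) * S"
          by (simp add: Y_def T_def D_def S_def algebra_simps)
        then show ?thesis using pos unfolding g_def Y_def[symmetric] T_def[symmetric] D_def[symmetric]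
          by (simp add: field_simps)
      qed
      have gy: "g y = (y - s) * D / (Y * T)" by (simp add: g_def Y_def T_def D_def)
      have g'y: "g' y = D * S / (T * Y\<^sup>2)" by (simp add: g'_def Y_def T_def D_def S_def)
      have "f (g y) * g' y = ((y - s) powr (p - 1) * D powr (p - 1) / (Y powr (p - 1) * T powr (p - 1)))
          * ((b - y) powr (q - 1) * S powr (q - 1) / (Y powr (q - 1) * T powr (q - 1))) * (D * S / (T * Y\<^sup>2))"
        unfolding f_def one_minus unfolding gy g'y using True pos
        by (simp add: powr_mult powr_divide)
      also have "\<dots> = (y - s) powr (p - 1) * (b - y) powr (q - 1) *
          (D powr (p - 1) * D) * (S powr (q - 1) * S) / (T powr (p - 1) * T powr (q - 1) * T)
          / (Y powr (p - 1) * Y powr (q - 1) * Y\<^sup>2)"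
        by (simp add: field_simps)
      also have "D powr (p - 1) * D = D powr p" using pos by (simp add: powr_diff)
      also have "S powr (q - 1) * S = S powr q" using pos by (simp add: powr_diff)
      also have "T powr (p - 1) * T powr (q - 1) * T = T powr (p + q - 1)"
        using pos by (simp add: powr_diff powr_add)
      also have "Y powr (p - 1) * Y powr (q - 1) * Y\<^sup>2 = Y powr (p + q)"
        using pos by (simp add: powr_diff powr_add power2_eq_square)
      also have "(y - s) powr (p - 1) * (b - y) powr (q - 1) * D powr p * S powr q / T powr (p + q - 1) / Y powr (p + q)
          = K * ((y - s) powr (p - 1) * (b - y) powr (q - 1) * Y powr (- p - q))"
      proof -
        have "T powr (1 - p - q) = 1 / T powr (p + q - 1)" "Y powr (- p - q) = 1 / Y powr (p + q)"
          using powr_minus_divide[of T "p + q - 1"] powr_minus_divide[of Y "p + q"] by (simp_all add: algebra_simps)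
        then show ?thesis by (simp add: K_def D_def[symmetric] S_def[symmetric] T_def[symmetric])
      qed
      finally show ?thesis using True K by (simp add: Y_def ennreal_mult')
    qed simp
  qed
  also have "\<dots> = ennreal K * (\<integral>\<^sup>+y. ennreal ((y - s) powr (p - 1) * (b - y) powr (q - 1) * (y - a) powr (- p - q)) * indicator {s..b} y \<partial>lborel)"
    (is "_ = _ * ?I")
    by (rule nn_integral_cmult) measurable
  finally have eq: "ennreal (Beta p q) = ennreal K * ?I" .
  have "?I = ennreal (1 / K) * (ennreal K * ?I)"
    using K by (simp add: mult.assoc[symmetric] ennreal_mult'[symmetric])
  also have "\<dots> = ennreal (1 / K * Beta p q)"
    unfolding eq[symmetric] using K by (subst ennreal_mult') auto
  also have "1 / K * Beta p q = Beta p q * ((b - a) powr (- p) * (s - a) powr (- q) * (b - s) powr (p + q - 1))"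
  proof -
    have "(b - s) powr (1 - p - q) = 1 / (b - s) powr (p + q - 1)"
      using powr_minus_divide[of "b - s" "p + q - 1"] by (simp add: algebra_simps)
    then show ?thesis unfolding K_def by (simp add: powr_minus_divide)
  qed
  finally show ?thesis .
qed

lemma nn_integral_powr_le:
  fixes x y e :: real
  assumes "x \<le> y" "e > -1"
  shows "(\<integral>\<^sup>+s. ennreal ((y - s) powr e) * indicator {x..y} s \<partial>lborel) = ennreal ((y - x) powr (e + 1) / (e + 1))"
proof -
  have "(\<integral>\<^sup>+s. ennreal ((y - s) powr e) * indicator {x..y} s \<partial>lborel)
    = ennreal \<bar>-1\<bar> * (\<integral>\<^sup>+r. ennreal ((y - (y + (-1) * r)) powr e) * indicator {x..y} (y + (-1) * r) \<partial>lborel)"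
    by (intro nn_integral_real_affine) auto
  also have "\<dots> = (\<integral>\<^sup>+r. ennreal (r powr e) * indicator {0..y - x} r \<partial>lborel)"
    by (auto intro!: nn_integral_cong simp: indicator_def)
  also have "\<dots> = ennreal ((y - x) powr (e + 1) / (e + 1))"
    using assms by (intro nn_integral_has_integral_lebesgue' has_integral_powr_from_0) auto
  finally show ?thesis .
qed

text \<open>
  Instead of differentiating the potential, write \<open>(y - x)\<^sup>e = e \<integral> (y - s)\<^sup>e\<^sup>-\<^sup>1 ds\<close> over \<open>x \<le> s \<le> y\<close> and
  exchange the integrals by Tonelli. The inner integral is the projective one with \<open>p = e\<close> and \<open>q = 1 - u\<close>,
  because \<open>p + q = v\<close> when \<open>e = u + v - 1\<close>.
\<close>

lemma one_sided_potential_right: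
  fixes a b x u v :: real
  assumes x: "a \<le> x" "x \<le> b" and u: "u < 1" and uv: "u + v > 1"
  shows "(\<integral>\<^sup>+y. ennreal ((y - x) powr (u + v - 1) * ((b - y) powr (- u) * (y - a) powr (- v))) * indicator {x..b} y \<partial>lborel)
    = ennreal ((u + v - 1) * Beta (u + v - 1) (1 - u) * (b - a) powr (1 - u - v)) *
      (\<integral>\<^sup>+s. ennreal ((s - a) powr (u - 1) * (b - s) powr (v - 1)) * indicator {x..b} s \<partial>lborel)"
proof -
  define e where "e = u + v - 1"
  have e: "e > 0" using uv by (simp add: e_def)
  have B: "Beta e (1 - u) > 0" using e u by (simp add: Beta_def Gamma_real_pos)
  let ?w = "\<lambda>y. (b - y) powr (- u) * (y - a) powr (- v)"
  let ?F = "\<lambda>s y. ennreal e * (ennreal ((y - s) powr (e - 1) * ?w y) * (indicator {x..b} s * indicator {s..b} y))"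
  have "(\<integral>\<^sup>+y. ennreal ((y - x) powr e * ?w y) * indicator {x..b} y \<partial>lborel)
    = (\<integral>\<^sup>+y. \<integral>\<^sup>+s. ?F s y \<partial>lborel \<partial>lborel)"
  proof (rule nn_integral_cong)
    fix y
    have "(\<integral>\<^sup>+s. ?F s y \<partial>lborel)
       = (\<integral>\<^sup>+s. (ennreal (e * ?w y) * indicator {x..b} y) * (ennreal ((y - s) powr (e - 1)) * indicator {x..y} s) \<partial>lborel)"
    proof (rule nn_integral_cong)
      fix s
      show "?F s y
        = (ennreal (e * ?w y) * indicator {x..b} y) * (ennreal ((y - s) powr (e - 1)) * indicator {x..y} s)"
        using e by (auto simp: indicator_def ennreal_mult' ennreal_mult'' mult_ac)
    qed
    also have "\<dots> = (ennreal (e * ?w y) * indicator {x..b} y) *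
        (\<integral>\<^sup>+s. (ennreal ((y - s) powr (e - 1)) * indicator {x..y} s) \<partial>lborel)"
      by (rule nn_integral_cmult) measurable
    also have "\<dots> = ennreal ((y - x) powr e * ?w y) * indicator {x..b} y"
    proof (cases "y \<in> {x..b}")
      case True
      have "(\<integral>\<^sup>+s. (ennreal ((y - s) powr (e - 1)) * indicator {x..y} s) \<partial>lborel) = ennreal ((y - x) powr e / e)"
        using True e nn_integral_powr_le[of x y "e - 1"] by simp
      then show ?thesis using True e by (simp add: ennreal_mult'[symmetric])
    qed simp
    finally show "ennreal ((y - x) powr e * ?w y) * indicator {x..b} y =
      (\<integral>\<^sup>+s. ?F s y \<partial>lborel)" ..
  qed
  also have "\<dots> = (\<integral>\<^sup>+s. \<integral>\<^sup>+y. ?F s y \<partial>lborel \<partial>lborel)"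
    by (rule lborel_pair.Fubini')
       (auto simp: case_prod_unfold indicator_def cong: measurable_cong_sets)
  also have "\<dots> = (\<integral>\<^sup>+s. ennreal (e * Beta e (1 - u) * (b - a) powr (- e)) *
      (ennreal ((s - a) powr (u - 1) * (b - s) powr (v - 1)) * indicator {x..b} s) \<partial>lborel)"
  proof (rule nn_integral_cong_AE)
    have "AE s in lborel. s \<noteq> a \<and> s \<noteq> b"
      using AE_lborel_singleton[of a] AE_lborel_singleton[of b] by eventually_elim auto
    \<comment> \<open>For \<open>s = a\<close> or \<open>s = b\<close> the projective integral may diverge; this is a null set of \<open>s\<close>.\<close>
    then show "AE s in lborel. (\<integral>\<^sup>+y. ?F s y \<partial>lborel)
      = ennreal (e * Beta e (1 - u) * (b - a) powr (- e)) *
      (ennreal ((s - a) powr (u - 1) * (b - s) powr (v - 1)) * indicator {x..b} s)"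
    proof eventually_elim
      case (elim s)
      show ?case
      proof (cases "s \<in> {x..b}")
        case True
        then have s: "a < s" "s < b" using elim x by auto
        have "(\<integral>\<^sup>+y. ?F s y \<partial>lborel)
          = ennreal e * (\<integral>\<^sup>+y. ennreal ((y - s) powr (e - 1) * (b - y) powr (1 - u - 1) * (y - a) powr (- e - (1 - u))) * indicator {s..b} y \<partial>lborel)"
          using True by (subst nn_integral_cmult) (auto simp: e_def mult.assoc)
        also have "\<dots> = ennreal e * ennreal (Beta e (1 - u) * ((b - a) powr (- e) * (s - a) powr (- (1 - u)) * (b - s) powr (e + (1 - u) - 1)))"
          using e u s by (subst nn_integral_Beta_projective) auto
        also have "\<dots> = ennreal (e * Beta e (1 - u) * (b - a) powr (- e)) *
            (ennreal ((s - a) powr (u - 1) * (b - s) powr (v - 1)) * indicator {x..b} s)"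
          using True e B by (simp add: ennreal_mult'[symmetric] e_def mult_ac)
        finally show ?thesis .
      qed simp
    qed
  qed
  also have "\<dots> = ennreal (e * Beta e (1 - u) * (b - a) powr (- e)) *
      (\<integral>\<^sup>+s. ennreal ((s - a) powr (u - 1) * (b - s) powr (v - 1)) * indicator {x..b} s \<partial>lborel)"
    by (rule nn_integral_cmult) measurable
  finally show ?thesis by (simp add: e_def algebra_simps)
qed

text \<open>
  The reflection \<open>y \<mapsto> - y\<close> exchanges the end points and the exponents, but yields the same integrand over the
  complementary interval.
\<close>

lemma one_sided_potential_left:
  fixes a b x u v :: real
  assumes x: "a \<le> x" "x \<le> b" and v: "v < 1" and uv: "u + v > 1"
  shows "(\<integral>\<^sup>+y. ennreal ((x - y) powr (u + v - 1) * ((b - y) powr (- u) * (y - a) powr (- v))) * indicator {a..x} y \<partial>lborel)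
    = ennreal ((u + v - 1) * Beta (u + v - 1) (1 - v) * (b - a) powr (1 - u - v)) *
      (\<integral>\<^sup>+s. ennreal ((s - a) powr (u - 1) * (b - s) powr (v - 1)) * indicator {a..x} s \<partial>lborel)"
proof -
  have refl: "(\<integral>\<^sup>+y. f y \<partial>lborel) = (\<integral>\<^sup>+y. f (- y) \<partial>lborel)" if "f \<in> borel_measurable borel" for f :: "real \<Rightarrow> ennreal"
    using nn_integral_real_affine[OF that, of "-1" 0] by simp
  have ind: "indicator {- x..- a} (- y) = (indicator {a..x} y :: ennreal)" for y
    by (auto simp: indicator_def)
  have "(\<integral>\<^sup>+y. ennreal ((x - y) powr (u + v - 1) * ((b - y) powr (- u) * (y - a) powr (- v))) * indicator {a..x} y \<partial>lborel)
    = (\<integral>\<^sup>+y. ennreal ((y - (- x)) powr (v + u - 1) * ((- a - y) powr (- v) * (y - (- b)) powr (- u))) * indicator {- x..- a} y \<partial>lborel)"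
    by (subst (2) refl) (auto simp: ind algebra_simps)
  also have "\<dots> = ennreal ((v + u - 1) * Beta (v + u - 1) (1 - v) * (- a - (- b)) powr (1 - v - u)) *
      (\<integral>\<^sup>+s. ennreal ((s - (- b)) powr (v - 1) * (- a - s) powr (u - 1)) * indicator {- x..- a} s \<partial>lborel)"
    using x v uv by (intro one_sided_potential_right) auto
  also have "(\<integral>\<^sup>+s. ennreal ((s - (- b)) powr (v - 1) * (- a - s) powr (u - 1)) * indicator {- x..- a} s \<partial>lborel)
    = (\<integral>\<^sup>+s. ennreal ((s - a) powr (u - 1) * (b - s) powr (v - 1)) * indicator {a..x} s \<partial>lborel)"
    by (subst refl) (auto simp: ind algebra_simps)
  finally show ?thesis by (simp add: algebra_simps)
qed

text \<open>
  Both one-sided potentials are integrals of \<open>(s - a)\<^sup>u\<^sup>-\<^sup>1 (b - s)\<^sup>v\<^sup>-\<^sup>1\<close>, over \<open>[x, b]\<close> and over \<open>[a, x]\<close>. The balance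
  condition says that they carry the same factor, so that their sum is an integral over all of \<open>[a, b]\<close>
  and \<open>x\<close> disappears.
\<close>

lemma riesz_potential_constant:
  fixes a b x u v \<beta> :: real
  assumes ab: "a < b" and x: "x \<in> {a..b}" and u: "0 < u" "u < 1" and v: "0 < v" "v < 1" and uv: "u + v > 1"
    and \<beta>: "-1 \<le> \<beta>" "\<beta> \<le> 1"
    and balance: "(1 + \<beta>) * Beta (u + v - 1) (1 - u) = (1 - \<beta>) * Beta (u + v - 1) (1 - v)"
  shows "(\<integral>\<^sup>+y. ennreal (\<bar>y - x\<bar> powr (u + v - 1) * (1 + \<beta> * sgn (y - x)) * ((b - y) powr (- u) * (y - a) powr (- v)))
      * indicator {a<..<b} y \<partial>lborel)
    = ennreal ((1 + \<beta>) * (Gamma u * Gamma (1 - u)))"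
proof -
  define e where "e = u + v - 1"
  have e: "e > 0" using uv by (simp add: e_def)
  let ?w = "\<lambda>y. (b - y) powr (- u) * (y - a) powr (- v)"
  let ?g = "\<lambda>s. ennreal ((s - a) powr (u - 1) * (b - s) powr (v - 1))"
  \<comment> \<open>The common factor of the two one-sided potentials; \<open>c'\<close> below is where the balance condition enters.\<close>
  define c where "c = (1 + \<beta>) * (e * Beta e (1 - u) * (b - a) powr (- e))"
  have pos: "Beta e (1 - u) > 0" "Beta e (1 - v) > 0" "Beta u v > 0"
    using e u v by (simp_all add: Beta_def Gamma_real_pos)
  have c': "c = (1 - \<beta>) * (e * Beta e (1 - v) * (b - a) powr (- e))"
    using balance unfolding c_def e_def[symmetric] by (metis mult.assoc mult.left_commute)
  have m: "1 - u - v = - e" by (simp add: e_def)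
  have c: "c \<ge> 0" using \<beta> e pos unfolding c_def by simp
  have "(\<integral>\<^sup>+y. ennreal (\<bar>y - x\<bar> powr e * (1 + \<beta> * sgn (y - x)) * ?w y) * indicator {a<..<b} y \<partial>lborel)
    = (\<integral>\<^sup>+y. ennreal (1 + \<beta>) * (ennreal ((y - x) powr e * ?w y) * indicator {x..b} y)
         + ennreal (1 - \<beta>) * (ennreal ((x - y) powr e * ?w y) * indicator {a..x} y) \<partial>lborel)"
  proof (rule nn_integral_cong_AE)
    have "AE y in lborel. y \<noteq> a \<and> y \<noteq> b \<and> y \<noteq> x"
      using AE_lborel_singleton[of a] AE_lborel_singleton[of b] AE_lborel_singleton[of x] by eventually_elim auto
    then show "AE y in lborel. ennreal (\<bar>y - x\<bar> powr e * (1 + \<beta> * sgn (y - x)) * ?w y) * indicator {a<..<b} y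
      = ennreal (1 + \<beta>) * (ennreal ((y - x) powr e * ?w y) * indicator {x..b} y)
         + ennreal (1 - \<beta>) * (ennreal ((x - y) powr e * ?w y) * indicator {a..x} y)"
    proof eventually_elim
      case (elim y)
      consider "y \<notin> {a<..<b}" | "y \<in> {a<..<b}" "y < x" | "y \<in> {a<..<b}" "y > x" using elim by fastforce
      then show ?case
      proof cases
        case 1
        then have "y \<notin> {x..b}" "y \<notin> {a..x}" using elim x by auto
        then show ?thesis using 1 by simp
      next
        case 2
        then have "ennreal (\<bar>y - x\<bar> powr e * (1 + \<beta> * sgn (y - x)) * ?w y) = ennreal (1 - \<beta>) * ennreal ((x - y) powr e * ?w y)"
          using \<beta> by (subst ennreal_mult'[symmetric]) (auto simp: mult_ac)
        with 2 show ?thesis by simp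
      next
        case 3
        then have "ennreal (\<bar>y - x\<bar> powr e * (1 + \<beta> * sgn (y - x)) * ?w y) = ennreal (1 + \<beta>) * ennreal ((y - x) powr e * ?w y)"
          using \<beta> by (subst ennreal_mult'[symmetric]) (auto simp: mult_ac)
        with 3 show ?thesis by simp
      qed
    qed
  qed
  also have "\<dots> = ennreal (1 + \<beta>) * (\<integral>\<^sup>+y. ennreal ((y - x) powr e * ?w y) * indicator {x..b} y \<partial>lborel)
         + ennreal (1 - \<beta>) * (\<integral>\<^sup>+y. ennreal ((x - y) powr e * ?w y) * indicator {a..x} y \<partial>lborel)"
    by (subst nn_integral_add) (auto simp: nn_integral_cmult)
  also have "\<dots> = ennreal c * (\<integral>\<^sup>+s. ?g s * indicator {x..b} s \<partial>lborel) + ennreal c * (\<integral>\<^sup>+s. ?g s * indicator {a..x} s \<partial>lborel)"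
  proof (intro arg_cong2[where f="(+)"])
    show "ennreal (1 + \<beta>) * (\<integral>\<^sup>+y. ennreal ((y - x) powr e * ?w y) * indicator {x..b} y \<partial>lborel)
      = ennreal c * (\<integral>\<^sup>+s. ?g s * indicator {x..b} s \<partial>lborel)"
      using one_sided_potential_right[of a x b u v, unfolded m e_def[symmetric]] x u uv \<beta>
      by (simp add: c_def mult.assoc ennreal_mult')
    show "ennreal (1 - \<beta>) * (\<integral>\<^sup>+y. ennreal ((x - y) powr e * ?w y) * indicator {a..x} y \<partial>lborel)
      = ennreal c * (\<integral>\<^sup>+s. ?g s * indicator {a..x} s \<partial>lborel)"
      using one_sided_potential_left[of a x b v u, unfolded m e_def[symmetric]] x v uv \<beta>
      by (simp add: c' mult.assoc ennreal_mult')
  qed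
  also have "\<dots> = ennreal c * (\<integral>\<^sup>+s. ?g s * indicator {x..b} s + ?g s * indicator {a..x} s \<partial>lborel)"
    by (subst nn_integral_add) (auto simp: distrib_left)
  also have "(\<integral>\<^sup>+s. ?g s * indicator {x..b} s + ?g s * indicator {a..x} s \<partial>lborel)
     = (\<integral>\<^sup>+s. ?g s * indicator {a..b} s \<partial>lborel)"
  proof (rule nn_integral_cong_AE)
    show "AE s in lborel. ?g s * indicator {x..b} s + ?g s * indicator {a..x} s = ?g s * indicator {a..b} s"
      using AE_lborel_singleton[of x] by eventually_elim (use x in \<open>auto simp: indicator_def\<close>)
  qed
  also have "\<dots> = ennreal (Beta u v * (b - a) powr (u + v - 1))"
    by (rule nn_integral_Beta) fact+
  also have "ennreal c * \<dots> = ennreal (c * (Beta u v * (b - a) powr e))"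
    using c by (simp add: ennreal_mult' e_def)
  also have "c * (Beta u v * (b - a) powr e) = (1 + \<beta>) * (e * Beta e (1 - u) * Beta u v)"
    using ab by (simp add: c_def powr_minus)
  also have "e * Beta e (1 - u) * Beta u v = Gamma u * Gamma (1 - u)"
  proof -
    have G: "Gamma (e + 1) = e * Gamma e" using e by (intro Gamma_plus1) (auto elim: nonpos_Ints_cases)
    have eq: "e + (1 - u) = v" "u + v = e + 1" by (simp_all add: e_def)
    have B: "Beta e (1 - u) = Gamma e * Gamma (1 - u) / Gamma v" "Beta u v = Gamma u * Gamma v / (e * Gamma e)"
      unfolding Beta_def eq G by simp_all
    have "Gamma e \<noteq> 0" "Gamma v \<noteq> 0" using Gamma_real_pos[OF e] Gamma_real_pos[OF v(1)] by linarith+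
    then show ?thesis unfolding B using e by simp
  qed
  finally show ?thesis by (simp add: e_def)
qed

section \<open>The positivity parameter\<close>

lemma abs_sinc_le_1: "\<bar>sinc x\<bar> \<le> 1"
  using abs_sin_x_le_abs_x[of x] by (auto simp: divide_simps)

lemma LBINT_cos_eq_sinc: "(LBINT s:{0..1}. cos (s * y)) = sinc y"
proof (cases "y = 0")
  case True
  then show ?thesis by (simp add: set_lebesgue_integral_def)
next
  case False
  have int: "set_integrable lborel {0..1} (\<lambda>s. cos (s * y))"
    by (intro borel_integrable_atLeastAtMost' continuous_intros)
  have "((\<lambda>s. cos (s * y)) has_integral (sin (1 * y) / y - sin (0 * y) / y)) {0..1}"
    using False
    by (intro fundamental_theorem_of_calculus)
       (auto intro!: derivative_eq_intros simp: has_real_derivative_iff_has_vector_derivative[symmetric])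
  then show ?thesis
    using set_borel_integral_eq_integral(2)[OF int] False by (simp add: integral_unique)
qed

text \<open>
  The real part of the mean of the characteristic function over \<open>[0, n]\<close> is \<open>E (sin (n Y) / (n Y))\<close>, which converges to the
  mass of the atom in \<open>0\<close>.
\<close>

lemma measure_singleton_0_eq_0:
  assumes "real_distribution N" and lim: "(char N \<longlongrightarrow> 0) at_top"
  shows "measure N {0} = 0"
proof -
  interpret N: real_distribution N by fact
  have eq: "(LINT y|N. sinc (real n * y)) = (LINT s|lborel. indicat_real {0..1} s *\<^sub>R Re (char N (s * real n)))" for n
  proof -
    have "(LINT y|N. sinc (real n * y)) = (LINT y|N. LINT s|lborel. indicat_real {0..1} s *\<^sub>R cos (s * (real n * y)))"
      unfolding LBINT_cos_eq_sinc[symmetric] set_lebesgue_integral_def ..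
    also have "\<dots> = (LINT s|lborel. LINT y|N. indicat_real {0..1} s *\<^sub>R cos (s * (real n * y)))"
    proof (rule Fubini_prob_lborel(2))
      show "integrable lborel (indicat_real {0..1::real})"
        by (intro integrable_real_indicator) auto
      show "AE y in N. \<forall>s. norm (indicat_real {0..1} s *\<^sub>R cos (s * (real n * y))) \<le> indicat_real {0..1} s"
        by (intro AE_I2 allI) (auto simp: indicator_def)
    qed (use assms in \<open>auto\<close>)
    also have "\<dots> = (LINT s|lborel. indicat_real {0..1} s *\<^sub>R Re (char N (s * real n)))"
    proof (rule Bochner_Integration.integral_cong[OF refl])
      fix s
      have "Re (char N (s * real n)) = (LINT y|N. Re (iexp (s * real n * y)))"
        unfolding char_def by (intro integral_Re[symmetric] N.integrable_iexp) auto
      then show "(LINT y|N. indicat_real {0..1} s *\<^sub>R cos (s * (real n * y))) = indicat_real {0..1} s *\<^sub>R Re (char N (s * real n))"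
        by (simp add: Re_exp mult.assoc)
    qed
    finally show ?thesis .
  qed
  have "(\<lambda>n. LINT s|lborel. indicat_real {0..1} s *\<^sub>R Re (char N (s * real n))) \<longlonglongrightarrow> (LINT (s::real)|lborel. 0)"
  proof (rule integral_dominated_convergence[where w="indicat_real {0..1}"])
    show "AE s in lborel. (\<lambda>n. indicat_real {0..1} s *\<^sub>R Re (char N (s * real n))) \<longlonglongrightarrow> 0"
      using AE_lborel_singleton[of "0::real"]
    proof eventually_elim
      case (elim s)
      show ?case
      proof (cases "s > 0")
        case True
        have "filterlim (\<lambda>n. s * real n) at_top sequentially"
          using True by (intro filterlim_tendsto_pos_mult_at_top[OF tendsto_const] filterlim_real_sequentially)
        then have "(\<lambda>n. char N (s * real n)) \<longlonglongrightarrow> 0"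
          by (rule filterlim_compose[OF lim])
        then have "(\<lambda>n. indicat_real {0..1} s *\<^sub>R Re (char N (s * real n))) \<longlonglongrightarrow> indicat_real {0..1} s *\<^sub>R Re 0"
          by (intro tendsto_intros)
        then show ?thesis by simp
      qed (use elim in auto)
    qed
    show "AE s in lborel. norm (indicat_real {0..1} s *\<^sub>R Re (char N (s * real n))) \<le> indicat_real {0..1} s" for n
      using order_trans[OF abs_Re_le_cmod N.cmod_char_le_1] by (intro AE_I2) (auto simp: indicator_def)
  qed auto
  then have "(\<lambda>n. LINT y|N. sinc (real n * y)) \<longlonglongrightarrow> 0" unfolding eq by simp
  moreover have "(\<lambda>n. LINT y|N. sinc (real n * y)) \<longlonglongrightarrow> (LINT y|N. indicat_real {0} y)"
  proof (rule integral_dominated_convergence[where w="\<lambda>_. 1"])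
    show "AE y in N. (\<lambda>n. sinc (real n * y)) \<longlonglongrightarrow> indicat_real {0} y"
    proof (rule AE_I2)
      fix y :: real
      show "(\<lambda>n. sinc (real n * y)) \<longlonglongrightarrow> indicat_real {0} y"
      proof (cases "y = 0")
        case False
        have "(\<lambda>n. sinc (real n * y)) \<longlonglongrightarrow> 0"
        proof (rule Lim_null_comparison)
          show "\<forall>\<^sub>F n in sequentially. norm (sinc (real n * y)) \<le> 1 / \<bar>y\<bar> * (1 / real n)"
            using eventually_gt_at_top[of 0]
          proof eventually_elim
            case (elim n)
            then show ?case using False abs_sin_le_one[of "real n * y"]
              by (simp add: abs_mult divide_simps)
          qed
          show "(\<lambda>n. 1 / \<bar>y\<bar> * (1 / real n)) \<longlonglongrightarrow> 0"
            by (intro tendsto_mult_right_zero lim_1_over_n)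
        qed
        then show ?thesis using False by simp
      qed simp
    qed
    show "AE y in N. norm (sinc (real n * y)) \<le> 1" for n
      by (rule AE_I2) (simp only: real_norm_def abs_sinc_le_1)
  qed auto
  ultimately have "(LINT y|N. indicat_real {0} y) = 0" by (rule LIMSEQ_unique[symmetric])
  then show ?thesis by simp
qed

lemma LBINT_sin_div:
  assumes "0 < \<epsilon>" "\<epsilon> \<le> T"
  shows "(LBINT \<xi>:{\<epsilon>..T}. sin (\<xi> * y) / \<xi>) = sgn y * (Si (T * \<bar>y\<bar>) - Si (\<epsilon> * \<bar>y\<bar>))"
proof -
  have int: "set_integrable lborel {\<epsilon>..T} (\<lambda>\<xi>. sin (\<xi> * y) / \<xi>)"
    using assms by (intro borel_integrable_atLeastAtMost' continuous_intros) auto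
  have "((\<lambda>\<xi>. sin (\<xi> * y) / \<xi>) has_integral (sgn y * Si (T * \<bar>y\<bar>) - sgn y * Si (\<epsilon> * \<bar>y\<bar>))) {\<epsilon>..T}"
  proof (rule fundamental_theorem_of_calculus[OF assms(2)])
    fix \<xi> assume "\<xi> \<in> {\<epsilon>..T}"
    then have x: "\<xi> > 0" using assms by auto
    have d: "((\<lambda>\<xi>. sgn y * Si (\<xi> * \<bar>y\<bar>)) has_real_derivative sgn y * (sinc (\<xi> * \<bar>y\<bar>) * \<bar>y\<bar>)) (at \<xi>)"
      by (intro DERIV_cmult DERIV_chain2[OF DERIV_Si]) (auto intro!: derivative_eq_intros)
    have e: "sgn y * (sinc (\<xi> * \<bar>y\<bar>) * \<bar>y\<bar>) = sin (\<xi> * y) / \<xi>"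
      using x by (cases y "0 :: real" rule: linorder_cases) auto
    show "((\<lambda>\<xi>. sgn y * Si (\<xi> * \<bar>y\<bar>)) has_vector_derivative sin (\<xi> * y) / \<xi>) (at \<xi> within {\<epsilon>..T})"
      using has_field_derivative_at_within[OF d] unfolding e
      by (rule has_real_derivative_iff_has_vector_derivative[THEN iffD1])
  qed
  then show ?thesis
    using set_borel_integral_eq_integral(2)[OF int] by (simp add: integral_unique right_diff_distrib)
qed

text \<open>
  The integrals are truncated at both ends: on \<open>[1/n, n]\<close> the integrand \<open>sin (\<xi> y) / \<xi>\<close> is bounded
  uniformly in \<open>y\<close>, so that Fubini needs no moment of \<open>N\<close>, and the inner integrals are differences of
  values of the bounded function \<open>Si\<close>, which tend to \<open>sgn y \<pi> / 2\<close>.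
\<close>

lemma Gil_Pelaez:
  assumes "real_distribution N"
  shows "(\<lambda>n. LBINT \<xi>:{1 / real (Suc n)..real (Suc n)}. Im (char N \<xi>) / \<xi>)
    \<longlonglongrightarrow> pi / 2 * (measure N {0<..} - measure N {..<0})"
proof -
  interpret N: real_distribution N by fact
  let ?\<epsilon> = "\<lambda>n. 1 / real (Suc n)" and ?T = "\<lambda>n. real (Suc n)"
  let ?S = "\<lambda>n y. sgn y * (Si (?T n * \<bar>y\<bar>) - Si (?\<epsilon> n * \<bar>y\<bar>))"
  have le: "?\<epsilon> n \<le> ?T n" for n by (simp add: divide_le_eq mult_ge1_I)
  have eq: "(LINT y|N. ?S n y)
     = (LBINT \<xi>:{?\<epsilon> n..?T n}. Im (char N \<xi>) / \<xi>)" for n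
  proof -
    have "(LINT y|N. ?S n y)
      = (LINT y|N. LINT \<xi>|lborel. indicat_real {?\<epsilon> n..?T n} \<xi> *\<^sub>R (sin (\<xi> * y) / \<xi>))"
      using LBINT_sin_div[of "?\<epsilon> n" "?T n"] le[of n] unfolding set_lebesgue_integral_def by simp
    also have "\<dots> = (LINT \<xi>|lborel. LINT y|N. indicat_real {?\<epsilon> n..?T n} \<xi> *\<^sub>R (sin (\<xi> * y) / \<xi>))"
    proof (rule Fubini_prob_lborel(2))
      show "integrable lborel (\<lambda>\<xi>. ?T n * indicat_real {?\<epsilon> n..?T n} \<xi>)"
        using le[of n] by (intro integrable_mult_right) simp
      show "AE y in N. \<forall>\<xi>. norm (indicat_real {?\<epsilon> n..?T n} \<xi> *\<^sub>R (sin (\<xi> * y) / \<xi>)) \<le> ?T n * indicat_real {?\<epsilon> n..?T n} \<xi>"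
      proof (intro AE_I2 allI)
        fix y \<xi> :: real
        show "norm (indicat_real {?\<epsilon> n..?T n} \<xi> *\<^sub>R (sin (\<xi> * y) / \<xi>)) \<le> ?T n * indicat_real {?\<epsilon> n..?T n} \<xi>"
        proof (cases "\<xi> \<in> {?\<epsilon> n..?T n}")
          case True
          then have x: "1 / real (Suc n) \<le> \<xi>" by simp
          then have p: "\<xi> > 0" by (rule less_le_trans[rotated]) simp
          have "\<bar>sin (\<xi> * y)\<bar> / \<xi> \<le> 1 / \<xi>" using p by (intro divide_right_mono) auto
          also have "1 / \<xi> \<le> real (Suc n)" using x p by (simp add: field_simps)
          finally show ?thesis using True p by simp
        qed simp
      qed
    qed (use assms in auto)
    also have "\<dots> = (LBINT \<xi>:{?\<epsilon> n..?T n}. Im (char N \<xi>) / \<xi>)"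
      unfolding set_lebesgue_integral_def
    proof (rule Bochner_Integration.integral_cong[OF refl])
      fix \<xi> :: real
      have "Im (char N \<xi>) = (LINT y|N. Im (iexp (\<xi> * y)))"
        unfolding char_def by (intro integral_Im[symmetric] N.integrable_iexp) auto
      then show "(LINT y|N. indicat_real {?\<epsilon> n..?T n} \<xi> *\<^sub>R (sin (\<xi> * y) / \<xi>))
          = indicat_real {?\<epsilon> n..?T n} \<xi> *\<^sub>R (Im (char N \<xi>) / \<xi>)"
        by (simp add: Im_exp)
    qed
    finally show ?thesis .
  qed
  obtain B where B: "\<And>T. \<bar>Si T\<bar> \<le> B" using bounded_Si by auto
  have "(\<lambda>n. LINT y|N. ?S n y)
    \<longlonglongrightarrow> (LINT y|N. pi / 2 * (indicat_real {0<..} y - indicat_real {..<0} y))"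
  proof (rule integral_dominated_convergence[where w="\<lambda>_. 2 * B"])
    show "AE y in N. norm (?S n y) \<le> 2 * B" for n
    proof (rule AE_I2)
      fix y :: real
      have "\<bar>Si (?T n * \<bar>y\<bar>) - Si (?\<epsilon> n * \<bar>y\<bar>)\<bar> \<le> 2 * B"
        using B[of "?T n * \<bar>y\<bar>"] B[of "?\<epsilon> n * \<bar>y\<bar>"] by linarith
      then show "norm (?S n y) \<le> 2 * B"
        using B[of 0] by (simp add: abs_mult abs_sgn_eq)
    qed
    show "AE y in N. (\<lambda>n. ?S n y)
        \<longlonglongrightarrow> pi / 2 * (indicat_real {0<..} y - indicat_real {..<0} y)"
    proof (rule AE_I2)
      fix y :: real
      show "(\<lambda>n. ?S n y)
        \<longlonglongrightarrow> pi / 2 * (indicat_real {0<..} y - indicat_real {..<0} y)"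
      proof (cases "y = 0")
        case False
        have "filterlim ?T at_top sequentially"
          by (rule filterlim_compose[OF filterlim_real_sequentially filterlim_Suc])
        then have "filterlim (\<lambda>n. ?T n * \<bar>y\<bar>) at_top sequentially"
          using False by (intro filterlim_at_top_mult_tendsto_pos[OF tendsto_const]) auto
        then have 1: "(\<lambda>n. Si (?T n * \<bar>y\<bar>)) \<longlonglongrightarrow> pi / 2"
          by (rule filterlim_compose[OF Si_at_top])
        have "(\<lambda>n. ?\<epsilon> n * \<bar>y\<bar>) \<longlonglongrightarrow> 0 * \<bar>y\<bar>"
          by (intro tendsto_mult tendsto_const LIMSEQ_Suc[OF lim_1_over_n])
        then have "(\<lambda>n. Si (?\<epsilon> n * \<bar>y\<bar>)) \<longlonglongrightarrow> Si 0"
          by (intro isCont_tendsto_compose[OF isCont_Si]) simp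
        moreover have "Si 0 = 0" using Si_neg[of 0] by simp
        ultimately have "(\<lambda>n. ?S n y) \<longlonglongrightarrow> sgn y * (pi / 2 - 0)"
          using 1 by (intro tendsto_intros) auto
        then show ?thesis using False by (cases "y > 0") (auto simp: indicator_def)
      qed simp
    qed
  qed auto
  moreover have "(LINT y|N. pi / 2 * (indicat_real {0<..} y - indicat_real {..<0} y))
      = pi / 2 * (measure N {0<..} - measure N {..<0})"
    by (simp add: N.emeasure_eq_measure)
  ultimately show ?thesis unfolding eq by simp
qed

text \<open>
  Differentiating the sine in \<open>c\<close> cancels the denominator: with \<open>U = t \<xi>\<^sup>\<alpha>\<close>, the mixed integrand
  \<open>(U / \<xi>) e\<^sup>-\<^sup>U cos (v U)\<close> has an elementary primitive in each variable, and \<open>p v (U) / \<alpha>\<close> is the one in \<open>\<xi>\<close>.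
\<close>

lemma integral_exp_sin_div:
  fixes t \<alpha> c \<epsilon> T :: real
  defines "p \<equiv> \<lambda>v U. exp (- U) * (v * sin (v * U) - cos (v * U)) / (1 + v\<^sup>2)"
  assumes "\<alpha> > 0" "t > 0" "0 < \<epsilon>" "\<epsilon> \<le> T" "c \<ge> 0"
  shows "integral {\<epsilon>..T} (\<lambda>\<xi>. exp (- (t * \<xi> powr \<alpha>)) * sin (c * (t * \<xi> powr \<alpha>)) / \<xi>)
    = integral {0..c} (\<lambda>v. (p v (t * T powr \<alpha>) - p v (t * \<epsilon> powr \<alpha>)) / \<alpha>)"
proof -
  define U where "U = (\<lambda>\<xi>. t * \<xi> powr \<alpha>)"
  define f where "f \<xi> v = U \<xi> / \<xi> * exp (- U \<xi>) * cos (v * U \<xi>)" for \<xi> v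
  have "integral {\<epsilon>..T} (\<lambda>\<xi>. integral {0..c} (f \<xi>)) = integral {0..c} (\<lambda>v. integral {\<epsilon>..T} (\<lambda>\<xi>. f \<xi> v))"
  proof -
    have "continuous_on (cbox (\<epsilon>, 0) (T, c)) (\<lambda>(\<xi>, v). f \<xi> v)"
      unfolding f_def U_def case_prod_unfold using assms
      by (intro continuous_intros) (auto simp: cbox_Pair_eq)
    then show ?thesis
      using integral_swap_continuous[of \<epsilon> 0 T c f] by simp
  qed
  moreover have "integral {0..c} (f \<xi>) = exp (- U \<xi>) * sin (c * U \<xi>) / \<xi>" if "\<xi> \<in> {\<epsilon>..T}" for \<xi>
  proof -
    have x: "\<xi> > 0" using that assms by auto
    have "(f \<xi> has_integral (exp (- U \<xi>) * sin (c * U \<xi>) / \<xi> - exp (- U \<xi>) * sin (0 * U \<xi>) / \<xi>)) {0..c}"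
    proof (rule fundamental_theorem_of_calculus)
      fix v
      have "((\<lambda>v. exp (- U \<xi>) * sin (v * U \<xi>) / \<xi>) has_real_derivative f \<xi> v) (at v within {0..c})"
        unfolding f_def using x by (auto intro!: derivative_eq_intros simp: field_simps)
      then show "((\<lambda>v. exp (- U \<xi>) * sin (v * U \<xi>) / \<xi>) has_vector_derivative f \<xi> v) (at v within {0..c})"
        by (simp add: has_real_derivative_iff_has_vector_derivative)
    qed (use assms in auto)
    then show ?thesis by (simp add: integral_unique)
  qed
  moreover have "integral {\<epsilon>..T} (\<lambda>\<xi>. f \<xi> v) = (p v (U T) - p v (U \<epsilon>)) / \<alpha>" for v
  proof -
    have v: "1 + v\<^sup>2 \<noteq> 0" by (metis add_pos_nonneg less_irrefl zero_le_power2 zero_less_one)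
    have "((\<lambda>\<xi>. f \<xi> v) has_integral (p v (U T) / \<alpha> - p v (U \<epsilon>) / \<alpha>)) {\<epsilon>..T}"
    proof (rule fundamental_theorem_of_calculus)
      fix \<xi> assume "\<xi> \<in> {\<epsilon>..T}"
      then have x: "\<xi> > 0" using assms by auto
      have dU: "(U has_real_derivative \<alpha> * (U \<xi> / \<xi>)) (at \<xi>)"
        unfolding U_def using x by (auto intro!: derivative_eq_intros simp: powr_diff)
      have "((\<lambda>u. p v u / \<alpha>) has_real_derivative exp (- u) * cos (v * u) / \<alpha>) (at u)" for u
      proof -
        have "((\<lambda>u. exp (- u) * (v * sin (v * u) - cos (v * u))) has_real_derivative
            (1 + v\<^sup>2) * (exp (- u) * cos (v * u))) (at u)"
          by (auto intro!: derivative_eq_intros simp: algebra_simps power2_eq_square)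
        then have "((\<lambda>u. exp (- u) * (v * sin (v * u) - cos (v * u)) / (1 + v\<^sup>2) / \<alpha>) has_real_derivative
            (1 + v\<^sup>2) * (exp (- u) * cos (v * u)) / (1 + v\<^sup>2) / \<alpha>) (at u)"
          by (intro DERIV_cdivide)
        then show ?thesis using v by (simp add: p_def)
      qed
      from DERIV_chain2[OF this dU]
      have "((\<lambda>\<xi>. p v (U \<xi>) / \<alpha>) has_real_derivative f \<xi> v) (at \<xi>)"
        using assms by (simp add: f_def mult_ac)
      then show "((\<lambda>\<xi>. p v (U \<xi>) / \<alpha>) has_vector_derivative f \<xi> v) (at \<xi> within {\<epsilon>..T})"
        by (simp add: has_real_derivative_iff_has_vector_derivative has_vector_derivative_at_within)
    qed (use assms in auto)
    then show ?thesis by (simp add: integral_unique diff_divide_distrib)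
  qed
  ultimately show ?thesis
    unfolding U_def by (simp only: cong: Henstock_Kurzweil_Integration.integral_cong)
qed

lemma exp_sin_div_tendsto_arctan:
  fixes t \<alpha> c :: real
  assumes "\<alpha> > 0" "t > 0" "c \<ge> 0"
  shows "(\<lambda>n. integral {1 / real (Suc n)..real (Suc n)}
      (\<lambda>\<xi>. exp (- (t * \<xi> powr \<alpha>)) * sin (c * (t * \<xi> powr \<alpha>)) / \<xi>)) \<longlonglongrightarrow> arctan c / \<alpha>"
proof -
  define p :: "real \<Rightarrow> real \<Rightarrow> real"
    where "p v U = exp (- U) * (v * sin (v * U) - cos (v * U)) / (1 + v\<^sup>2)" for v U
  let ?\<epsilon> = "\<lambda>n. 1 / real (Suc n)" and ?T = "\<lambda>n. real (Suc n)"
  have le: "?\<epsilon> n \<le> ?T n" for n by (simp add: divide_le_eq mult_ge1_I)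
  have v2: "1 + v\<^sup>2 > 0" for v :: real by (simp add: add_pos_nonneg)
  have p_bound: "\<bar>p v U\<bar> \<le> exp (- U) * (\<bar>v\<bar> + 1)" for v U
  proof -
    have "\<bar>v * sin (v * U)\<bar> \<le> \<bar>v\<bar>" using abs_sin_le_one[of "v * U"] by (simp add: abs_mult mult_left_le)
    then have "\<bar>v * sin (v * U) - cos (v * U)\<bar> \<le> \<bar>v\<bar> + 1"
      using abs_cos_le_one[of "v * U"] by linarith
    then have "\<bar>p v U\<bar> \<le> exp (- U) * (\<bar>v\<bar> + 1) / (1 + v\<^sup>2)"
      unfolding p_def using v2[of v] by (simp add: abs_mult divide_right_mono)
    also have "\<dots> \<le> exp (- U) * (\<bar>v\<bar> + 1) / 1"
      using v2[of v] by (intro divide_left_mono) auto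
    finally show ?thesis by simp
  qed
  have cont: "continuous_on S (\<lambda>v. (p v U - p v U') / \<alpha>)" for S U U'
    unfolding p_def using v2 assms(1) by (intro continuous_intros) (auto simp: v2 less_imp_neq[OF v2, symmetric])
  have "(\<lambda>n. integral {0..c} (\<lambda>v. (p v (t * ?T n powr \<alpha>) - p v (t * ?\<epsilon> n powr \<alpha>)) / \<alpha>))
    \<longlonglongrightarrow> integral {0..c} (\<lambda>v. (0 - (- 1 / (1 + v\<^sup>2))) / \<alpha>)"
  proof (rule dominated_convergence(2))
    show "(\<lambda>v. (p v (t * ?T n powr \<alpha>) - p v (t * ?\<epsilon> n powr \<alpha>)) / \<alpha>) integrable_on {0..c}" for n
      by (intro integrable_continuous_real cont)
    show "(\<lambda>v. 2 * (\<bar>v\<bar> + 1) / \<alpha>) integrable_on {0..c}"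
      using assms by (intro integrable_continuous_real continuous_intros) auto
    show "norm ((p v (t * ?T n powr \<alpha>) - p v (t * ?\<epsilon> n powr \<alpha>)) / \<alpha>) \<le> 2 * (\<bar>v\<bar> + 1) / \<alpha>" for n v
    proof -
      have b: "\<bar>p v U\<bar> \<le> \<bar>v\<bar> + 1" if "U \<ge> 0" for U
      proof -
        have "exp (- U) * (\<bar>v\<bar> + 1) \<le> 1 * (\<bar>v\<bar> + 1)" using that by (intro mult_right_mono) auto
        then show ?thesis by (intro order_trans[OF p_bound]) simp
      qed
      have "\<bar>p v (t * ?T n powr \<alpha>) - p v (t * ?\<epsilon> n powr \<alpha>)\<bar> \<le> 2 * (\<bar>v\<bar> + 1)"
        using b[of "t * ?T n powr \<alpha>"] b[of "t * ?\<epsilon> n powr \<alpha>"] assms by simp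
      then show ?thesis using assms by (simp add: divide_right_mono)
    qed
    show "(\<lambda>n. (p v (t * ?T n powr \<alpha>) - p v (t * ?\<epsilon> n powr \<alpha>)) / \<alpha>) \<longlonglongrightarrow> (0 - (- 1 / (1 + v\<^sup>2))) / \<alpha>" for v
    proof -
      have "filterlim (\<lambda>n. t * ?T n powr \<alpha>) at_top sequentially"
        using assms by real_asymp
      then have "(\<lambda>n. exp (- (t * ?T n powr \<alpha>))) \<longlonglongrightarrow> 0"
        by (intro filterlim_compose[OF exp_at_bot] filterlim_compose[OF filterlim_uminus_at_bot_at_top])
      then have "(\<lambda>n. exp (- (t * ?T n powr \<alpha>)) * (\<bar>v\<bar> + 1)) \<longlonglongrightarrow> 0"
        by (rule tendsto_mult_left_zero)
      then have 1: "(\<lambda>n. p v (t * ?T n powr \<alpha>)) \<longlonglongrightarrow> 0"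
        by (rule Lim_null_comparison[rotated]) (use p_bound in auto)
      have "(\<lambda>n. t * ?\<epsilon> n powr \<alpha>) \<longlonglongrightarrow> 0"
        using assms by real_asymp
      then have "(\<lambda>n. p v (t * ?\<epsilon> n powr \<alpha>)) \<longlonglongrightarrow> exp (- 0) * (v * sin (v * 0) - cos (v * 0)) / (1 + v\<^sup>2)"
        unfolding p_def using v2[of v] by (intro tendsto_intros) auto
      then have 2: "(\<lambda>n. p v (t * ?\<epsilon> n powr \<alpha>)) \<longlonglongrightarrow> - 1 / (1 + v\<^sup>2)" by simp
      show ?thesis using assms by (intro tendsto_intros 1 2) auto
    qed
  qed
  moreover have "integral {0..c} (\<lambda>v. (0 - (- 1 / (1 + v\<^sup>2))) / \<alpha>) = arctan c / \<alpha>"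
  proof (rule integral_unique)
    have "((\<lambda>v. (0 - (- 1 / (1 + v\<^sup>2))) / \<alpha>) has_integral (arctan c / \<alpha> - arctan 0 / \<alpha>)) {0..c}"
    proof (rule fundamental_theorem_of_calculus)
      fix v
      have "((\<lambda>v. arctan v / \<alpha>) has_real_derivative inverse (1 + v\<^sup>2) / \<alpha>) (at v within {0..c})"
        by (rule has_field_derivative_at_within, rule DERIV_cdivide, rule DERIV_arctan)
      then show "((\<lambda>v. arctan v / \<alpha>) has_vector_derivative (0 - (- 1 / (1 + v\<^sup>2))) / \<alpha>) (at v within {0..c})"
        by (simp add: has_real_derivative_iff_has_vector_derivative inverse_eq_divide)
    qed fact
    then show "((\<lambda>v. (0 - (- 1 / (1 + v\<^sup>2))) / \<alpha>) has_integral arctan c / \<alpha>) {0..c}" by simp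
  qed
  moreover have "integral {?\<epsilon> n..?T n} (\<lambda>\<xi>. exp (- (t * \<xi> powr \<alpha>)) * sin (c * (t * \<xi> powr \<alpha>)) / \<xi>)
      = integral {0..c} (\<lambda>v. (p v (t * ?T n powr \<alpha>) - p v (t * ?\<epsilon> n powr \<alpha>)) / \<alpha>)" for n
    unfolding p_def using assms le[of n] by (intro integral_exp_sin_div) auto
  ultimately show ?thesis by simp
qed

lemma exp_sin_div_tendsto_arctan':
  fixes t \<alpha> c :: real
  assumes "\<alpha> > 0" "t > 0"
  shows "(\<lambda>n. integral {1 / real (Suc n)..real (Suc n)}
      (\<lambda>\<xi>. exp (- (t * \<xi> powr \<alpha>)) * sin (c * (t * \<xi> powr \<alpha>)) / \<xi>)) \<longlonglongrightarrow> arctan c / \<alpha>"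
proof (cases "c \<ge> 0")
  case True
  then show ?thesis by (intro exp_sin_div_tendsto_arctan assms)
next
  case False
  then have "(\<lambda>n. - integral {1 / real (Suc n)..real (Suc n)}
      (\<lambda>\<xi>. exp (- (t * \<xi> powr \<alpha>)) * sin (- c * (t * \<xi> powr \<alpha>)) / \<xi>)) \<longlonglongrightarrow> - (arctan (- c) / \<alpha>)"
    by (intro tendsto_minus exp_sin_div_tendsto_arctan assms) auto
  then show ?thesis by (simp add: arctan_minus)
qed

lemma stable_positivity:
  fixes N :: "real measure"
  assumes N: "real_distribution N" and "\<alpha> > 0" "t > 0"
    and char: "\<And>\<xi>. char N \<xi> = exp (- of_real t * stable_exponent \<alpha> \<beta> \<xi>)"
  shows "measure N {0..} = 1 / 2 + arctan (\<beta> * tan (pi * \<alpha> / 2)) / (pi * \<alpha>)"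
proof -
  interpret N: real_distribution N by fact
  define c where "c = \<beta> * tan (pi * \<alpha> / 2)"
  have ch: "char N \<xi> = exp (Complex (- (t * \<xi> powr \<alpha>)) (c * (t * \<xi> powr \<alpha>)))" if "\<xi> > 0" for \<xi>
    unfolding char using that
    by (intro arg_cong[where f=exp]) (simp add: stable_exponent_def c_def complex_eq_iff)
  have "(char N \<longlongrightarrow> 0) at_top"
  proof (rule tendsto_norm_zero_cancel)
    have "((\<lambda>\<xi>. exp (- (t * \<xi> powr \<alpha>))) \<longlongrightarrow> 0) at_top" using assms by real_asymp
    moreover have "\<forall>\<^sub>F \<xi> in at_top. exp (- (t * \<xi> powr \<alpha>)) = norm (char N \<xi>)"
      using eventually_gt_at_top[of 0] by eventually_elim (simp add: ch)
    ultimately show "((\<lambda>\<xi>. norm (char N \<xi>)) \<longlongrightarrow> 0) at_top"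
      by (rule Lim_transform_eventually)
  qed
  then have zero: "measure N {0} = 0" by (intro measure_singleton_0_eq_0 N)
  have eq: "(LBINT \<xi>:{1 / real (Suc n)..real (Suc n)}. Im (char N \<xi>) / \<xi>)
     = integral {1 / real (Suc n)..real (Suc n)}
      (\<lambda>\<xi>. exp (- (t * \<xi> powr \<alpha>)) * sin (c * (t * \<xi> powr \<alpha>)) / \<xi>)" for n
  proof -
    have pos: "0 < \<xi>" if "\<xi> \<in> {1 / real (Suc n)..real (Suc n)}" for \<xi>
      using that by (auto intro: less_le_trans[rotated])
    have "(LBINT \<xi>:{1 / real (Suc n)..real (Suc n)}. Im (char N \<xi>) / \<xi>)
      = (LBINT \<xi>:{1 / real (Suc n)..real (Suc n)}. exp (- (t * \<xi> powr \<alpha>)) * sin (c * (t * \<xi> powr \<alpha>)) / \<xi>)"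
      by (intro set_lebesgue_integral_cong) (simp_all add: ch[OF pos] Im_exp)
    also have "\<dots> = integral {1 / real (Suc n)..real (Suc n)}
      (\<lambda>\<xi>. exp (- (t * \<xi> powr \<alpha>)) * sin (c * (t * \<xi> powr \<alpha>)) / \<xi>)"
      using pos
      by (intro set_borel_integral_eq_integral(2) borel_integrable_atLeastAtMost' continuous_intros) force+
    finally show ?thesis .
  qed
  have "pi / 2 * (measure N {0<..} - measure N {..<0}) = arctan c / \<alpha>"
    using Gil_Pelaez[OF N] exp_sin_div_tendsto_arctan'[OF assms(2,3), of c]
    unfolding eq by (rule LIMSEQ_unique)
  moreover have "measure N {0..} = measure N {0<..}"
  proof -
    have "measure N ({0} \<union> {0<..}) = measure N {0} + measure N {0<..}"
      by (intro N.finite_measure_Union) auto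
    moreover have "{0} \<union> {0<..} = {0::real..}" by auto
    ultimately show ?thesis using zero by simp
  qed
  moreover have "measure N {..<0} = 1 - measure N {0..}"
  proof -
    have "measure N (space N - {0..}) = 1 - measure N {0..}"
      by (rule N.prob_compl) auto
    moreover have "space N - {0..} = {..<0::real}" by auto
    ultimately show ?thesis by simp
  qed
  ultimately have "pi / 2 * (2 * measure N {0..} - 1) = arctan c / \<alpha>" by simp
  note h = this
  have cancel: "Z = pi / 2 * Z * (2 / pi)" for Z :: real by simp
  have "2 * measure N {0..} - 1 = arctan c / \<alpha> * (2 / pi)"
    unfolding h[symmetric] by (rule cancel)
  then show ?thesis unfolding c_def by (simp add: field_simps)
qed

section \<open>The equilibrium measure of an interval\<close>

text \<open>
  A limit along \<open>q \<rightarrow> 0\<close> from the right is a limit along all positive null sequences, and along each of them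
  the equilibrium problem has been solved. The criterion covers atomic and absolutely continuous
  equilibrium measures alike.
\<close>

theorem (in stable_like_exponent) equilibrium_measure_and_robin_constant:
  assumes ab: "a \<le> b" and M: "prob_space M" "sets M = sets borel" "emeasure M (- {a..b}) = 0"
    and potential: "\<And>x. x \<in> {a..b} \<Longrightarrow> (LINT y|M. potential_kernel \<Psi> 0 (y - x)) = k"
    and fin: "\<And>q. q > 0 \<Longrightarrow> finite_measure (m q)" and sets_m: "\<And>q. q > 0 \<Longrightarrow> sets (m q) = sets borel"
    and supp: "\<And>q. q > 0 \<Longrightarrow> emeasure (m q) (- {a..b}) = 0"
    and capacity: "\<And>q x. q > 0 \<Longrightarrow> x \<in> {a..b} \<Longrightarrow> (LINT y|m q. resolvent_density \<Psi> q (y - x)) = 1"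
  shows "is_equilibrium_measure \<Psi> {a..b} m M" and "is_robin_constant \<Psi> {a..b} m k"
proof -
  have real: "real_distribution M"
    using M sets_eq_imp_space_eq[OF M(2)]
    by (simp add: real_distribution_def real_distribution_axioms_def)
  have AE_M: "AE y in M. y \<in> {a..b}"
    by (rule AE_I[where N="- {a..b}"]) (auto simp: M)
  interpret compact_charge \<Psi> \<alpha> C a b
    by unfold_locales (fact ab)
  have problem: "equilibrium_problem \<Psi> \<alpha> C a b M k X (\<lambda>n. m (X n))"
    if "\<forall>n. X n \<in> {0<..} - {0}" "X \<longlonglongrightarrow> 0" for X
  proof -
    have pos: "X n > 0" for n using that(1) by simp
    have charge: "charge M" unfolding charge_def using real AE_M by blast
    show ?thesis
      by (intro equilibrium_problem.intro equilibrium_problem_axioms.intro compact_charge_axioms)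
        (fact charge potential pos that(2) fin[OF pos] sets_m[OF pos] supp[OF pos] capacity[OF pos])+
  qed
  have mass: "measure (m q) (space (m q)) = measure (m q) {a..b}" if "q > 0" for q
  proof -
    interpret finite_measure "m q" by (rule fin) fact
    have sp: "space (m q) = UNIV" using sets_eq_imp_space_eq[OF sets_m[OF that]] by simp
    have "measure (m q) (space (m q) - {a..b}) = measure (m q) (space (m q)) - measure (m q) {a..b}"
      by (rule finite_measure_compl) (simp add: sets_m[OF that])
    moreover have "measure (m q) (space (m q) - {a..b}) = 0"
      using supp[OF that] unfolding sp measure_def by (simp add: Compl_eq_Diff_UNIV)
    ultimately show ?thesis by simp
  qed
  show "is_equilibrium_measure \<Psi> {a..b} m M"
    unfolding is_equilibrium_measure_def weak_limit_def
  proof (intro conjI allI impI M)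
    fix f :: "real \<Rightarrow> real" assume f: "continuous_on UNIV f" "bounded (range f)"
    show "((\<lambda>q. LINT x|scale_measure (ennreal (resolvent_density \<Psi> q 0)) (m q). f x) \<longlongrightarrow> (LINT x|M. f x)) (at_right 0)"
      unfolding tendsto_at_iff_sequentially
    proof (intro allI impI)
      fix X assume X: "\<forall>n. X n \<in> {0<..} - {0::real}" "X \<longlonglongrightarrow> 0"
      show "((\<lambda>q. LINT x|scale_measure (ennreal (resolvent_density \<Psi> q 0)) (m q). f x) \<circ> X) \<longlonglongrightarrow> (LINT x|M. f x)"
        using equilibrium_problem.equilibrium_tendsto[OF problem[OF X] f] by (simp add: o_def)
    qed
  qed
  show "is_robin_constant \<Psi> {a..b} m k"
    unfolding is_robin_constant_def tendsto_at_iff_sequentially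
  proof (intro allI impI)
    fix X assume X: "\<forall>n. X n \<in> {0<..} - {0::real}" "X \<longlonglongrightarrow> 0"
    have "measure (m (X n)) {a..b} = measure (m (X n)) (space (m (X n)))" for n
      using X(1) mass[of "X n"] by simp
    then show "((\<lambda>q. resolvent_density \<Psi> q 0 * (resolvent_density \<Psi> q 0 * measure (m q) {a..b} - 1)) \<circ> X) \<longlonglongrightarrow> k"
      using equilibrium_problem.robin_constant_tendsto[OF problem[OF X]] by (simp add: o_def)
  qed
qed

text \<open>
  The hitting time vanishes almost surely. The integrand need not be measurable before completion, but it
  agrees almost everywhere with a constant.
\<close>

lemma (in levy_process) hitting_laplace_start:
  assumes "x \<in> A"
  shows "hitting_laplace P X q A x = 1"
proof -
  interpret prob_space "P x" by (rule prob)
  let ?F = "\<lambda>w. if hitting_time X A w = \<infinity> then 0 else exp (- q * real_of_ereal (hitting_time X A w))"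
  have AE: "AE w in completion (P x). ?F w = 1"
  proof (rule AE_completion)
    show "AE w in P x. ?F w = 1"
      using start
    proof eventually_elim
      case (elim w)
      have "hitting_time X A w \<le> ereal 0"
        unfolding hitting_time_def using elim assms by (intro INF_lower) auto
      moreover have "0 \<le> hitting_time X A w"
        unfolding hitting_time_def by (intro INF_greatest) auto
      ultimately have "hitting_time X A w = 0" by (simp add: zero_ereal_def order.antisym)
      then show ?case by simp
    qed
  qed
  have meas: "?F \<in> borel_measurable (completion (P x))"
  proof (rule measurableI)
    fix S :: "real set" assume "S \<in> sets borel"
    show "?F -` S \<inter> space (completion (P x)) \<in> sets (completion (P x))"
    proof (rule completion.in_sets_AE)
      show "AE w in completion (P x). w \<in> (\<lambda>_. 1) -` S \<inter> space (completion (P x)) \<longleftrightarrow> w \<in> ?F -` S \<inter> space (completion (P x))"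
        using AE by eventually_elim auto
      show "(\<lambda>_. 1) -` S \<inter> space (completion (P x)) \<in> sets (completion (P x))"
        by (cases "1 \<in> S") auto
    qed auto
  qed simp
  have "hitting_laplace P X q A x = (LINT w|completion (P x). 1)"
    unfolding hitting_laplace_def by (intro integral_cong_AE meas AE) simp
  also have "\<dots> = 1" using prob_space by (simp add: measure_completion)
  finally show ?thesis .
qed

lemma (in levy_process) real_distribution_marginal:
  "t \<ge> 0 \<Longrightarrow> real_distribution (distr (P x) borel (X t))"
  by (intro real_distribution.intro real_distribution_axioms.intro prob_space.prob_space_distr prob measurable) auto

lemma (in stable_process) positivity_parameter:
  assumes "\<alpha> > 0" "t > 0"
  shows "measure (P 0) {w \<in> space (P 0). X t w \<ge> 0} = 1 / 2 + arctan (\<beta> * tan (pi * \<alpha> / 2)) / (pi * \<alpha>)"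
proof -
  have [measurable]: "X t \<in> borel_measurable (P 0)" using assms by (intro measurable) simp
  have "measure (P 0) {w \<in> space (P 0). X t w \<ge> 0} = measure (distr (P 0) borel (X t)) {0..}"
    by (subst measure_distr) (auto simp: vimage_def Int_def intro!: arg_cong[where f="measure (P 0)"])
  also have "\<dots> = 1 / 2 + arctan (\<beta> * tan (pi * \<alpha> / 2)) / (pi * \<alpha>)"
    using assms by (intro stable_positivity[where t=t] real_distribution_marginal characteristic_exponent) auto
  finally show ?thesis .
qed

text \<open>
  The relations between \<open>\<alpha>\<close>, \<open>\<beta>\<close> and \<open>\<rho>\<close>, separated from the process. The bounds on \<open>\<rho>\<close> hold because it is a
  probability; they save a discussion of the monotonicity of the arctangent.
\<close>

locale stable_parameters =
  fixes \<alpha> \<beta> \<rho> \<rho>' :: real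
  assumes \<alpha>: "1 < \<alpha>" "\<alpha> < 2" and \<beta>: "- 1 \<le> \<beta>" "\<beta> \<le> 1"
    and \<rho>: "\<rho> = 1 / 2 + arctan (\<beta> * tan (pi * \<alpha> / 2)) / (pi * \<alpha>)" and \<rho>': "\<rho>' = 1 - \<rho>"
    and \<rho>_bounds: "0 \<le> \<rho>" "\<rho> \<le> 1"
begin

definition c :: real where "c = \<beta> * tan (pi * \<alpha> / 2)"

lemma cos_half_neg: "cos (pi * \<alpha> / 2) < 0"
  using \<alpha> cos_monotone_0_pi[of "pi/2" "pi * \<alpha> / 2"] by simp

lemma sin_half_pos: "sin (pi * \<alpha> / 2) > 0"
  using \<alpha> by (intro sin_gt_zero) auto

lemma cos_arctan_pos: "cos (arctan c) > 0"
  by (intro cos_gt_zero_pi arctan_lbound arctan_ubound)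

lemma angle: "pi * \<alpha> * (\<rho> - 1 / 2) = arctan c"
  using \<alpha> by (simp add: \<rho> c_def)

lemma sin_add_arctan: "sin (arctan c) * cos (pi * \<alpha> / 2) = \<beta> * sin (pi * \<alpha> / 2) * cos (arctan c)"
proof -
  have "sin (arctan c) = c * cos (arctan c)" by (simp add: sin_arctan cos_arctan)
  moreover have "c * cos (pi * \<alpha> / 2) = \<beta> * sin (pi * \<alpha> / 2)"
    using cos_half_neg by (simp add: c_def tan_def)
  ultimately show ?thesis by (metis mult.assoc mult.commute)
qed

lemma sin_rho: "sin (pi * (\<alpha> * \<rho>)) = (1 + \<beta>) * (sin (pi * \<alpha> / 2) * cos (arctan c))"
proof -
  have "pi * (\<alpha> * \<rho>) = pi * \<alpha> / 2 + arctan c"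
    using angle by (simp add: algebra_simps)
  then have "sin (pi * (\<alpha> * \<rho>)) = sin (pi * \<alpha> / 2) * cos (arctan c) + sin (arctan c) * cos (pi * \<alpha> / 2)"
    by (simp add: sin_add)
  then show ?thesis unfolding sin_add_arctan by (simp add: algebra_simps)
qed

lemma sin_rho': "sin (pi * (\<alpha> * \<rho>')) = (1 - \<beta>) * (sin (pi * \<alpha> / 2) * cos (arctan c))"
proof -
  have "pi * (\<alpha> * \<rho>') = pi * \<alpha> / 2 - arctan c"
    using angle by (simp add: \<rho>' algebra_simps)
  then have "sin (pi * (\<alpha> * \<rho>')) = sin (pi * \<alpha> / 2) * cos (arctan c) - sin (arctan c) * cos (pi * \<alpha> / 2)"
    by (simp add: sin_diff)
  then show ?thesis unfolding sin_add_arctan by (simp add: algebra_simps)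
qed

text \<open>
  As \<open>0 \<le> \<alpha> r < 2\<close>, the sign of \<open>sin (\<pi> \<alpha> r)\<close> decides on which side of \<open>1\<close> the exponent lies.
\<close>

lemma exponent_in_unit_interval:
  assumes "0 \<le> r" "r \<le> 1" "sin (pi * (\<alpha> * r)) > 0"
  shows "0 < \<alpha> * r" "\<alpha> * r < 1"
proof -
  have le: "\<alpha> * r < 2" using assms \<alpha> mult_left_le[of r \<alpha>] by linarith
  show "0 < \<alpha> * r" using assms \<alpha> by (cases "r = 0") auto
  show "\<alpha> * r < 1"
  proof (rule ccontr)
    assume "\<not> \<alpha> * r < 1"
    then have "pi \<le> pi * (\<alpha> * r)" "pi * (\<alpha> * r) < 2 * pi" using le by auto
    then have "0 \<le> sin (pi * (\<alpha> * r) - pi)" by (intro sin_ge_zero) auto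
    then show False using assms(3) by (simp add: sin_diff)
  qed
qed

lemma rho'_bounds: "0 \<le> \<rho>'" "\<rho>' \<le> 1"
  using \<rho>_bounds by (auto simp: \<rho>')

lemma exponent_eq_1:
  assumes "0 \<le> r" "r \<le> 1" "sin (pi * (\<alpha> * r)) = 0" "\<alpha> * r > 0"
  shows "\<alpha> * r = 1"
proof -
  have le: "\<alpha> * r < 2" using assms \<alpha> mult_left_le[of r \<alpha>] by linarith
  show ?thesis
  proof (cases "\<alpha> * r" "1::real" rule: linorder_cases)
    case less
    then have "sin (pi * (\<alpha> * r)) > 0" using assms(4) by (intro sin_gt_zero) auto
    then show ?thesis using assms by simp
  next
    case greater
    then have "sin (pi * (\<alpha> * r) - pi) > 0" using le by (intro sin_gt_zero) auto
    then show ?thesis using assms by (simp add: sin_diff)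
  qed
qed

lemma sum_exponents: "\<alpha> * \<rho> + \<alpha> * \<rho>' = \<alpha>"
  by (simp add: \<rho>' algebra_simps)

definition kernel_scale :: real where "kernel_scale = - 1 / (2 * Gamma \<alpha> * cos (pi * \<alpha> / 2) * (1 + c\<^sup>2))"

lemma potential_kernel_eq:
  "potential_kernel (stable_exponent \<alpha> \<beta>) 0 x = kernel_scale * (\<bar>x\<bar> powr (\<alpha> - 1) * (1 + \<beta> * sgn x))"
  unfolding stable_potential_kernel[OF \<alpha>] kernel_scale_def c_def by simp

lemma Gamma_pos: "Gamma \<alpha> > 0"
  using \<alpha> by (intro Gamma_real_pos) auto

lemma kernel_scale_pos: "kernel_scale > 0"
  using cos_half_neg Gamma_pos unfolding kernel_scale_def
  by (intro divide_neg_neg mult_neg_pos mult_pos_neg) (auto simp: add_pos_nonneg)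

definition robin :: "real \<Rightarrow> real \<Rightarrow> real" where
  "robin a b = - ((b - a) powr (\<alpha> - 1) * pi * cos (pi * \<alpha> * (\<rho> - 1 / 2)))
        / (Gamma \<alpha> * sin (pi * \<alpha>) * Beta (1 - \<alpha> * \<rho>) (1 - \<alpha> * \<rho>'))"

text \<open>
  Collects the constants: \<open>1 + c\<^sup>2 = 1 / cos\<^sup>2 (arctan c)\<close> and
  \<open>sin (\<pi> \<alpha>) = 2 sin (\<pi> \<alpha> / 2) cos (\<pi> \<alpha> / 2)\<close>.
\<close>

lemma kernel_scale_times_reflection:
  "kernel_scale * (pi / (sin (pi * \<alpha> / 2) * cos (arctan c))) = - (pi * cos (arctan c)) / (Gamma \<alpha> * sin (pi * \<alpha>))"
proof -
  define C where "C = cos (arctan c)"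
  define s where "s = sin (pi * \<alpha> / 2)"
  define k where "k = cos (pi * \<alpha> / 2)"
  have nz: "C \<noteq> 0" "s \<noteq> 0" "k \<noteq> 0" "Gamma \<alpha> \<noteq> 0"
    using cos_arctan_pos sin_half_pos cos_half_neg Gamma_pos by (auto simp: C_def s_def k_def)
  have "1 + c\<^sup>2 = 1 / C\<^sup>2"
    unfolding C_def cos_arctan by (simp add: power_divide add_nonneg_nonneg)
  then have scale: "kernel_scale = - 1 / (2 * Gamma \<alpha> * k * (1 / C\<^sup>2))"
    unfolding kernel_scale_def k_def by (simp only:)
  have sin: "sin (pi * \<alpha>) = 2 * s * k"
    using sin_double[of "pi * \<alpha> / 2"] by (simp add: s_def k_def)
  show ?thesis
    unfolding C_def[symmetric] s_def[symmetric] scale sin using nz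
    by (simp add: field_simps power2_eq_square)
qed

end

locale two_sided_stable = stable_parameters +
  fixes a b :: real
  assumes ab: "a < b" and \<beta>_strict: "- 1 < \<beta>" "\<beta> < 1"
begin

lemma exponent_at_b: "0 < \<alpha> * \<rho>" "\<alpha> * \<rho> < 1" and exponent_at_a: "0 < \<alpha> * \<rho>'" "\<alpha> * \<rho>' < 1"
proof -
  have "sin (pi * (\<alpha> * \<rho>)) > 0" "sin (pi * (\<alpha> * \<rho>')) > 0"
    unfolding sin_rho sin_rho' using \<beta>_strict sin_half_pos cos_arctan_pos by auto
  then show "0 < \<alpha> * \<rho>" "\<alpha> * \<rho> < 1" "0 < \<alpha> * \<rho>'" "\<alpha> * \<rho>' < 1"
    using exponent_in_unit_interval \<rho>_bounds rho'_bounds by blast+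
qed

text \<open>
  By the reflection formula, the balance condition for the one-sided potentials is
  \<open>(1 + \<beta>) / sin (\<pi> \<alpha> \<rho>) = (1 - \<beta>) / sin (\<pi> \<alpha> \<rho>')\<close>, and both sides equal
  \<open>1 / (sin (\<pi> \<alpha> / 2) cos (arctan c))\<close>.
\<close>

lemma balance:
  "(1 + \<beta>) * Beta (\<alpha> - 1) (1 - \<alpha> * \<rho>) = (1 - \<beta>) * Beta (\<alpha> - 1) (1 - \<alpha> * \<rho>')"
proof -
  define u v where "u = \<alpha> * \<rho>" and "v = \<alpha> * \<rho>'"
  define K where "K = sin (pi * \<alpha> / 2) * cos (arctan c)"
  have uv: "\<alpha> - 1 + (1 - u) = v" "\<alpha> - 1 + (1 - v) = u"
    using sum_exponents by (simp_all add: u_def v_def)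
  have K: "K > 0" using sin_half_pos cos_arctan_pos by (simp add: K_def)
  have r: "Gamma u * Gamma (1 - u) = pi / ((1 + \<beta>) * K)" "Gamma v * Gamma (1 - v) = pi / ((1 - \<beta>) * K)"
    using sin_Gamma_reflection_real[of u] sin_Gamma_reflection_real[of v] exponent_at_b exponent_at_a
    by (simp_all add: u_def v_def K_def sin_rho sin_rho')
  have g: "Gamma u > 0" "Gamma v > 0"
    using exponent_at_b exponent_at_a by (auto simp: u_def v_def intro: Gamma_real_pos)
  have "(1 + \<beta>) * (Gamma u * Gamma (1 - u)) = (1 - \<beta>) * (Gamma v * Gamma (1 - v))"
    unfolding r using \<beta>_strict K by simp
  then have "(1 + \<beta>) * (Gamma (1 - u) / Gamma v) = (1 - \<beta>) * (Gamma (1 - v) / Gamma u)"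
    using g by (simp add: field_simps)
  then have "Gamma (\<alpha> - 1) * ((1 + \<beta>) * (Gamma (1 - u) / Gamma v)) = Gamma (\<alpha> - 1) * ((1 - \<beta>) * (Gamma (1 - v) / Gamma u))"
    by simp
  then show ?thesis
    unfolding Beta_def u_def[symmetric] v_def[symmetric] uv by (simp add: mult_ac)
qed

definition eq_density :: "real \<Rightarrow> real" where
  "eq_density y = (b - a) powr (\<alpha> - 1) / Beta (1 - \<alpha> * \<rho>') (1 - \<alpha> * \<rho>)
            * (b - y) powr (- \<alpha> * \<rho>) * (y - a) powr (- \<alpha> * \<rho>') * indicator {a<..<b} y"

abbreviation eq_measure where "eq_measure \<equiv> density lborel (\<lambda>y. ennreal (eq_density y))"

lemma measurable_eq_density [measurable]: "eq_density \<in> borel_measurable borel"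
  unfolding eq_density_def by measurable

lemma Beta_pos: "Beta (1 - \<alpha> * \<rho>') (1 - \<alpha> * \<rho>) > 0"
  using exponent_at_b exponent_at_a by (simp add: Beta_def Gamma_real_pos)

lemma eq_density_nonneg: "eq_density y \<ge> 0"
  unfolding eq_density_def using Beta_pos by simp

lemma emeasure_eq_measure_UNIV: "emeasure eq_measure UNIV = 1"
proof -
  let ?C = "(b - a) powr (\<alpha> - 1) / Beta (1 - \<alpha> * \<rho>') (1 - \<alpha> * \<rho>)"
  have C: "?C > 0" using ab Beta_pos by simp
  have "emeasure eq_measure UNIV = (\<integral>\<^sup>+y. ennreal (eq_density y) \<partial>lborel)"
    by (simp add: emeasure_density)
  also have "\<dots> = (\<integral>\<^sup>+y. ennreal ?C * (ennreal ((y - a) powr (1 - \<alpha> * \<rho>' - 1) * (b - y) powr (1 - \<alpha> * \<rho> - 1)) * indicator {a..b} y) \<partial>lborel)"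
  proof (rule nn_integral_cong_AE)
    have "AE y in lborel. y \<noteq> a \<and> y \<noteq> b"
      using AE_lborel_singleton[of a] AE_lborel_singleton[of b] by eventually_elim auto
    then show "AE y in lborel. ennreal (eq_density y) = ennreal ?C *
        (ennreal ((y - a) powr (1 - \<alpha> * \<rho>' - 1) * (b - y) powr (1 - \<alpha> * \<rho> - 1)) * indicator {a..b} y)"
    proof eventually_elim
      case (elim y)
      show ?case
      proof (cases "y \<in> {a<..<b}")
        case True
        then show ?thesis using C by (simp add: eq_density_def ennreal_mult'[symmetric] mult_ac)
      next
        case False
        then have "y \<notin> {a..b}" using elim by auto
        then show ?thesis using False by (simp add: eq_density_def)
      qed
    qed
  qed
  also have "\<dots> = ennreal ?C * ennreal (Beta (1 - \<alpha> * \<rho>') (1 - \<alpha> * \<rho>) * (b - a) powr (1 - \<alpha> * \<rho>' + (1 - \<alpha> * \<rho>) - 1))"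
    using nn_integral_Beta[OF ab, of "1 - \<alpha> * \<rho>'" "1 - \<alpha> * \<rho>"] exponent_at_b exponent_at_a
    by (subst nn_integral_cmult) auto
  also have "\<dots> = ennreal (?C * (Beta (1 - \<alpha> * \<rho>') (1 - \<alpha> * \<rho>) * (b - a) powr (- (\<alpha> - 1))))"
  proof -
    have "1 - \<alpha> * \<rho>' + (1 - \<alpha> * \<rho>) - 1 = - (\<alpha> - 1)" using sum_exponents by linarith
    then show ?thesis using C by (simp only: ennreal_mult')
  qed
  also have "?C * (Beta (1 - \<alpha> * \<rho>') (1 - \<alpha> * \<rho>) * (b - a) powr (- (\<alpha> - 1))) = 1"
    using Beta_pos ab powr_minus_divide[of "b - a" "\<alpha> - 1"] by simp
  finally show ?thesis by simp
qed

lemma prob_space_eq_measure: "prob_space eq_measure"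
  by (rule prob_spaceI) (use emeasure_eq_measure_UNIV in simp)

lemma supp_eq_measure: "emeasure eq_measure (- {a..b}) = 0"
proof -
  have "emeasure eq_measure (- {a..b}) = (\<integral>\<^sup>+y. ennreal (eq_density y) * indicator (- {a..b}) y \<partial>lborel)"
    by (rule emeasure_density) auto
  also have "\<dots> = (\<integral>\<^sup>+(y::real). 0 \<partial>lborel)"
    by (rule nn_integral_cong) (auto simp: eq_density_def indicator_def)
  finally show ?thesis by simp
qed

text \<open>
  All factors are nonnegative, so the potential can be computed as an integral with values in
  \<open>[0, \<infinity>]\<close>; the resulting finite value gives integrability.
\<close>

lemma potential_eq_measure:
  assumes "x \<in> {a..b}"
  shows "(LINT y|eq_measure. potential_kernel (stable_exponent \<alpha> \<beta>) 0 (y - x)) = robin a b"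
proof -
  let ?B = "Beta (1 - \<alpha> * \<rho>') (1 - \<alpha> * \<rho>)"
  let ?C = "(b - a) powr (\<alpha> - 1) / ?B"
  let ?R = "\<lambda>y. \<bar>y - x\<bar> powr (\<alpha> * \<rho> + \<alpha> * \<rho>' - 1) * (1 + \<beta> * sgn (y - x)) * ((b - y) powr (- (\<alpha> * \<rho>)) * (y - a) powr (- (\<alpha> * \<rho>')))"
  let ?h = "\<lambda>y. kernel_scale * (\<bar>y - x\<bar> powr (\<alpha> - 1) * (1 + \<beta> * sgn (y - x)))"
  have C: "?C > 0" using ab Beta_pos by simp
  have CG: "0 \<le> ?C * kernel_scale" using C kernel_scale_pos by (intro mult_nonneg_nonneg less_imp_le)
  have sgn_nonneg: "0 \<le> 1 + \<beta> * sgn z" for z :: real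
    using \<beta> by (cases z "0::real" rule: linorder_cases) auto
  have h: "?h y \<ge> 0" for y using kernel_scale_pos sgn_nonneg[of "y - x"] by simp
  have refl: "(1 + \<beta>) * (Gamma (\<alpha> * \<rho>) * Gamma (1 - \<alpha> * \<rho>)) = pi / (sin (pi * \<alpha> / 2) * cos (arctan c))"
    unfolding sin_Gamma_reflection_real[OF exponent_at_b] sin_rho using \<beta>_strict by simp
  have sc: "sin (pi * \<alpha> / 2) * cos (arctan c) > 0" using sin_half_pos cos_arctan_pos by simp
  have robin_eq: "?C * (kernel_scale * (pi / (sin (pi * \<alpha> / 2) * cos (arctan c)))) = robin a b"
    unfolding kernel_scale_times_reflection robin_def angle Beta_commute[of "1 - \<alpha> * \<rho>"] by (simp add: mult_ac)
  have "(\<integral>\<^sup>+y. ennreal (?h y) \<partial>eq_measure) = (\<integral>\<^sup>+y. ennreal (eq_density y) * ennreal (?h y) \<partial>lborel)"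
    by (rule nn_integral_density) auto
  also have "\<dots> = (\<integral>\<^sup>+y. ennreal (?C * kernel_scale) * (ennreal (?R y) * indicator {a<..<b} y) \<partial>lborel)"
  proof (rule nn_integral_cong)
    fix y
    show "ennreal (eq_density y) * ennreal (?h y) = ennreal (?C * kernel_scale) * (ennreal (?R y) * indicator {a<..<b} y)"
    proof (cases "y \<in> {a<..<b}")
      case True
      have "ennreal (eq_density y) * ennreal (?h y) = ennreal (eq_density y * ?h y)"
        using eq_density_nonneg by (simp add: ennreal_mult')
      also have "eq_density y * ?h y = (?C * kernel_scale) * (?R y)"
        using True unfolding eq_density_def sum_exponents by (simp add: mult_ac)
      also have "ennreal \<dots> = ennreal (?C * kernel_scale) * ennreal (?R y)"
        by (rule ennreal_mult'[OF CG])
      finally show ?thesis using True by simp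
    qed (simp add: eq_density_def)
  qed
  also have "\<dots> = ennreal (?C * kernel_scale) * ennreal ((1 + \<beta>) * (Gamma (\<alpha> * \<rho>) * Gamma (1 - \<alpha> * \<rho>)))"
  proof (subst nn_integral_cmult)
    have "(\<integral>\<^sup>+y. (ennreal (?R y) * indicator {a<..<b} y) \<partial>lborel)
      = ennreal ((1 + \<beta>) * (Gamma (\<alpha> * \<rho>) * Gamma (1 - \<alpha> * \<rho>)))"
    proof (rule riesz_potential_constant[OF ab assms exponent_at_b exponent_at_a _ \<beta>])
      show "1 < \<alpha> * \<rho> + \<alpha> * \<rho>'" unfolding sum_exponents by (rule \<alpha>)
      show "(1 + \<beta>) * Beta (\<alpha> * \<rho> + \<alpha> * \<rho>' - 1) (1 - \<alpha> * \<rho>) = (1 - \<beta>) * Beta (\<alpha> * \<rho> + \<alpha> * \<rho>' - 1) (1 - \<alpha> * \<rho>')"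
        unfolding sum_exponents by (rule balance)
    qed
    then show "ennreal (?C * kernel_scale) * (\<integral>\<^sup>+y. (ennreal (?R y) * indicator {a<..<b} y) \<partial>lborel)
      = ennreal (?C * kernel_scale) * ennreal ((1 + \<beta>) * (Gamma (\<alpha> * \<rho>) * Gamma (1 - \<alpha> * \<rho>)))" by (rule arg_cong)
  qed measurable
  also have "\<dots> = ennreal (?C * kernel_scale * (pi / (sin (pi * \<alpha> / 2) * cos (arctan c))))"
    unfolding refl by (rule ennreal_mult'[OF CG, symmetric])
  also have "?C * kernel_scale * (pi / (sin (pi * \<alpha> / 2) * cos (arctan c))) = robin a b"
    by (simp only: mult.assoc robin_eq)
  finally have nn: "(\<integral>\<^sup>+y. ennreal (?h y) \<partial>eq_measure) = ennreal (robin a b)" .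
  have "robin a b \<ge> 0"
  proof -
    have "?C * (kernel_scale * (pi / (sin (pi * \<alpha> / 2) * cos (arctan c)))) \<ge> 0"
      using C kernel_scale_pos sc by (intro mult_nonneg_nonneg) auto
    then show ?thesis by (simp only: robin_eq)
  qed
  then have "has_bochner_integral eq_measure ?h (robin a b)"
    using nn h by (intro has_bochner_integral_nn_integral) auto
  then show ?thesis
    unfolding potential_kernel_eq by (rule has_bochner_integral_integral_eq)
qed

end

context stable_parameters
begin

text \<open>
  One argument of the Beta function is the pole \<open>0\<close>. By the conventions that \<open>Gamma\<close> is \<open>0\<close> at its poles and
  that \<open>x / 0 = 0\<close>, the formula has the value \<open>0\<close>; this agrees with its limit, as the Beta function tends to
  \<open>\<infinity>\<close> there.
\<close>

lemma robin_spectrally_one_sided: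
  assumes "\<beta> = 1 \<or> \<beta> = - 1"
  shows "robin a b = 0"
proof -
  have "Beta (1 - \<alpha> * \<rho>) (1 - \<alpha> * \<rho>') = 0"
    using assms
  proof
    assume b: "\<beta> = 1"
    have "sin (pi * (\<alpha> * \<rho>)) > 0" unfolding sin_rho using b sin_half_pos cos_arctan_pos by simp
    then have "\<alpha> * \<rho> < 1" using exponent_in_unit_interval \<rho>_bounds by blast
    then have "\<alpha> * \<rho>' > 0" using sum_exponents \<alpha> by linarith
    moreover have "sin (pi * (\<alpha> * \<rho>')) = 0" unfolding sin_rho' using b by simp
    ultimately have "1 - \<alpha> * \<rho>' = 0" using exponent_eq_1[OF rho'_bounds] by simp
    then show ?thesis using Beta_pole2[of "0::real"] by simp
  next
    assume b: "\<beta> = - 1"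
    have "sin (pi * (\<alpha> * \<rho>')) > 0" unfolding sin_rho' using b sin_half_pos cos_arctan_pos by simp
    then have "\<alpha> * \<rho>' < 1" using exponent_in_unit_interval rho'_bounds by blast
    then have "\<alpha> * \<rho> > 0" using sum_exponents \<alpha> by linarith
    moreover have "sin (pi * (\<alpha> * \<rho>)) = 0" unfolding sin_rho using b by simp
    ultimately have "1 - \<alpha> * \<rho> = 0" using exponent_eq_1[OF \<rho>_bounds] by simp
    then show ?thesis using Beta_pole1[of "0::real"] by simp
  qed
  then show ?thesis by (simp add: robin_def)
qed

lemma potential_kernel_one_sided:
  "\<beta> = 1 \<Longrightarrow> x \<le> 0 \<Longrightarrow> potential_kernel (stable_exponent \<alpha> \<beta>) 0 x = 0"
  "\<beta> = - 1 \<Longrightarrow> x \<ge> 0 \<Longrightarrow> potential_kernel (stable_exponent \<alpha> \<beta>) 0 x = 0"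
  unfolding potential_kernel_eq by (cases "x = 0"; simp)+

end

theorem proposition4p11:
  fixes P :: "real \<Rightarrow> 'w measure" and X :: "real \<Rightarrow> 'w \<Rightarrow> real"
    and \<alpha> \<beta> \<rho> \<rho>' a b t :: real
    and m :: "real \<Rightarrow> real measure"
  assumes "1 < \<alpha>" "\<alpha> < 2" "- 1 \<le> \<beta>" "\<beta> \<le> 1"
    and "stable_process P X \<alpha> \<beta>"
    and "recurrent_process P X"
    and "t > 0"
    and "\<rho> = measure (P 0) {w \<in> space (P 0). X t w \<ge> 0}"
    and "\<rho>' = 1 - \<rho>"
    and "a < b"
    and "\<And>q. q > 0 \<Longrightarrow> is_capacity_measure P X (stable_exponent \<alpha> \<beta>) q {a..b} (m q)"
  shows "(- 1 < \<beta> \<and> \<beta> < 1 \<longrightarrow>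
      is_equilibrium_measure (stable_exponent \<alpha> \<beta>) {a..b} m
        (density lborel (\<lambda>y. ennreal
          ((b - a) powr (\<alpha> - 1) / Beta (1 - \<alpha> * \<rho>') (1 - \<alpha> * \<rho>)
            * (b - y) powr (- \<alpha> * \<rho>) * (y - a) powr (- \<alpha> * \<rho>')
            * indicator {a<..<b} y)))) \<and>
    (\<beta> = 1 \<longrightarrow> is_equilibrium_measure (stable_exponent \<alpha> \<beta>) {a..b} m (return borel a)) \<and>
    (\<beta> = - 1 \<longrightarrow> is_equilibrium_measure (stable_exponent \<alpha> \<beta>) {a..b} m (return borel b)) \<and>
    is_robin_constant (stable_exponent \<alpha> \<beta>) {a..b} m
      (- ((b - a) powr (\<alpha> - 1) * pi * cos (pi * \<alpha> * (\<rho> - 1 / 2)))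
        / (Gamma \<alpha> * sin (pi * \<alpha>) * Beta (1 - \<alpha> * \<rho>) (1 - \<alpha> * \<rho>')))"
proof -
  interpret stable_process P X \<alpha> \<beta> by fact
  interpret prob_space "P 0" by (rule prob)
  interpret stable_parameters \<alpha> \<beta> \<rho> \<rho>'
  proof
    show "\<rho> = 1 / 2 + arctan (\<beta> * tan (pi * \<alpha> / 2)) / (pi * \<alpha>)"
      using assms by (simp add: positivity_parameter)
  qed (use assms in auto)
  interpret stable_like_exponent "stable_exponent \<alpha> \<beta>" \<alpha> "1 + \<bar>\<beta> * tan (pi * \<alpha> / 2)\<bar>"
    using assms by (intro stable_like_exponent_stable)
  let ?\<Psi> = "stable_exponent \<alpha> \<beta>"
  have cap: "finite_measure (m q)" "sets (m q) = sets borel" "emeasure (m q) (- {a..b}) = 0"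
    "x \<in> {a..b} \<Longrightarrow> (LINT y|m q. resolvent_density ?\<Psi> q (y - x)) = 1" if "q > 0" for q x
    using assms(11)[OF that] hitting_laplace_start[of x "{a..b}" q]
    unfolding is_capacity_measure_def by auto
  have main: "is_equilibrium_measure ?\<Psi> {a..b} m M \<and> is_robin_constant ?\<Psi> {a..b} m (robin a b)"
    if "prob_space M" "sets M = sets borel" "emeasure M (- {a..b}) = 0"
      "\<And>x. x \<in> {a..b} \<Longrightarrow> (LINT y|M. potential_kernel ?\<Psi> 0 (y - x)) = robin a b" for M
    using equilibrium_measure_and_robin_constant[OF less_imp_le[OF \<open>a < b\<close>] that cap] by blast
  have dirac: "is_equilibrium_measure ?\<Psi> {a..b} m (return borel z) \<and> is_robin_constant ?\<Psi> {a..b} m (robin a b)"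
    if "z \<in> {a..b}" "\<beta> = 1 \<or> \<beta> = - 1"
      "\<And>x. x \<in> {a..b} \<Longrightarrow> potential_kernel ?\<Psi> 0 (z - x) = 0" for z
  proof (rule main)
    show "emeasure (return borel z) (- {a..b}) = 0" using that by simp
    show "(LINT y|return borel z. potential_kernel ?\<Psi> 0 (y - x)) = robin a b" if "x \<in> {a..b}" for x
      using \<open>\<And>x. x \<in> {a..b} \<Longrightarrow> potential_kernel ?\<Psi> 0 (z - x) = 0\<close>[OF that]
        robin_spectrally_one_sided[OF \<open>\<beta> = 1 \<or> \<beta> = - 1\<close>]
      by (subst integral_return) auto
  qed (auto intro: prob_space_return)
  consider "- 1 < \<beta>" "\<beta> < 1" | "\<beta> = 1" | "\<beta> = - 1" using \<beta> by linarith
  then show ?thesis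
  proof cases
    case 1
    interpret two_sided_stable \<alpha> \<beta> \<rho> \<rho>' a b
      using 1 assms by unfold_locales auto
    show ?thesis
      using main[OF prob_space_eq_measure _ supp_eq_measure potential_eq_measure] 1
      unfolding robin_def eq_density_def by simp
  next
    case 2
    show ?thesis
      using dirac[of a] potential_kernel_one_sided(1) 2 \<open>a < b\<close> unfolding robin_def by simp
  next
    case 3
    show ?thesis
      using dirac[of b] potential_kernel_one_sided(2) 3 \<open>a < b\<close> unfolding robin_def by simp
  qed
qed

end
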